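(* Let $U$ be an open neighbourhood of $\mathbf{0}\in\mathbb{C}^n$, let $D$ be an open disc centred at $0\in\mathbb{C}$, and let $f\colon (D\times U, D\times\{\mathbf{0}\})\to(\mathbb{C},0)$, $(t,\mathbf{z})\mapsto f(t,\mathbf{z})=f_t(\mathbf{z})$, be a polynomial function (so $f(D\times\{\mathbf{0}\})=\{0\}$). If the family of polynomial functions $\{f_t\}$ is admissible, then, for a sufficiently small open neighbourhood $\mathscr{U}\subseteq D\times U$ of the origin of $\mathbb{C}\times\mathbb{C}^n$, the canonical stratification $$\mathscr{S}=\{A_I,B_I\,;\,I\in\mathscr{I}_{nv}(f_0)\}\cup\{C_I\,;\,I\in\mathscr{I}_v(f_0)\}$$ of $\mathscr{U}\cap(\mathbb{C}\times\mathbb{C}^n)$ is a Whitney stratification, and hence the corresponding family of hypersurfaces $\{V(f_t)\}$ is Whitney equisingular. Here $$A_I:=\mathscr{U}\cap V(f)\cap(\mathbb{C}\times\mathbb{C}^{*I}),\qquad B_I:=\mathscr{U}\cap\bigl((\mathbb{C}\times\mathbb{C}^{*I})\setminus (V(f)\cap(\mathbb{C}\times\mathbb{C}^{*I}))\bigr)\qquad (I\in\mathscr{I}_{nv}(f_0)),$$ $$C_I:=\mathscr{U}\cap(\mathbb{C}\times\mathbb{C}^{*I})\qquad (I\in\mathscr{I}_v(f_0)).$$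
   Context: **Coordinate subspaces.** For $I\subseteq\{1,\dots,n\}$, $\mathbb{C}^I:=\{\mathbf z\in\mathbb{C}^n : z_i=0 \text{ if } i\notin I\}$ and $\mathbb{C}^{*I}:=\{\mathbf z\in\mathbb{C}^n : z_i=0 \text{ if and only if } i\notin I\}$; in particular $\mathbb{C}^{\emptyset}=\mathbb{C}^{*\emptyset}=\{\mathbf 0\}$. $V(f_t)$ is the hypersurface in $U$ defined by $f_t$, and $V(f):=f^{-1}(0)$. Let $h(\mathbf z)=\sum_\alpha c_\alpha \mathbf z^\alpha$ be a polynomial function on a neighbourhood of $\mathbf 0\in\mathbb{C}^n$ with $h(\mathbf 0)=0$. $\mathscr{I}_{nv}(h)$ (respectively $\mathscr{I}_v(h)$) is the set of $I\subseteq\{1,\dots,n\}$ such that $h|_{\mathbb{C}^I}\not\equiv0$ (respectively $h|_{\mathbb{C}^I}\equiv 0$). For $I\in\mathscr{I}_v(h)$, $\mathbb{C}^I$ is called a vanishing coordinates subspace. **Newton polygon and boundaries.** The Newton polygon $\Gamma_+(h;\mathbf z)$ is the convex hull in $\mathbb{R}_+^n$ of $\bigcup_{c_\alpha\neq0}(\alpha+\mathbb{R}_+^n)$, where $\mathbb{R}_+^n=\{\mathbf x\in\mathbb{R}^n: x_i\ge0 \text{ for all } i\}$. The Newton boundary $\Gamma(h;\mathbf z)$ is the union of the compact faces of $\Gamma_+(h;\mathbf z)$. For weights $\mathbf w\in\mathbb{N}^n\setminus\{\mathbf 0\}$ (where $0\in\mathbb{N}$), $\Delta_{\mathbf w}$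 is the face of $\Gamma_+(h;\mathbf z)$ on which $\mathbf x\mapsto\sum_i x_iw_i$ takes its minimal value on $\Gamma_+(h;\mathbf z)$, and $I_{\mathbf w}:=\{i: w_i=0\}$. A non-compact face $\Delta$ of $\Gamma_+(h;\mathbf z)$ is essential if there is $\mathbf w\in\mathbb{N}^n\setminus\{\mathbf 0\}$ such that (i) $\Delta=\Delta_{\mathbf w}$ and $h|_{\mathbb{C}^{I_{\mathbf w}}}\equiv0$; (ii) for any $i\in I_{\mathbf w}$ and any $\alpha\in\Delta$, the half-line $\alpha+\mathbb{R}_+\mathbf e_i$ is contained in $\Delta$, where $\mathbf e_i$ is the $i$-th unit vector. The set $I_{\mathbf w}$ does not depend on the choice of such $\mathbf w$ and is denoted by $I_\Delta$. The non-compact Newton boundary $\Gamma_{nc}(h;\mathbf z)$ is obtained from $\Gamma(h;\mathbf z)$ by adding the essential non-compact faces. **Non-degeneracy and local tameness.** For a face $\Delta$, the face function is $h_\Delta(\mathbf z):=\sum_{\alpha\in\Delta}c_\alpha\mathbf z^\alpha$. $h$ is non-degenerate if for every compact face $\Delta\subseteq\Gamma(h;\mathbf z)$, $h_\Delta$ has no critical point on $(\mathbb{C}^* )^n$. For an essential non-compact face $\Delta$ with $I_\Delta=\{i_1,\dots,i_m\}$, $h_\Delta$ is locally tame if there exists a number $r(h_\Delta)>0$ such that for all $u_{i_1},\dots,u_{i_m}\in\mathbb{C}^*$ with $|u_{i_1}|^2+\cdots+|u_{i_m}|^2<r(h_\Delta)^2$, $h_\Delta$ has no critical point in $\{\mathbf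 z\in(\mathbb{C}^* )^n: z_{i_j}=u_{i_j},\,1\le j\le m\}$ as a function of the remaining $n-m$ variables. $h$ is locally tame along the vanishing coordinates subspaces if for every $I\in\mathscr{I}_v(h)$ and every essential non-compact face $\Delta$ with $I_\Delta=I$, $h_\Delta$ is locally tame. In that case, $r_I(h):=\inf_{I_\Delta=I}r(h_\Delta)$ and $r_{nc}(h):=\inf_{I\in\mathscr{I}_v(h)}r_I(h)$ (where, for each essential non-compact face $\Delta$ with $I_\Delta=\{i_1,\dots,i_m\}$, $r(h_\Delta)$ is a choice of a positive number, possibly $+\infty$, such that for all $u_{i_1},\dots,u_{i_m}\in\mathbb{C}^*$ with $|u_{i_1}|^2+\cdots+|u_{i_m}|^2<r(h_\Delta)^2$, $h_\Delta$ has no critical point in $\{\mathbf z\in(\mathbb{C}^* )^n: z_{i_j}=u_{i_j},\,1\le j\le m\}$ as a function of the remaining $n-m$ variables; an infimum over the empty set is $+\infty$). **Admissible family.** $\{f_t\}$ is admissible (at $t=0$) if for all sufficiently small $t$: (I) $\Gamma_{nc}(f_t;\mathbf z)$ is independent of $t$ (in particular $\mathscr{I}_{nv}(f_t)$ and $\mathscr{I}_v(f_t)$ are independent of $t$); (II) $f_t$ is non-degenerate and locally tame along the vanishing coordinates subspaces; and, furthermore, there is $\rho>0$ such that $\inf\{R,r_{nc}(f_t)\}\ge\rho$ for all sufficiently small $t$. Here $R>0$ is a number, which exists under (I) and (II), such that for any $I\in\mathscr{I}_{nv}(f_0)$ and any sufficiently small $t$, $V(f_t)\cap\mathbb{C}^{*I}\cap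 B_R$ is non-singular and intersects $S_r$ transversely for any $r<R$, where $B_R$ (respectively $S_r$) is the open ball of radius $R$ (respectively the sphere of radius $r$) centred at $\mathbf 0\in\mathbb{C}^n$. It follows that, for $\mathscr{U}$ sufficiently small, $V(f)\cap(\mathbb{C}\times\mathbb{C}^{*I})$ is non-singular in $\mathscr{U}$ for every $I\in\mathscr{I}_{nv}(f_0)$, so that $\mathscr{S}$ is a partition of $\mathscr{U}$ into complex analytic submanifolds for which $\mathscr{U}\cap V(f)$ is a union of strata; the stratum $C_\emptyset$ is the $t$-axis $\mathscr{U}\cap(\mathbb{C}\times\{\mathbf 0\})$. **Whitney stratification.** A stratification (partition into complex analytic submanifolds) of a subset of $\mathbb{C}^N$ is a Whitney stratification if for each stratum $S$ the closure $\bar S$ and $\bar S\setminus S$ are analytic sets, and for any pair of strata $(S_2,S_1)$ and any point $\mathbf p\in S_1\cap\bar S_2$, $S_2$ is Whitney $(b)$-regular over $S_1$ at $\mathbf p$: for any sequences $\{\mathbf p_k\}$ in $S_1$, $\{\mathbf q_k\}$ in $S_2$ and $\{a_k\}$ in $\mathbb{C}$ with $\mathbf p_k\to\mathbf p$, $\mathbf q_k\to\mathbf p$, $T_{\mathbf q_k}S_2\to T$ and $a_k(\mathbf p_k-\mathbf q_k)\to v$, one has $v\in T$. The frontier condition is not required. **Whitney equisingularity.** The family $\{V(f_t)\}$ is Whitney equisingular if there exists a Whitney stratification of $V(f)$ in an open neighbourhood $\mathscr{U}$ of the origin $(0,\mathbf 0)\in\mathbb{C}\times\mathbb{C}^n$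 such that the $t$-axis $\mathscr{U}\cap(D\times\{\mathbf 0\})$ is a stratum. *)

theory Defs
  imports "HOL-Analysis.Analysis" "HOL-Library.Poly_Mapping"
    "HOL-Computational_Algebra.Polynomial"
begin

section \<open>Polynomial functions\<close>

text \<open>
  A polynomial in the coordinates of \<open>complex^'n\<close> is a finitely supported map from exponent
  vectors to coefficients.  A polynomial \<open>f(t,z)\<close> is an element of \<open>C[t][z]\<close>: a finitely supported
  map from exponent vectors of \<open>z\<close> to univariate polynomials in \<open>t\<close>.  (A polynomial function on a
  nonempty open set is the same thing as a polynomial.)
\<close>

type_synonym 'n tspace = "complex \<times> (complex^'n)"
type_synonym 'n mpol = "(nat^'n) \<Rightarrow>\<^sub>0 complex"
type_synonym 'n mpol_family = "(nat^'n) \<Rightarrow>\<^sub>0 complex poly"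

definition poly_fun :: "'n::finite mpol \<Rightarrow> complex^'n \<Rightarrow> complex" where
  "poly_fun h z = (\<Sum>\<alpha>\<in>Poly_Mapping.keys h. Poly_Mapping.lookup h \<alpha> * (\<Prod>i\<in>UNIV. (z $ i) ^ (\<alpha> $ i)))"

definition family_at :: "'n::finite mpol_family \<Rightarrow> complex \<Rightarrow> 'n mpol" where
  "family_at f t = Poly_Mapping.map (\<lambda>p. poly p t) f"

lemma lookup_family_at: "Poly_Mapping.lookup (family_at f t) \<alpha> = poly (Poly_Mapping.lookup f \<alpha>) t"
  by (simp add: family_at_def Poly_Mapping.map.rep_eq when_def)

definition fibre_zeros :: "(complex^'n) set \<Rightarrow> 'n::finite mpol_family \<Rightarrow> complex \<Rightarrow> (complex^'n) set" where
  "fibre_zeros U f t = {z \<in> U. poly_fun (family_at f t) z = 0}"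

definition total_zeros ::
    "complex set \<Rightarrow> (complex^'n) set \<Rightarrow> 'n::finite mpol_family \<Rightarrow> 'n tspace set" where
  "total_zeros D U f = {(t, z). t \<in> D \<and> z \<in> fibre_zeros U f t}"


section \<open>Coordinate subspaces\<close>

definition coord_space :: "'n::finite set \<Rightarrow> (complex^'n) set" where
  "coord_space I = {z. \<forall>i. i \<notin> I \<longrightarrow> z $ i = 0}"

definition coord_torus :: "'n::finite set \<Rightarrow> (complex^'n) set" where
  "coord_torus I = {z. \<forall>i. z $ i = 0 \<longleftrightarrow> i \<notin> I}"

definition vanishing_sets :: "'n::finite mpol \<Rightarrow> 'n set set" where
  "vanishing_sets h = {I. \<forall>z\<in>coord_space I. poly_fun h z = 0}"

definition nonvanishing_sets :: "'n::finite mpol \<Rightarrow> 'n set set" where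
  "nonvanishing_sets h = {I. \<exists>z\<in>coord_space I. poly_fun h z \<noteq> 0}"


section \<open>Newton polygon and Newton boundaries\<close>

definition real_exponent :: "nat^'n \<Rightarrow> real^'n::finite" where
  "real_exponent \<alpha> = (\<chi> i. real (\<alpha> $ i))"

definition newton_polygon :: "'n::finite mpol \<Rightarrow> (real^'n) set" where
  "newton_polygon h =
     convex hull (\<Union>\<alpha>\<in>Poly_Mapping.keys h. {real_exponent \<alpha> + x | x. \<forall>i. 0 \<le> x $ i})"

definition compact_faces :: "'n::finite mpol \<Rightarrow> (real^'n) set set" where
  "compact_faces h = {\<Delta>. \<Delta> face_of newton_polygon h \<and> \<Delta> \<noteq> {} \<and> compact \<Delta>}"

definition newton_boundary :: "'n::finite mpol \<Rightarrow> (real^'n) set" where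
  "newton_boundary h = \<Union> (compact_faces h)"

definition weight_value :: "nat^'n \<Rightarrow> real^'n \<Rightarrow> real" where
  "weight_value w x = (\<Sum>i\<in>UNIV. x $ i * real (w $ i))"

definition weight_face :: "'n::finite mpol \<Rightarrow> nat^'n \<Rightarrow> (real^'n) set" where
  "weight_face h w =
     {x \<in> newton_polygon h. \<forall>y\<in>newton_polygon h. weight_value w x \<le> weight_value w y}"

definition weight_zeros :: "nat^'n \<Rightarrow> 'n::finite set" where
  "weight_zeros w = {i. w $ i = 0}"

text \<open>
  \<open>essential_face h I \<Delta>\<close> says that \<open>\<Delta>\<close> is an essential non-compact face with \<open>I\<^sub>\<Delta> = I\<close>.  Since
  \<open>I\<^sub>\<Delta>\<close> does not depend on the weight used to define it, \<open>\<Delta>\<close> determines \<open>I\<close>.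
\<close>

definition essential_face :: "'n::finite mpol \<Rightarrow> 'n set \<Rightarrow> (real^'n) set \<Rightarrow> bool" where
  "essential_face h I \<Delta> \<longleftrightarrow>
     \<Delta> face_of newton_polygon h \<and> \<not> compact \<Delta> \<and>
     (\<exists>w. w \<noteq> 0 \<and> weight_zeros w = I \<and>
        \<Delta> = weight_face h w \<and> (\<forall>z\<in>coord_space I. poly_fun h z = 0) \<and>
        (\<forall>i\<in>I. \<forall>\<alpha>\<in>\<Delta>. \<forall>s\<ge>0. \<alpha> + s *\<^sub>R axis i 1 \<in> \<Delta>))"

definition noncompact_newton_boundary :: "'n::finite mpol \<Rightarrow> (real^'n) set" where
  "noncompact_newton_boundary h = newton_boundary h \<union> \<Union> {\<Delta>. \<exists>I. essential_face h I \<Delta>}"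


section \<open>Non-degeneracy and local tameness\<close>

definition face_fun :: "'n::finite mpol \<Rightarrow> (real^'n) set \<Rightarrow> complex^'n \<Rightarrow> complex" where
  "face_fun h \<Delta> z =
     (\<Sum>\<alpha>\<in>{\<alpha> \<in> Poly_Mapping.keys h. real_exponent \<alpha> \<in> \<Delta>}.
        Poly_Mapping.lookup h \<alpha> * (\<Prod>i\<in>UNIV. (z $ i) ^ (\<alpha> $ i)))"

definition partial_deriv :: "'n \<Rightarrow> (complex^'n \<Rightarrow> complex) \<Rightarrow> complex^'n::finite \<Rightarrow> complex" where
  "partial_deriv i g z = deriv (\<lambda>w. g (\<chi> j. if j = i then w else z $ j)) (z $ i)"

text \<open>\<open>z\<close> is a critical point of \<open>g\<close> as a function of the variables \<open>z\<^sub>i\<close> with \<open>i \<in> J\<close>, the other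
  variables being fixed.\<close>

definition critical_in :: "'n::finite set \<Rightarrow> (complex^'n \<Rightarrow> complex) \<Rightarrow> complex^'n \<Rightarrow> bool" where
  "critical_in J g z \<longleftrightarrow> (\<forall>i\<in>J. partial_deriv i g z = 0)"

definition nondegenerate :: "'n::finite mpol \<Rightarrow> bool" where
  "nondegenerate h \<longleftrightarrow>
     (\<forall>\<Delta>\<in>compact_faces h. \<forall>z\<in>coord_torus UNIV. \<not> critical_in UNIV (face_fun h \<Delta>) z)"

definition tame_radius :: "'n::finite mpol \<Rightarrow> 'n set \<Rightarrow> (real^'n) set \<Rightarrow> ereal \<Rightarrow> bool" where
  "tame_radius h I \<Delta> r \<longleftrightarrow>
     0 < r \<and>
     (\<forall>z\<in>coord_torus UNIV. ereal (\<Sum>i\<in>I. (norm (z $ i))\<^sup>2) < r\<^sup>2 \<longrightarrow>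
        \<not> critical_in (- I) (face_fun h \<Delta>) z)"

definition locally_tame :: "'n::finite mpol \<Rightarrow> bool" where
  "locally_tame h \<longleftrightarrow>
     (\<forall>I\<in>vanishing_sets h. \<forall>\<Delta>. essential_face h I \<Delta> \<longrightarrow> (\<exists>r::real. tame_radius h I \<Delta> (ereal r)))"

text \<open>A choice \<open>r\<close> of radii \<open>r(h\<^sub>\<Delta>)\<close>, possibly infinite, and the resulting \<open>r\<^sub>I(h)\<close> and \<open>r\<^sub>n\<^sub>c(h)\<close>.\<close>

definition tame_choice :: "'n::finite mpol \<Rightarrow> ((real^'n) set \<Rightarrow> ereal) \<Rightarrow> bool" where
  "tame_choice h r \<longleftrightarrow>
     (\<forall>I\<in>vanishing_sets h. \<forall>\<Delta>. essential_face h I \<Delta> \<longrightarrow> tame_radius h I \<Delta> (r \<Delta>))"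

definition radius_along :: "((real^'n) set \<Rightarrow> ereal) \<Rightarrow> 'n::finite mpol \<Rightarrow> 'n set \<Rightarrow> ereal" where
  "radius_along r h I = (INF \<Delta>\<in>{\<Delta>. essential_face h I \<Delta>}. r \<Delta>)"

definition radius_nc :: "((real^'n) set \<Rightarrow> ereal) \<Rightarrow> 'n::finite mpol \<Rightarrow> ereal" where
  "radius_nc r h = (INF I\<in>vanishing_sets h. radius_along r h I)"


section \<open>Tangent spaces and transversality\<close>

text \<open>Velocities of curves in \<open>S\<close> through \<open>p\<close>; this is used for smooth submanifolds only.\<close>

definition tangent_space :: "'a::real_normed_vector set \<Rightarrow> 'a \<Rightarrow> 'a set" where
  "tangent_space S p =
     {v. \<exists>\<gamma> e. 0 < (e::real) \<and> \<gamma> 0 = p \<and> \<gamma> ` {-e<..<e} \<subseteq> S \<and> (\<gamma> has_vector_derivative v) (at 0)}"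

definition transverse_at :: "'a::real_normed_vector set \<Rightarrow> 'a set \<Rightarrow> 'a \<Rightarrow> bool" where
  "transverse_at S T p \<longleftrightarrow> {u + v | u v. u \<in> tangent_space S p \<and> v \<in> tangent_space T p} = UNIV"


section \<open>Admissible families\<close>

text \<open>
  Non-singularity of the hypersurface \<open>V(f\<^sub>t)\<close> in the torus of \<open>I\<close> is meant for the defining
  equation: the restriction of \<open>f\<^sub>t\<close> to the torus has no critical point on its zero set.
\<close>

definition stable_radius :: "(complex^'n) set \<Rightarrow> 'n::finite mpol_family \<Rightarrow> real \<Rightarrow> bool" where
  "stable_radius U f R \<longleftrightarrow>
     0 < R \<and>
     (\<forall>I\<in>nonvanishing_sets (family_at f 0). \<forall>\<^sub>F t in nhds 0.
        (\<forall>z\<in>fibre_zeros U f t \<inter> coord_torus I \<inter> ball 0 R.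
           \<not> critical_in I (poly_fun (family_at f t)) z) \<and>
        (\<forall>r. 0 < r \<and> r < R \<longrightarrow>
           (\<forall>z\<in>fibre_zeros U f t \<inter> coord_torus I \<inter> ball 0 R \<inter> sphere 0 r.
              transverse_at (fibre_zeros U f t \<inter> coord_torus I \<inter> ball 0 R) (sphere 0 r) z)))"

definition admissible :: "(complex^'n) set \<Rightarrow> 'n::finite mpol_family \<Rightarrow> bool" where
  "admissible U f \<longleftrightarrow>
     (\<forall>\<^sub>F t in nhds 0.
        noncompact_newton_boundary (family_at f t) = noncompact_newton_boundary (family_at f 0)) \<and>
     (\<forall>\<^sub>F t in nhds 0. nondegenerate (family_at f t) \<and> locally_tame (family_at f t)) \<and>
     (\<exists>R r. stable_radius U f R \<and>
        (\<forall>\<^sub>F t in nhds 0. tame_choice (family_at f t) (r t)) \<and>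
        (\<exists>\<rho>>0. \<forall>\<^sub>F t in nhds 0. ereal \<rho> \<le> min (ereal R) (radius_nc (r t) (family_at f t))))"


section \<open>Complex analytic sets and submanifolds\<close>

definition cscale :: "complex \<Rightarrow> 'n tspace \<Rightarrow> 'n::finite tspace" where
  "cscale c p = (c * fst p, c *s snd p)"

lemma vector_space_cscale: "vector_space cscale"
  by unfold_locales
    (auto simp: cscale_def vec_eq_iff algebra_simps)

definition holo_fun_on ::
    "('n::finite tspace \<Rightarrow> complex) \<Rightarrow> 'n tspace set \<Rightarrow> bool" where
  "holo_fun_on g W \<longleftrightarrow>
     (\<forall>p\<in>W. \<exists>A. (g has_derivative A) (at p) \<and> (\<forall>c v. A (cscale c v) = c * A v))"

definition holo_map_on ::
    "('n::finite tspace \<Rightarrow> 'n tspace) \<Rightarrow> 'n tspace set \<Rightarrow> bool" where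
  "holo_map_on \<phi> W \<longleftrightarrow>
     holo_fun_on (\<lambda>p. fst (\<phi> p)) W \<and> (\<forall>i. holo_fun_on (\<lambda>p. snd (\<phi> p) $ i) W)"

definition analytic_subset ::
    "'n::finite tspace set \<Rightarrow> 'n tspace set \<Rightarrow> bool" where
  "analytic_subset W X \<longleftrightarrow>
     X \<subseteq> W \<and>
     (\<forall>p\<in>W. \<exists>N G. open N \<and> p \<in> N \<and> N \<subseteq> W \<and> finite G \<and> (\<forall>g\<in>G. holo_fun_on g N) \<and>
        X \<inter> N = {q \<in> N. \<forall>g\<in>G. g q = 0})"

text \<open>Submanifolds are not assumed closed; the model subspace \<open>L\<close> does not depend on the point, so
  they have constant dimension.\<close>

definition complex_submanifold :: "'n::finite tspace set \<Rightarrow> bool" where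
  "complex_submanifold S \<longleftrightarrow>
     (\<exists>L. module.subspace cscale L \<and>
       (\<forall>p\<in>S. \<exists>W W' \<phi> \<psi>. open W \<and> p \<in> W \<and> open W' \<and> homeomorphism W W' \<phi> \<psi> \<and>
          holo_map_on \<phi> W \<and> holo_map_on \<psi> W' \<and> \<phi> ` (S \<inter> W) = L \<inter> W'))"


section \<open>Whitney stratifications\<close>

text \<open>Convergence in the Grassmannian, expressed through the orthogonal projections
  onto the subspaces.\<close>

definition subspaces_tendsto :: "(nat \<Rightarrow> 'a::euclidean_space set) \<Rightarrow> 'a set \<Rightarrow> bool" where
  "subspaces_tendsto L T \<longleftrightarrow>
     subspace T \<and> (\<forall>x. (\<lambda>k. closest_point (L k) x) \<longlonglongrightarrow> closest_point T x)"

definition whitney_b_regular ::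
    "'n::finite tspace set \<Rightarrow> 'n tspace set \<Rightarrow> 'n tspace \<Rightarrow> bool"
  where
  "whitney_b_regular S2 S1 p \<longleftrightarrow>
     (\<forall>x y a T v.
        (\<forall>k::nat. x k \<in> S1) \<and> (\<forall>k. y k \<in> S2) \<and> x \<longlonglongrightarrow> p \<and> y \<longlonglongrightarrow> p \<and>
        subspaces_tendsto (\<lambda>k. tangent_space S2 (y k)) T \<and>
        (\<lambda>k. cscale (a k) (x k - y k)) \<longlonglongrightarrow> v \<longrightarrow> v \<in> T)"

text \<open>
  \<open>whitney_stratification W X \<S>\<close>: \<open>\<S>\<close> is a Whitney stratification of \<open>X\<close>, where \<open>X\<close> lies in the
  open set \<open>W\<close>; closures and analyticity are relative to \<open>W\<close>.  Strata may be empty or disconnected.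
  As usual a stratification is locally finite; otherwise points could be taken as strata, and every
  set in which the \<open>t\<close>-axis is a closed submanifold would trivially admit a Whitney stratification
  having the axis as a stratum.
\<close>

definition whitney_stratification ::
    "'n::finite tspace set \<Rightarrow> 'n tspace set \<Rightarrow>
     'n tspace set set \<Rightarrow> bool" where
  "whitney_stratification W X \<S> \<longleftrightarrow>
     open W \<and> X \<subseteq> W \<and> disjoint \<S> \<and> \<Union> \<S> = X \<and> locally_finite_in (top_of_set X) \<S> \<and>
     (\<forall>S\<in>\<S>. complex_submanifold S \<and>
        analytic_subset W (closure S \<inter> W) \<and> analytic_subset W ((closure S \<inter> W) - S)) \<and>
     (\<forall>S1\<in>\<S>. \<forall>S2\<in>\<S>. \<forall>p\<in>S1 \<inter> closure S2. whitney_b_regular S2 S1 p)"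

definition whitney_equisingular ::
    "complex set \<Rightarrow> (complex^'n) set \<Rightarrow> 'n::finite mpol_family \<Rightarrow> bool" where
  "whitney_equisingular D U f \<longleftrightarrow>
     (\<exists>W \<S>. open W \<and> (0, 0) \<in> W \<and> W \<subseteq> D \<times> U \<and>
        whitney_stratification W (W \<inter> total_zeros D U f) \<S> \<and> W \<inter> (D \<times> {0}) \<in> \<S>)"


section \<open>The canonical stratification\<close>

definition stratum_A ::
    "complex set \<Rightarrow> (complex^'n) set \<Rightarrow> 'n::finite mpol_family \<Rightarrow> 'n tspace set \<Rightarrow>
     'n set \<Rightarrow> 'n tspace set" where
  "stratum_A D U f W I = W \<inter> total_zeros D U f \<inter> (UNIV \<times> coord_torus I)"

definition stratum_B ::
    "complex set \<Rightarrow> (complex^'n) set \<Rightarrow> 'n::finite mpol_family \<Rightarrow> 'n tspace set \<Rightarrow>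
     'n set \<Rightarrow> 'n tspace set" where
  "stratum_B D U f W I =
     W \<inter> ((UNIV \<times> coord_torus I) - (total_zeros D U f \<inter> (UNIV \<times> coord_torus I)))"

definition stratum_C ::
    "'n::finite tspace set \<Rightarrow> 'n set \<Rightarrow> 'n tspace set" where
  "stratum_C W I = W \<inter> (UNIV \<times> coord_torus I)"

definition canonical_stratification ::
    "complex set \<Rightarrow> (complex^'n) set \<Rightarrow> 'n::finite mpol_family \<Rightarrow> 'n tspace set \<Rightarrow>
     'n tspace set set" where
  "canonical_stratification D U f W =
     stratum_A D U f W ` nonvanishing_sets (family_at f 0) \<union>
     stratum_B D U f W ` nonvanishing_sets (family_at f 0) \<union>
     stratum_C W ` vanishing_sets (family_at f 0)"

end

theory Submission
  imports Defs "HOL-Complex_Analysis.Great_Picard"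
begin

text \<open>
  Let \<open>F(t,z) = \<Sum>\<^sub>\<alpha> c\<^sub>\<alpha>(t) z\<^sup>\<alpha>\<close>.  The only pairs of strata for which Whitney's condition (b) is not
  immediate are those with \<open>y\<^sub>k \<in> A\<^sub>J\<close> converging to a point \<open>p\<close> of a vanishing stratum \<open>C\<^sub>I\<close>.
  In place of the curve selection lemma, the sequence \<open>(-ln |z\<^sub>j(y\<^sub>k)|)\<^sub>j\<close> is analysed directly: up
  to a bounded sequence it lies in the orthogonal complement of the differences of the exponents of
  the dominant monomials, and simultaneous Dirichlet approximation yields a weight \<open>w\<close> with natural
  entries and zero set \<open>I\<close>, whose face \<open>\<Delta>\<close> carries exactly the dominant monomials.  After rescaling,
  \<open>z\<^sub>j \<partial>\<^sub>jF\<close> converges to \<open>D\<^sub>j = b\<^sub>j \<partial>\<^sub>jF\<^sub>\<Delta>(b)\<close> at a point \<open>b\<close> of the torus with \<open>F\<^sub>\<Delta>(b) = 0\<close> and with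
  \<open>I\<close>-coordinates those of \<open>p\<close>.  Local tameness (non-degeneracy if \<open>I = {}\<close>) gives \<open>D\<^sub>j \<noteq> 0\<close> for some
  \<open>j \<notin> I\<close>.  If the limit \<open>v\<close> of the secants has \<open>v\<^sub>j = 0\<close> for such a \<open>j\<close>, then \<open>v\<close> lies in the limit of
  the tangent spaces.  Otherwise the coordinates \<open>z\<^sub>j\<close> with \<open>D\<^sub>j \<noteq> 0\<close> are comparable, so they have the
  same weight and Euler's identity for the weighted homogeneous \<open>F\<^sub>\<Delta>\<close> gives \<open>\<Sum>\<^sub>j D\<^sub>j = 0\<close>, which
  suffices as well.
\<close>

section \<open>Polynomial functions on lines\<close>

text \<open>Two difficulties lie outside the estimate near a vanishing stratum. A coefficient of F
  may vanish at particular t, so an exponent of F need not occur in f_t. But it occurs in f_s for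
  some s close to 0, and the non-compact Newton boundary determines the whole polygon. Constancy of
  the boundary thus puts every exponent of F into the polygon of each f_t, and one exponent set
  serves for all small t. The second difficulty is the analyticity of the closure of A_J: on the
  plane of J, F can have monomial factors whose zeros need not lie in the closure. They are divided
  out, and the zeros of the quotient in the torus are shown to be dense. The other pairs of strata
  are easier for two reasons: B_J and C_J are open in a coordinate plane, so their tangent spaces
  are constant, and at a point of A_I some dF/dz_j with j in I is nonzero, which makes the tangent
  spaces of A_J continuous there. Weights are also assigned to coordinates outside J, because
  tameness refers to faces of the full polygon and to points with all coordinates nonzero.\<close>

definition monomial_at :: "nat^'n \<Rightarrow> complex^'n::finite \<Rightarrow> complex" where
  "monomial_at \<alpha> z = (\<Prod>i\<in>UNIV. (z $ i) ^ (\<alpha> $ i))"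

definition family_sum ::
    "(nat^'n) set \<Rightarrow> (nat^'n \<Rightarrow> complex poly) \<Rightarrow> 'n::finite tspace \<Rightarrow> complex" where
  "family_sum K c q = (\<Sum>\<alpha>\<in>K. poly (c \<alpha>) (fst q) * monomial_at \<alpha> (snd q))"

definition total_fun :: "'n::finite mpol_family \<Rightarrow> 'n tspace \<Rightarrow> complex" where
  "total_fun f = family_sum (Poly_Mapping.keys f) (Poly_Mapping.lookup f)"

definition supported :: "'n::finite set \<Rightarrow> nat^'n \<Rightarrow> bool" where
  "supported J \<alpha> \<longleftrightarrow> (\<forall>i. i \<notin> J \<longrightarrow> \<alpha> $ i = 0)"

definition coord_plane :: "'n::finite set \<Rightarrow> 'n tspace set" where
  "coord_plane J = UNIV \<times> coord_space J"

lemma keys_family_at_subset: "Poly_Mapping.keys (family_at f t) \<subseteq> Poly_Mapping.keys f"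
  by (auto simp: in_keys_iff lookup_family_at)

lemma poly_fun_family_at: "poly_fun (family_at f t) z = total_fun f (t, z)"
  unfolding poly_fun_def total_fun_def family_sum_def monomial_at_def
  by (rule sum.mono_neutral_cong_left)
     (auto simp: keys_family_at_subset lookup_family_at in_keys_iff)

lemma monomial_at_eq_0:
  assumes "z \<in> coord_space J" "\<not> supported J \<alpha>"
  shows "monomial_at \<alpha> z = 0"
  using assms unfolding monomial_at_def coord_space_def supported_def
  by (auto simp: prod_zero_iff)

lemma monomial_at_nonzero:
  assumes "z \<in> coord_torus J" "supported J \<alpha>"
  shows "monomial_at \<alpha> z \<noteq> 0"
  using assms unfolding monomial_at_def coord_torus_def supported_def
  by (auto simp: prod_zero_iff)

section \<open>Coordinate planes in the product of the t-line with the z-space\<close>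

lemma coord_plane_iff: "q \<in> coord_plane J \<longleftrightarrow> (\<forall>i. i \<notin> J \<longrightarrow> snd q $ i = 0)"
  by (cases q) (auto simp: coord_plane_def coord_space_def)

lemma coord_plane_add: "p \<in> coord_plane J \<Longrightarrow> q \<in> coord_plane J \<Longrightarrow> p + q \<in> coord_plane J"
  and coord_plane_diff: "p \<in> coord_plane J \<Longrightarrow> q \<in> coord_plane J \<Longrightarrow> p - q \<in> coord_plane J"
  and coord_plane_cscale: "p \<in> coord_plane J \<Longrightarrow> cscale c p \<in> coord_plane J"
  and coord_plane_scaleR: "p \<in> coord_plane J \<Longrightarrow> a *\<^sub>R p \<in> coord_plane J"
  and coord_plane_0: "0 \<in> coord_plane J"
  by (simp_all add: coord_plane_iff cscale_def)

lemma coord_plane_mono: "I \<subseteq> J \<Longrightarrow> coord_plane I \<subseteq> coord_plane J"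
  using coord_plane_iff by blast

lemma closed_coord_plane: "closed (coord_plane J)"
proof -
  have "coord_plane J = (\<Inter>i\<in>-J. {q. snd q $ i = 0})"
    by (auto simp: coord_plane_iff)
  thus ?thesis
    by (auto intro!: closed_INT closed_Collect_eq continuous_intros)
qed

lemma module_subspace_coord_plane: "module.subspace cscale (coord_plane J)"
  unfolding module.subspace_def[OF vector_space_cscale[folded module_iff_vector_space]]
  by (simp add: coord_plane_add coord_plane_0 coord_plane_cscale)

lemma cscale_simps [simp]:
  "fst (cscale c q) = c * fst q" "snd (cscale c q) = c *s snd q"
  "cscale 0 q = 0" "cscale 1 q = q" "cscale c 0 = 0"
  by (simp_all add: cscale_def zero_prod_def)

lemma norm_cscale [simp]: "norm (cscale c q) = norm c * norm q" for q :: "'n::finite tspace"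
proof -
  have "norm (c *s z) = norm c * norm z" for z :: "complex^'n"
    by (simp add: norm_vec_def norm_mult L2_set_left_distrib L2_set_right_distrib)
  thus ?thesis
    by (cases q) (simp add: cscale_def norm_Pair norm_mult power_mult_distrib
        flip: distrib_left real_sqrt_mult, simp add: real_sqrt_mult)
qed

text \<open>Only the restriction to complex lines is recorded: there a function that is not
  identically zero has finitely many roots, which is enough for density arguments, and the property
  passes through sums, products and affine substitutions.\<close>

definition line_poly :: "('n::finite tspace \<Rightarrow> complex) \<Rightarrow> bool" where
  "line_poly g \<longleftrightarrow> (\<forall>p v. \<exists>P. \<forall>s. g (p + cscale s v) = poly P s)"

lemma line_polyE:
  assumes "line_poly g"
  obtains P where "\<And>s. g (p + cscale s v) = poly P s"
  using assms unfolding line_poly_def by blast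

lemma line_poly_const: "line_poly (\<lambda>q. c)"
  unfolding line_poly_def by (metis poly_pCons poly_0 mult_zero_right add.right_neutral)

lemma line_poly_add: "line_poly f \<Longrightarrow> line_poly g \<Longrightarrow> line_poly (\<lambda>q. f q + g q)"
  unfolding line_poly_def by (metis poly_add)

lemma line_poly_mult: "line_poly f \<Longrightarrow> line_poly g \<Longrightarrow> line_poly (\<lambda>q. f q * g q)"
  unfolding line_poly_def by (metis poly_mult)

lemma line_family_sum: "(\<And>i. i \<in> A \<Longrightarrow> line_poly (f i)) \<Longrightarrow> line_poly (\<lambda>q. \<Sum>i\<in>A. f i q)"
  by (induction A rule: infinite_finite_induct) (auto intro: line_poly_const line_poly_add)

lemma line_poly_prod: "(\<And>i. i \<in> A \<Longrightarrow> line_poly (f i)) \<Longrightarrow> line_poly (\<lambda>q. \<Prod>i\<in>A. f i q)"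
  by (induction A rule: infinite_finite_induct) (auto intro: line_poly_const line_poly_mult)

lemma line_poly_power: "line_poly f \<Longrightarrow> line_poly (\<lambda>q. f q ^ n)"
  by (induction n) (auto intro: line_poly_const line_poly_mult)

lemma line_poly_fst: "line_poly fst"
  unfolding line_poly_def
proof (intro allI)
  fix p v :: "'a tspace"
  show "\<exists>P. \<forall>s. fst (p + cscale s v) = poly P s"
    by (rule exI[of _ "[:fst p, fst v:]"]) simp
qed

lemma line_poly_snd: "line_poly (\<lambda>q. snd q $ i)"
  unfolding line_poly_def
proof (intro allI)
  fix p v :: "'a tspace"
  show "\<exists>P. \<forall>s. snd (p + cscale s v) $ i = poly P s"
    by (rule exI[of _ "[:snd p $ i, snd v $ i:]"]) simp
qed

lemma line_poly_poly: "line_poly g \<Longrightarrow> line_poly (\<lambda>q. poly P (g q))"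
  by (induction P) (auto intro: line_poly_const line_poly_add line_poly_mult)

lemma line_poly_family_sum: "line_poly (family_sum K c)"
  unfolding family_sum_def [abs_def] monomial_at_def
  by (intro line_family_sum line_poly_mult line_poly_poly line_poly_fst line_poly_prod
      line_poly_power line_poly_snd)

lemma line_poly_affine:
  assumes "line_poly g" "\<And>p s v. A (p + cscale s v) = A p + cscale s (B v)"
  shows "line_poly (\<lambda>q. g (A q))"
  using assms unfolding line_poly_def by metis

lemma ex_small_nonroot:
  fixes P :: "complex poly"
  assumes "P \<noteq> 0" "0 < e"
  obtains s where "norm s < e" "poly P s \<noteq> 0"
proof -
  have "finite {s. poly P s = 0}" using assms poly_roots_finite by blast
  moreover have "uncountable (ball (0::complex) e)" using assms by (simp add: uncountable_ball)
  ultimately have "\<not> ball 0 e \<subseteq> {s. poly P s = 0}"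
    using countable_finite countable_subset by blast
  then obtain s where "s \<in> ball 0 e" "poly P s \<noteq> 0" by blast
  thus ?thesis by (intro that) auto
qed

text \<open>On the line from \<open>p\<close> through \<open>q\<close> the function is a polynomial
  that is nonzero at parameter 1, hence nonzero at parameters arbitrarily close to 0.\<close>

lemma line_poly_dense:
  assumes "line_poly g" "q \<in> coord_plane J" "g q \<noteq> 0" "p \<in> coord_plane J" "0 < e"
  shows "\<exists>x\<in>coord_plane J. dist x p < e \<and> g x \<noteq> 0"
proof -
  obtain P where P: "\<And>s. g (p + cscale s (q - p)) = poly P s"
    using line_polyE[OF assms(1)] by blast
  have "p + cscale 1 (q - p) = q" by simp
  with assms(3) P[of 1] have "P \<noteq> 0" by auto
  have "0 < e / (norm (q - p) + 1)" using assms(5) by (simp add: add_nonneg_pos)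
  then obtain s where s: "norm s < e / (norm (q - p) + 1)" "poly P s \<noteq> 0"
    using ex_small_nonroot[OF \<open>P \<noteq> 0\<close>] by blast
  have "norm s * norm (q - p) \<le> norm s * (norm (q - p) + 1)"
    by (simp add: mult_left_mono)
  also have "\<dots> < e" using s(1) by (simp add: pos_less_divide_eq add_nonneg_pos)
  finally have "dist (p + cscale s (q - p)) p < e" by (simp add: dist_norm)
  thus ?thesis using s P assms
    by (intro bexI[of _ "p + cscale s (q - p)"])
       (auto intro!: coord_plane_add coord_plane_cscale coord_plane_diff)
qed

text \<open>Univariate polynomials form an integral domain, so on the line joining \<open>p\<close>
  and \<open>q\<close> both factors are nonzero at a common parameter. This stands in for the
  irreducibility of the plane.\<close>

lemma line_poly_mult_nonzero:
  assumes "line_poly f" "p \<in> coord_plane J" "f p \<noteq> 0"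
    and "line_poly g" "q \<in> coord_plane J" "g q \<noteq> 0"
  shows "\<exists>x\<in>coord_plane J. f x * g x \<noteq> 0"
proof -
  obtain P where P: "\<And>s. f (p + cscale s (q - p)) = poly P s"
    using line_polyE[OF assms(1)] by blast
  obtain Q where Q: "\<And>s. g (p + cscale s (q - p)) = poly Q s"
    using line_polyE[OF assms(4)] by blast
  have "p + cscale 1 (q - p) = q" by simp
  with assms(6) Q[of 1] have "Q \<noteq> 0" by auto
  have "p + cscale 0 (q - p) = p" by simp
  with assms(3) P[of 0] have "P \<noteq> 0" by auto
  then obtain s where "poly (P * Q) s \<noteq> 0"
    using ex_small_nonroot[of "P * Q" 1] \<open>Q \<noteq> 0\<close> by auto
  thus ?thesis using P Q assms
    by (intro bexI[of _ "p + cscale s (q - p)"])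
       (auto intro!: coord_plane_add coord_plane_cscale coord_plane_diff)
qed

lemma line_poly_prod_nonzero:
  assumes "finite A" "\<And>i. i \<in> A \<Longrightarrow> line_poly (f i)"
    and "\<And>i. i \<in> A \<Longrightarrow> \<exists>q\<in>coord_plane J. f i q \<noteq> 0"
  shows "\<exists>x\<in>coord_plane J. (\<Prod>i\<in>A. f i x) \<noteq> 0"
  using assms
proof (induction A rule: finite_induct)
  case empty
  show ?case using coord_plane_0[of J] by (intro bexI[of _ 0]) auto
next
  case (insert a A)
  obtain p where p: "p \<in> coord_plane J" "f a p \<noteq> 0" using insert.prems(2)[of a] by blast
  obtain q where q: "q \<in> coord_plane J" "(\<Prod>i\<in>A. f i q) \<noteq> 0"
    using insert.IH insert.prems by blast
  have "line_poly (\<lambda>x. \<Prod>i\<in>A. f i x)" using insert.prems by (intro line_poly_prod) auto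
  from line_poly_mult_nonzero[where f = "f a", OF _ p this q] insert show ?case by auto
qed

section \<open>Nonzero polynomials have nonzero values\<close>

text \<open>Kronecker's substitution, with the exponents chosen outside the roots of finitely many
  polynomials.\<close>

lemma ex_separating_weights:
  fixes K :: "(nat^'n::finite) set"
  assumes "finite K"
  obtains e :: "'n \<Rightarrow> nat" where "inj_on (\<lambda>\<alpha>. \<Sum>i\<in>UNIV. e i * \<alpha> $ i) K"
proof -
  obtain idx :: "'n \<Rightarrow> nat" where idx: "inj idx"
    using finite_imp_inj_to_nat_seg[OF finite_class.finite_UNIV] by blast
  \<comment> \<open>At \<open>x\<close> the polynomial \<open>Q \<alpha> \<beta>\<close> is the
    difference of the weighted degrees for the weights \<open>x ^ idx i\<close>. As
    \<open>idx\<close> is injective, no two coordinates share a coefficient.\<close>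
  define Q where "Q \<alpha> \<beta> = (\<Sum>i\<in>UNIV. monom (int (\<alpha> $ i) - int (\<beta> $ i)) (idx i))"
    for \<alpha> \<beta> :: "nat^'n"
  have Q0: "Q \<alpha> \<beta> \<noteq> 0" if neq: "\<alpha> \<noteq> \<beta>" for \<alpha> \<beta>
  proof -
    obtain i where i: "\<alpha> $ i \<noteq> \<beta> $ i" using neq by (metis vec_eq_iff)
    have "coeff (Q \<alpha> \<beta>) (idx i) = (\<Sum>j\<in>UNIV. if j = i then int (\<alpha> $ j) - int (\<beta> $ j) else 0)"
      unfolding Q_def coeff_sum coeff_monom using idx by (intro sum.cong) (auto dest: injD)
    also have "\<dots> = int (\<alpha> $ i) - int (\<beta> $ i)" by simp
    finally show ?thesis using i by auto
  qed
  define R where "R = (\<Union>\<alpha>\<in>K. \<Union>\<beta>\<in>K-{\<alpha>}. {x. poly (Q \<alpha> \<beta>) x = 0})"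
  have "finite R" unfolding R_def using assms
    by (intro finite_UN_I finite_Diff) (auto intro!: poly_roots_finite Q0)
  moreover have "infinite (range int)" by (simp add: finite_image_iff inj_on_def)
  ultimately obtain x where x: "int x \<notin> R"
    by (meson finite_subset rev_finite_subset image_subset_iff)
  have "inj_on (\<lambda>\<alpha>. \<Sum>i\<in>UNIV. x ^ idx i * \<alpha> $ i) K"
  proof (rule inj_onI, rule ccontr)
    fix \<alpha> \<beta> assume *: "\<alpha> \<in> K" "\<beta> \<in> K" "\<alpha> \<noteq> \<beta>"
      "(\<Sum>i\<in>UNIV. x ^ idx i * \<alpha> $ i) = (\<Sum>i\<in>UNIV. x ^ idx i * \<beta> $ i)"
    have "poly (Q \<alpha> \<beta>) (int x) = 
       int (\<Sum>i\<in>UNIV. x ^ idx i * \<alpha> $ i) - int (\<Sum>i\<in>UNIV. x ^ idx i * \<beta> $ i)"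
      by (simp add: Q_def poly_sum poly_monom algebra_simps sum_subtractf)
    also have "\<dots> = 0" using * by simp
    finally have "int x \<in> R" using * unfolding R_def by blast
    with x show False by blast
  qed
  thus ?thesis using that[of "\<lambda>i. x ^ idx i"] by blast
qed

text \<open>On the curve with coordinates \<open>s ^ e i\<close> for i in J and 0 elsewhere, the
  monomials supported in J become different powers of s, so nothing cancels against the term of
  \<alpha>.\<close>

lemma family_sum_nonzero_at:
  fixes K :: "(nat^'n::finite) set"
  assumes "finite K" "\<alpha> \<in> K" "supported J \<alpha>" "poly (c \<alpha>) t \<noteq> 0"
  shows "\<exists>z\<in>coord_space J. family_sum K c (t, z) \<noteq> 0"
proof -
  obtain e where e: "inj_on (\<lambda>\<alpha>. \<Sum>i\<in>UNIV. e i * \<alpha> $ i) K"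
    using ex_separating_weights assms(1) by blast
  define wt where "wt \<alpha> = (\<Sum>i\<in>UNIV. e i * \<alpha> $ i)" for \<alpha> :: "nat^'n"
  define K' where "K' = {\<alpha>\<in>K. supported J \<alpha>}"
  define P where "P = (\<Sum>\<alpha>\<in>K'. monom (poly (c \<alpha>) t) (wt \<alpha>))"
  have "coeff P (wt \<alpha>) = (\<Sum>\<beta>\<in>K'. if \<beta> = \<alpha> then poly (c \<beta>) t else 0)"
    unfolding P_def coeff_sum coeff_monom
    using e assms(2) by (intro sum.cong) (auto dest: inj_onD simp: wt_def K'_def)
  also have "\<dots> = poly (c \<alpha>) t" using assms by (simp add: K'_def)
  finally have "P \<noteq> 0" using assms(4) by auto
  then obtain s where s: "poly P s \<noteq> 0" using ex_small_nonroot[of P 1] by auto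
  define z where "z = (\<chi> i. if i \<in> J then s ^ e i else 0)"
  have z: "z \<in> coord_space J" by (auto simp: z_def coord_space_def)
  have "monomial_at \<beta> z = s ^ wt \<beta>" if "supported J \<beta>" for \<beta>
  proof -
    have "monomial_at \<beta> z = (\<Prod>i\<in>UNIV. s ^ (e i * \<beta> $ i))"
      unfolding monomial_at_def using that
      by (intro prod.cong) (auto simp: z_def supported_def power_mult)
    thus ?thesis by (simp add: wt_def power_sum)
  qed
  hence "poly P s = (\<Sum>\<beta>\<in>K'. poly (c \<beta>) t * monomial_at \<beta> z)"
    by (simp add: P_def poly_sum poly_monom K'_def)
  also have "\<dots> = family_sum K c (t, z)"
    unfolding family_sum_def using assms(1)
    by (intro sum.mono_neutral_cong_left) (auto simp: K'_def monomial_at_eq_0[OF z])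
  finally show ?thesis using s z by auto
qed

section \<open>Derivatives\<close>

text \<open>For exponent 0 the truncated \<open>\<alpha> $ i - 1\<close> does no harm, the first
  factor being 0.\<close>

definition monomial_diff :: "'n \<Rightarrow> nat^'n \<Rightarrow> complex^'n::finite \<Rightarrow> complex" where
  "monomial_diff i \<alpha> z = of_nat (\<alpha> $ i) * (z $ i) ^ (\<alpha> $ i - 1) * (\<Prod>j\<in>UNIV-{i}. (z $ j) ^ (\<alpha> $ j))"

definition diff_t where
  "diff_t K c q = (\<Sum>\<alpha>\<in>K. poly (pderiv (c \<alpha>)) (fst q) * monomial_at \<alpha> (snd q))"

definition diff_z where
  "diff_z K c i q = (\<Sum>\<alpha>\<in>K. poly (c \<alpha>) (fst q) * monomial_diff i \<alpha> (snd q))"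

definition family_diff ::
    "(nat^'n) set \<Rightarrow> (nat^'n \<Rightarrow> complex poly) \<Rightarrow> 'n::finite tspace \<Rightarrow> 'n tspace \<Rightarrow> complex" where
  "family_diff K c q v = diff_t K c q * fst v + (\<Sum>i\<in>UNIV. diff_z K c i q * snd v $ i)"

text \<open>The logarithmic derivative reproduces a monomial up to its exponent, so the asymptotics
  of the monomials also control the derivatives.\<close>

lemma mult_monomial_diff: "z $ i * monomial_diff i \<alpha> z = of_nat (\<alpha> $ i) * monomial_at \<alpha> z"
proof (cases "\<alpha> $ i = 0")
  case False
  then obtain n where n: "\<alpha> $ i = Suc n" by (cases "\<alpha> $ i") auto
  have "monomial_at \<alpha> z = (z $ i) ^ (\<alpha> $ i) * (\<Prod>j\<in>UNIV-{i}. (z $ j) ^ (\<alpha> $ j))"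
    unfolding monomial_at_def by (simp add: prod.remove[of UNIV i])
  thus ?thesis by (simp add: monomial_diff_def n mult_ac)
qed (simp add: monomial_diff_def)

lemma mult_diff_z:
  "snd q $ i * diff_z K c i q =
     (\<Sum>\<alpha>\<in>K. poly (c \<alpha>) (fst q) * of_nat (\<alpha> $ i) * monomial_at \<alpha> (snd q))"
  unfolding diff_z_def sum_distrib_left
  by (intro sum.cong refl) (metis mult_monomial_diff mult.left_commute mult.assoc)

lemma has_derivative_snd_nth:
  fixes q :: "'n::finite tspace"
  shows "((\<lambda>q. snd q $ i) has_derivative (\<lambda>v. snd v $ i)) (at q)"
  by (intro bounded_linear_imp_has_derivative bounded_linear_compose[OF bounded_linear_vec_nth]
      bounded_linear_snd)

lemma has_derivative_monomial_at:
  fixes q :: "'n::finite tspace"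
  shows "((\<lambda>q. monomial_at \<alpha> (snd q)) has_derivative
     (\<lambda>v. \<Sum>i\<in>UNIV. monomial_diff i \<alpha> (snd q) * snd v $ i)) (at q)"
proof -
  have "((\<lambda>q. \<Prod>i\<in>UNIV. (snd q $ i) ^ (\<alpha> $ i)) has_derivative
     (\<lambda>v. \<Sum>i\<in>UNIV. (of_nat (\<alpha> $ i) * snd v $ i * (snd q $ i) ^ (\<alpha> $ i - 1)) *
          (\<Prod>j\<in>UNIV-{i}. (snd q $ j) ^ (\<alpha> $ j)))) (at q)"
    by (intro has_derivative_prod has_derivative_power has_derivative_snd_nth)
  thus ?thesis
    unfolding monomial_at_def monomial_diff_def by (simp add: mult_ac)
qed

lemma has_derivative_poly_fst:
  fixes q :: "'n::finite tspace"
  shows "((\<lambda>q. poly p (fst q)) has_derivative (\<lambda>v. poly (pderiv p) (fst q) * fst v)) (at q)"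
  using has_derivative_compose[OF has_derivative_fst[OF has_derivative_ident]
      poly_DERIV[of p "fst q", unfolded has_field_derivative_def]]
  by simp

lemma family_sum_has_derivative:
  "(family_sum K c has_derivative family_diff K c q) (at q)"
proof -
  have "(family_sum K c has_derivative
    (\<lambda>v. \<Sum>\<alpha>\<in>K. poly (c \<alpha>) (fst q) * (\<Sum>i\<in>UNIV. monomial_diff i \<alpha> (snd q) * snd v $ i) +
          poly (pderiv (c \<alpha>)) (fst q) * fst v * monomial_at \<alpha> (snd q))) (at q)"
    unfolding family_sum_def [abs_def]
    by (intro has_derivative_sum has_derivative_mult has_derivative_poly_fst
        has_derivative_monomial_at)
  moreover have "(\<lambda>v. \<Sum>\<alpha>\<in>K. poly (c \<alpha>) (fst q) * (\<Sum>i\<in>UNIV. monomial_diff i \<alpha> (snd q) * snd v $ i) +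
          poly (pderiv (c \<alpha>)) (fst q) * fst v * monomial_at \<alpha> (snd q)) = family_diff K c q"
  proof
    fix v :: "'a tspace"
    have "(\<Sum>\<alpha>\<in>K. poly (c \<alpha>) (fst q) * (\<Sum>i\<in>UNIV. monomial_diff i \<alpha> (snd q) * snd v $ i)) =
        (\<Sum>i\<in>UNIV. diff_z K c i q * snd v $ i)"
      unfolding diff_z_def sum_distrib_left sum_distrib_right
      by (subst sum.swap) (simp add: mult_ac)
    thus "(\<Sum>\<alpha>\<in>K. poly (c \<alpha>) (fst q) * (\<Sum>i\<in>UNIV. monomial_diff i \<alpha> (snd q) * snd v $ i) +
          poly (pderiv (c \<alpha>)) (fst q) * fst v * monomial_at \<alpha> (snd q)) = family_diff K c q v"
      unfolding family_diff_def diff_t_def sum.distrib sum_distrib_right by (simp add: mult_ac)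
  qed
  ultimately show ?thesis by simp
qed

text \<open>\<open>has_derivative\<close> only provides a real-linear map; complex linearity is the
  extra condition in \<open>holo_fun_on\<close>.\<close>

lemma family_diff_cscale: "family_diff K c q (cscale a v) = a * family_diff K c q v"
  by (simp add: family_diff_def algebra_simps sum_distrib_left)

lemma family_diff_add: "family_diff K c q (u + v) = family_diff K c q u + family_diff K c q v"
  by (simp add: family_diff_def algebra_simps sum.distrib)

lemma family_diff_axis: "family_diff K c q (0, axis i a) = diff_z K c i q * a"
proof -
  have "(\<Sum>j\<in>UNIV. diff_z K c j q * axis i a $ j) = (\<Sum>j\<in>UNIV. if j = i then diff_z K c j q * a else 0)"
    by (intro sum.cong) (auto simp: axis_def)
  thus ?thesis by (simp add: family_diff_def)
qed

lemma bounded_linear_family_diff: "bounded_linear (family_diff K c q)"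
  using family_sum_has_derivative has_derivative_bounded_linear by blast

lemma holo_family_sum: "holo_fun_on (family_sum K c) W"
  unfolding holo_fun_on_def using family_sum_has_derivative family_diff_cscale by blast

lemma continuous_on_family_sum: "continuous_on S (family_sum K c)"
  using family_sum_has_derivative has_derivative_continuous
  by (intro continuous_at_imp_continuous_on) blast

lemma continuous_on_diff_z: "continuous_on S (diff_z K c i)"
  unfolding diff_z_def [abs_def] monomial_diff_def by (intro continuous_intros)

lemma continuous_on_diff_t: "continuous_on S (diff_t K c)"
  unfolding diff_t_def [abs_def] monomial_at_def by (intro continuous_intros)

lemma continuous_on_family_diff: "continuous_on S (\<lambda>q. family_diff K c q v)"
  unfolding family_diff_def [abs_def]
  by (intro continuous_intros continuous_on_diff_z continuous_on_diff_t)

lemma partial_deriv_family_sum: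
  "partial_deriv i (\<lambda>z. family_sum K c (t, z)) z = diff_z K c i (t, z)"
proof -
  have eq: "(t, \<chi> j. if j = i then w else z $ j) = (t, z) + cscale (w - z $ i) (0, axis i 1)" for w
    by (auto simp: prod_eq_iff vec_eq_iff axis_def)
  have lin: "bounded_linear (\<lambda>h. cscale h (0, axis i 1 :: complex^'a))"
  proof (rule bounded_linear_intro[where K = "norm (0::complex, axis i 1 :: complex^'a)"])
    show "norm (cscale x (0, axis i 1 :: complex^'a)) \<le> norm x * norm (0::complex, axis i 1 :: complex^'a)"
      for x by (simp only: norm_cscale)
  qed (auto simp: cscale_def algebra_simps vec_eq_iff)
  have "((\<lambda>w. (t, z) + cscale (w - z $ i) (0, axis i 1)) has_derivative
      (\<lambda>h. cscale h (0, axis i 1))) (at (z $ i))"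
    by (rule derivative_eq_intros bounded_linear.has_derivative[OF lin] refl | simp)+
  from has_derivative_compose[OF this family_sum_has_derivative]
  have "((\<lambda>w. family_sum K c (t, \<chi> j. if j = i then w else z $ j)) has_derivative
      (\<lambda>h. diff_z K c i (t, z) * h)) (at (z $ i))"
    unfolding eq by (simp add: family_diff_cscale family_diff_axis mult.commute)
  thus ?thesis unfolding partial_deriv_def
    by (intro DERIV_imp_deriv) (simp add: has_field_derivative_def)
qed

lemma critical_in_total_fun:
  "critical_in J (poly_fun (family_at f t)) z \<longleftrightarrow>
     (\<forall>i\<in>J. diff_z (Poly_Mapping.keys f) (Poly_Mapping.lookup f) i (t, z) = 0)"
  unfolding critical_in_def poly_fun_family_at[abs_def] total_fun_def partial_deriv_family_sum ..

text \<open>Exponents whose coefficient vanishes at t contribute nothing, so the exponent set can be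
  taken from f and depends on t only through \<Delta>.\<close>

lemma face_fun_family_at:
  "face_fun (family_at f t) \<Delta> z =
     family_sum {\<alpha> \<in> Poly_Mapping.keys f. real_exponent \<alpha> \<in> \<Delta>} (Poly_Mapping.lookup f) (t, z)"
  unfolding face_fun_def family_sum_def monomial_at_def
  using keys_family_at_subset[of f t]
  by (intro sum.mono_neutral_cong_left)
     (auto simp: lookup_family_at in_keys_iff)

lemma critical_in_face_fun:
  "critical_in J (face_fun (family_at f t) \<Delta>) z \<longleftrightarrow>
     (\<forall>i\<in>J. diff_z {\<alpha> \<in> Poly_Mapping.keys f. real_exponent \<alpha> \<in> \<Delta>} (Poly_Mapping.lookup f) i (t, z) = 0)"
  unfolding critical_in_def face_fun_family_at[abs_def] partial_deriv_family_sum ..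

section \<open>Faces of the Newton polygon\<close>

lemma real_exponent_nth [simp]: "real_exponent \<alpha> $ i = real (\<alpha> $ i)"
  by (simp add: real_exponent_def)

text \<open>As a compact polytope plus a closed orthant, the polygon is closed and absorbs
  nonnegative vectors.\<close>

lemma newton_polygon_eq:
  "newton_polygon h =
     (\<Union>a\<in>convex hull (real_exponent ` Poly_Mapping.keys h). \<Union>x\<in>{x. \<forall>i. 0 \<le> x $ i}. {a + x})"
    (is "_ = ?N")
proof
  have eq: "?N = (\<Union>a\<in>convex hull (real_exponent ` Poly_Mapping.keys h). \<Union>x\<in>{x. \<forall>i. 0 \<le> x $ i}. {a + x})"
    by simp
  have "convex {x::real^'a. \<forall>i. 0 \<le> x $ i}"
    by (auto simp: convex_def)
  hence "convex ?N" by (intro convex_sums convex_convex_hull)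
  thus "newton_polygon h \<subseteq> ?N"
    unfolding newton_polygon_def by (intro hull_minimal) (auto intro: hull_inc)
next
  show "?N \<subseteq> newton_polygon h"
  proof clarify
    fix a x :: "real^'a"
    assume a: "a \<in> convex hull (real_exponent ` Poly_Mapping.keys h)" and x: "\<forall>i. 0 \<le> x $ i"
    have "x + a \<in> (+) x ` (convex hull (real_exponent ` Poly_Mapping.keys h))"
      using a by blast
    also have "\<dots> = convex hull ((+) x ` real_exponent ` Poly_Mapping.keys h)"
      by (rule convex_hull_translation [symmetric])
    also have "\<dots> \<subseteq> newton_polygon h"
      unfolding newton_polygon_def using x by (intro hull_mono) (force simp: add.commute)
    finally show "a + x \<in> newton_polygon h" by (simp add: add.commute)
  qed
qed

lemma convex_newton_polygon: "convex (newton_polygon h)"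
  unfolding newton_polygon_def by simp

lemma closed_newton_polygon: "closed (newton_polygon h)"
proof -
  have "closed {x::real^'a. \<forall>i. 0 \<le> x $ i}"
    by (intro closed_Collect_all closed_Collect_le continuous_intros)
  thus ?thesis
    unfolding newton_polygon_eq
    by (intro compact_closed_sums finite_imp_compact_convex_hull) auto
qed

lemma real_exponent_in_newton_polygon:
  "\<alpha> \<in> Poly_Mapping.keys h \<Longrightarrow> real_exponent \<alpha> \<in> newton_polygon h"
  unfolding newton_polygon_def by (rule hull_inc) (auto intro!: exI[of _ 0])

lemma newton_polygon_add:
  assumes "p \<in> newton_polygon h" "\<forall>i. 0 \<le> x $ i"
  shows "p + x \<in> newton_polygon h"
proof -
  obtain a y where "a \<in> convex hull (real_exponent ` Poly_Mapping.keys h)" "\<forall>i. 0 \<le> y $ i" "p = a + y"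
    using assms(1) unfolding newton_polygon_eq by auto
  thus ?thesis unfolding newton_polygon_eq using assms(2)
    by (auto intro!: bexI[of _ a] exI[of _ "y + x"] simp: add.assoc)
qed

lemma newton_polygon_nonneg:
  assumes "p \<in> newton_polygon h"
  shows "0 \<le> p $ i"
proof -
  have "newton_polygon h \<subseteq> {x. 0 \<le> x $ i}"
    unfolding newton_polygon_def
    by (intro hull_minimal) (auto simp: convex_def)
  thus ?thesis using assms by auto
qed

lemma newton_polygon_lower_bound:
  assumes "\<And>i. 0 \<le> a $ i" "\<And>\<alpha>. \<alpha> \<in> Poly_Mapping.keys h \<Longrightarrow> d \<le> a \<bullet> real_exponent \<alpha>"
    and "p \<in> newton_polygon h"
  shows "d \<le> a \<bullet> p"
proof -
  have "0 \<le> a \<bullet> x" if "\<forall>i. 0 \<le> x $ i" for x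
    unfolding inner_vec_def using assms(1) that by (intro sum_nonneg) auto
  hence "newton_polygon h \<subseteq> {x. d \<le> a \<bullet> x}"
    unfolding newton_polygon_def
    by (intro hull_minimal convex_halfspace_ge)
       (auto simp: inner_add_right intro!: add_increasing2 assms(2))
  thus ?thesis using assms(3) by auto
qed

text \<open>With strictly positive entries, fixing the value of the functional bounds each of the
  nonnegative coordinates.\<close>

lemma compact_positive_face:
  assumes "\<And>i. 0 < a $ i"
  shows "compact (newton_polygon h \<inter> {x. a \<bullet> x = d})"
proof -
  have "x $ i \<le> d / a $ i" if "x \<in> newton_polygon h" "a \<bullet> x = d" for x i
  proof -
    have "a $ i * x $ i \<le> (\<Sum>j\<in>UNIV. a $ j * x $ j)"
      using assms newton_polygon_nonneg[OF that(1)]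
      by (intro member_le_sum mult_nonneg_nonneg) (auto simp: less_imp_le)
    thus ?thesis using assms that(2) by (simp add: inner_vec_def field_simps)
  qed
  hence "newton_polygon h \<inter> {x. a \<bullet> x = d} \<subseteq> cbox 0 (\<chi> i. d / a $ i)"
    by (auto simp: mem_box_cart newton_polygon_nonneg)
  hence "bounded (newton_polygon h \<inter> {x. a \<bullet> x = d})"
    using bounded_cbox bounded_subset by blast
  thus ?thesis
    by (simp add: compact_eq_bounded_closed closed_Int closed_newton_polygon closed_hyperplane)
qed

lemma newton_polygon_empty: "Poly_Mapping.keys h = {} \<Longrightarrow> newton_polygon h = {}"
  by (simp add: newton_polygon_def)

lemma noncompact_newton_boundary_subset: "noncompact_newton_boundary h \<subseteq> newton_polygon h"
  by (auto simp: noncompact_newton_boundary_def newton_boundary_def compact_faces_def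
      essential_face_def weight_face_def dest: face_of_imp_subset)

text \<open>A point outside the second polygon is separated from it by a functional that can be made
  strictly positive; the face of the first polygon on which this functional is minimal is compact,
  hence part of the common boundary.\<close>

lemma newton_polygon_subset:
  assumes "noncompact_newton_boundary g \<subseteq> newton_polygon h"
  shows "newton_polygon g \<subseteq> newton_polygon h"
proof
  fix p assume p: "p \<in> newton_polygon g"
  show "p \<in> newton_polygon h"
  proof (rule ccontr)
    assume np: "p \<notin> newton_polygon h"
    have "\<exists>a b. (\<forall>i. 0 \<le> a $ i) \<and> a \<bullet> p < b \<and> (\<forall>x\<in>newton_polygon h. a \<bullet> x > b)"
    proof (cases "newton_polygon h = {}")
      case True
      thus ?thesis by (intro exI[of _ 0] exI[of _ 1]) auto
    next
      case False
      then obtain x0 where x0: "x0 \<in> newton_polygon h" by auto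
      obtain a b where ab: "a \<bullet> p < b" "\<forall>x\<in>newton_polygon h. a \<bullet> x > b"
        using separating_hyperplane_closed_point[OF convex_newton_polygon closed_newton_polygon np]
        by blast
      have "0 \<le> a $ i" for i
      proof (rule ccontr)
        assume neg: "\<not> 0 \<le> a $ i"
        \<comment> \<open>Moving this far from \<open>x0\<close> along axis i stays in the polygon
          but lowers the functional to exactly b.\<close>
        define s where "s = (a \<bullet> x0 - b) / (- a $ i)"
        have "s \<ge> 0" using ab(2) x0 neg unfolding s_def by (intro divide_nonneg_nonneg) force+
        hence "x0 + s *\<^sub>R axis i 1 \<in> newton_polygon h"
          by (intro newton_polygon_add x0) (auto simp: axis_def)
        hence "b < a \<bullet> x0 + s * a $ i"
          using ab(2) by (force simp: inner_add_right inner_axis)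
        thus False using neg by (simp add: s_def field_simps)
      qed
      thus ?thesis using ab by blast
    qed
    then obtain a b where a: "\<And>i. 0 \<le> a $ i" and b: "a \<bullet> p < b"
      and ab: "\<And>x. x \<in> newton_polygon h \<Longrightarrow> a \<bullet> x > b" by blast
    \<comment> \<open>Adding \<epsilon> times the all-ones functional raises the value at p by at
      most half of the gap \<open>b - a \<bullet> p\<close>, so it still separates.\<close>
    define \<epsilon> where "\<epsilon> = (b - a \<bullet> p) / (2 * (1 + (\<chi> i. 1) \<bullet> p))"
    have pp: "0 \<le> (\<chi> i. 1) \<bullet> p"
      unfolding inner_vec_def using newton_polygon_nonneg[OF p] by (intro sum_nonneg) auto
    hence \<epsilon>: "0 < \<epsilon>" using b by (simp add: \<epsilon>_def)
    define a' where "a' = a + \<epsilon> *\<^sub>R (\<chi> i. 1)"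
    have a'pos: "0 < a' $ i" for i using a[of i] \<epsilon> by (simp add: a'_def add_nonneg_pos)
    have "\<epsilon> * ((\<chi> i. 1) \<bullet> p) \<le> \<epsilon> * (1 + (\<chi> i. 1) \<bullet> p)" using \<epsilon> by simp
    also have "\<dots> = (b - a \<bullet> p) / 2" using pp by (simp add: \<epsilon>_def field_simps)
    also have "\<dots> < b - a \<bullet> p" using b by simp
    finally have a'p: "a' \<bullet> p < b" by (simp add: a'_def inner_add_left)
    have a'h: "b < a' \<bullet> x" if "x \<in> newton_polygon h" for x
    proof -
      have "0 \<le> (\<chi> i. 1) \<bullet> x"
        unfolding inner_vec_def using newton_polygon_nonneg[OF that] by (intro sum_nonneg) auto
      hence "a \<bullet> x \<le> a' \<bullet> x" using \<epsilon> by (simp add: a'_def inner_add_left)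
      thus ?thesis using ab[OF that] by simp
    qed
    define M where "M = (\<lambda>\<alpha>. a' \<bullet> real_exponent \<alpha>) ` Poly_Mapping.keys g"
    have "Poly_Mapping.keys g \<noteq> {}" using p newton_polygon_empty by blast
    hence M: "finite M" "M \<noteq> {}" by (auto simp: M_def)
    obtain \<beta> where \<beta>: "\<beta> \<in> Poly_Mapping.keys g" "Min M = a' \<bullet> real_exponent \<beta>"
      using Min_in[OF M] by (auto simp: M_def)
    have low: "Min M \<le> a' \<bullet> x" if "x \<in> newton_polygon g" for x
      by (rule newton_polygon_lower_bound[OF _ _ that])
         (use a'pos less_imp_le M in \<open>auto simp: M_def\<close>)
    define F where "F = newton_polygon g \<inter> {x. a' \<bullet> x = Min M}"
    have "F face_of newton_polygon g"
      unfolding F_def using low by (intro face_of_Int_supporting_hyperplane_ge convex_newton_polygon)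
    moreover have "real_exponent \<beta> \<in> F"
      using \<beta> by (auto simp: F_def real_exponent_in_newton_polygon)
    moreover have "compact F" unfolding F_def by (intro compact_positive_face a'pos)
    ultimately have "real_exponent \<beta> \<in> noncompact_newton_boundary g"
      unfolding noncompact_newton_boundary_def newton_boundary_def compact_faces_def by blast
    hence "b < a' \<bullet> real_exponent \<beta>" using assms a'h by blast
    with low[OF p] a'p \<beta>(2) show False by simp
  qed
qed

lemma newton_polygon_determined:
  assumes "noncompact_newton_boundary g = noncompact_newton_boundary h"
  shows "newton_polygon g = newton_polygon h"
  using newton_polygon_subset[of g h] newton_polygon_subset[of h g]
    noncompact_newton_boundary_subset[of g] noncompact_newton_boundary_subset[of h] assms
  by blast

lemma weight_value_inner: "weight_value w x = (\<chi> i. real (w $ i)) \<bullet> x"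
  by (simp add: weight_value_def inner_vec_def mult.commute)

lemma weight_face_eq:
  assumes "\<forall>\<alpha>\<in>Poly_Mapping.keys h. d \<le> weight_value w (real_exponent \<alpha>)"
    and "b \<in> newton_polygon h" "weight_value w b = d"
  shows "weight_face h w = newton_polygon h \<inter> {x. weight_value w x = d}"
    and "weight_face h w face_of newton_polygon h" "b \<in> weight_face h w"
proof -
  have low: "d \<le> weight_value w x" if "x \<in> newton_polygon h" for x
    unfolding weight_value_inner
    by (rule newton_polygon_lower_bound[OF _ _ that])
       (use assms(1) in \<open>auto simp: weight_value_inner\<close>)
  show *: "weight_face h w = newton_polygon h \<inter> {x. weight_value w x = d}"
    using low assms(2,3) unfolding weight_face_def by force
  show "weight_face h w face_of newton_polygon h"
    unfolding * unfolding weight_value_inner using low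
    by (intro face_of_Int_supporting_hyperplane_ge convex_newton_polygon)
       (auto simp: weight_value_inner)
  show "b \<in> weight_face h w" using * assms by auto
qed

lemma weight_face_compact:
  assumes "\<forall>\<alpha>\<in>Poly_Mapping.keys h. d \<le> weight_value w (real_exponent \<alpha>)"
    and "b \<in> newton_polygon h" "weight_value w b = d"
    and "weight_zeros w = {}"
  shows "weight_face h w \<in> compact_faces h"
proof -
  have "compact (newton_polygon h \<inter> {x. (\<chi> i. real (w $ i)) \<bullet> x = d})"
    by (rule compact_positive_face) (use assms(4) in \<open>auto simp: weight_zeros_def\<close>)
  hence "compact (weight_face h w)"
    unfolding weight_face_eq(1)[OF assms(1-3)] by (simp add: weight_value_inner)
  thus ?thesis using weight_face_eq[OF assms(1-3)] unfolding compact_faces_def by blast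
qed

text \<open>Moving in a direction of weight 0 preserves the minimal value and stays in the polygon;
  one such ray already makes the face unbounded.\<close>

lemma weight_face_essential:
  assumes "\<forall>\<alpha>\<in>Poly_Mapping.keys h. d \<le> weight_value w (real_exponent \<alpha>)"
    and "b \<in> newton_polygon h" "weight_value w b = d"
    and "weight_zeros w \<noteq> {}" "w \<noteq> 0" "weight_zeros w \<in> vanishing_sets h"
  shows "essential_face h (weight_zeros w) (weight_face h w)"
proof -
  note wf = weight_face_eq[OF assms(1-3)]
  have ray: "x + s *\<^sub>R axis i 1 \<in> weight_face h w"
    if "i \<in> weight_zeros w" "x \<in> weight_face h w" "0 \<le> s" for i x s
  proof -
    have "x + s *\<^sub>R axis i 1 \<in> newton_polygon h"
      using that wf(1) by (intro newton_polygon_add) (auto simp: axis_def)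
    moreover have "weight_value w (x + s *\<^sub>R axis i 1) = weight_value w x"
      using that(1) by (simp add: weight_value_inner inner_add_right inner_axis weight_zeros_def)
    ultimately show ?thesis using that(2) wf(1) by auto
  qed
  obtain i where i: "i \<in> weight_zeros w" using assms(4) by blast
  have "\<not> bounded (weight_face h w)"
  proof
    assume "bounded (weight_face h w)"
    then obtain B where B: "\<And>x. x \<in> weight_face h w \<Longrightarrow> norm x \<le> B"
      by (auto simp: bounded_iff)
    have B0: "0 \<le> B" using B[OF wf(3)] norm_ge_zero order_trans by blast
    have "norm (b + (B + 1) *\<^sub>R axis i (1::real)) \<le> B" using B0 by (intro B ray i wf(3)) auto
    moreover have "(b + (B + 1) *\<^sub>R axis i (1::real)) $ i \<le> norm (b + (B + 1) *\<^sub>R axis i (1::real))"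
      using component_le_norm_cart[of "b + (B + 1) *\<^sub>R axis i (1::real)" i] by linarith
    moreover have "0 \<le> b $ i" by (rule newton_polygon_nonneg[OF assms(2)])
    ultimately show False by (simp add: axis_def)
  qed
  hence "\<not> compact (weight_face h w)" using compact_imp_bounded by blast
  thus ?thesis
    unfolding essential_face_def using wf ray assms(5,6) unfolding vanishing_sets_def by blast
qed

section \<open>Asymptotic weights of a sequence in a torus\<close>

text \<open>Dirichlet approximates \<open>q * l\<close> within 1/N by an integral vector p. Where
  \<open>a \<bullet> l = 0\<close>, the integer \<open>a \<bullet> p\<close> has absolute value
  below 1, hence is 0; where \<open>a \<bullet> l > 0\<close>, the error is smaller than
  \<open>a \<bullet> l\<close>.\<close>

lemma ex_integral_signs:
  fixes l :: "real^'n::finite"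
  assumes A: "finite A" "\<And>a i. a \<in> A \<Longrightarrow> a $ i \<in> \<int>"
  obtains p :: "real^'n" where "\<And>i. p $ i \<in> \<int>"
    "\<And>a. a \<in> A \<Longrightarrow> a \<bullet> l = 0 \<Longrightarrow> a \<bullet> p = 0" "\<And>a. a \<in> A \<Longrightarrow> a \<bullet> l > 0 \<Longrightarrow> a \<bullet> p > 0"
proof -
  have ev: "\<forall>\<^sub>F N in sequentially. c < real N" for c
    using filterlim_real_sequentially unfolding filterlim_at_top_dense by blast
  \<comment> \<open>The first bound on N settles the equations, the second the strict inequalities.
    For \<open>a \<bullet> l = 0\<close> the quotient is 0 by the convention on division.\<close>
  have "\<forall>\<^sub>F N in sequentially. \<forall>a\<in>A. (\<Sum>i\<in>UNIV. \<bar>a $ i\<bar>) < real N \<and>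
      (\<Sum>i\<in>UNIV. \<bar>a $ i\<bar>) / (a \<bullet> l) < real N \<and> 0 < N"
    using ev[of 0] by (intro eventually_ball_finite A ballI eventually_conj ev) auto
  then obtain N where "\<forall>a\<in>A. (\<Sum>i\<in>UNIV. \<bar>a $ i\<bar>) < real N \<and>
      (\<Sum>i\<in>UNIV. \<bar>a $ i\<bar>) / (a \<bullet> l) < real N \<and> 0 < N"
    unfolding eventually_sequentially by blast
  then obtain N where N: "0 < N" "\<And>a. a \<in> A \<Longrightarrow> (\<Sum>i\<in>UNIV. \<bar>a $ i\<bar>) < real N"
      "\<And>a. a \<in> A \<Longrightarrow> (\<Sum>i\<in>UNIV. \<bar>a $ i\<bar>) / (a \<bullet> l) < real N"
    by (cases "A = {}") (metis empty_iff zero_less_one, blast)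
  obtain idx :: "'n \<Rightarrow> nat" and n where idx: "bij_betw idx UNIV {..<n}"
    using ex_bij_betw_finite_nat[of "UNIV :: 'n set"] by (auto simp: atLeast0LessThan)
  obtain q p' where q: "0 < q"
    and p': "\<And>i. i < n \<Longrightarrow> \<bar>of_int q * (l $ inv_into UNIV idx i) - of_int (p' i)\<bar> < 1 / N"
    using Dirichlet_approx_simult[OF N(1), where n = n and \<theta> = "\<lambda>i. l $ inv_into UNIV idx i"]
    by metis
  define p where "p = (\<chi> i. real_of_int (p' (idx i)))"
  have approx: "\<bar>of_int q * l $ i - p $ i\<bar> \<le> 1 / N" for i
  proof -
    have "idx i < n" using idx by (auto simp: bij_betw_def)
    moreover have "inv_into UNIV idx (idx i) = i" using idx by (simp add: bij_betw_def)
    ultimately show ?thesis using p'[of "idx i"] by (simp add: p_def less_imp_le)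
  qed
  have close: "\<bar>of_int q * (a \<bullet> l) - a \<bullet> p\<bar> \<le> (\<Sum>i\<in>UNIV. \<bar>a $ i\<bar>) / N" for a
  proof -
    have "of_int q * (a \<bullet> l) - a \<bullet> p = (\<Sum>i\<in>UNIV. a $ i * (of_int q * l $ i - p $ i))"
      by (simp add: inner_vec_def sum_distrib_left algebra_simps sum_subtractf)
    also have "\<bar>\<dots>\<bar> \<le> (\<Sum>i\<in>UNIV. \<bar>a $ i\<bar> * (1 / N))"
      using approx by (intro order_trans[OF sum_abs] sum_mono) (simp add: abs_mult mult_left_mono[OF approx, of "\<bar>a $ i\<bar>" for i, simplified])
    finally show ?thesis by (simp add: sum_divide_distrib)
  qed
  show ?thesis
  proof (rule that[of p])
    show "p $ i \<in> \<int>" for i by (simp add: p_def)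
    show "a \<bullet> p = 0" if "a \<in> A" "a \<bullet> l = 0" for a
    proof -
      have "a \<bullet> p \<in> \<int>"
        unfolding inner_vec_def inner_real_def using A(2)[OF that(1)]
        by (intro Ints_sum Ints_mult) (auto simp: p_def)
      moreover have "\<bar>a \<bullet> p\<bar> < 1"
      proof -
        have "\<bar>a \<bullet> p\<bar> \<le> (\<Sum>i\<in>UNIV. \<bar>a $ i\<bar>) / N" using close[of a] that(2) by simp
        also have "\<dots> < 1" using N(2)[OF that(1)] N(1) by simp
        finally show ?thesis .
      qed
      ultimately show ?thesis using Ints_nonzero_abs_less1 by blast
    qed
    show "a \<bullet> p > 0" if "a \<in> A" "a \<bullet> l > 0" for a
    proof -
      have "(\<Sum>i\<in>UNIV. \<bar>a $ i\<bar>) / N < a \<bullet> l"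
        using N(3)[OF that(1)] N(1) that(2) by (simp add: field_simps)
      also have "\<dots> \<le> of_int q * (a \<bullet> l)" using q that(2) by simp
      finally show ?thesis using close[of a] by linarith
    qed
  qed
qed

text \<open>\<open>C k\<close> is the orthogonal projection of \<open>L k\<close> to the span of
  \<open>A0\<close>. It is bounded because the inner products with \<open>A0\<close> are, so
  removing it makes the equations on \<open>A0\<close> exact and leaves the divergence along
  \<open>A1\<close> intact.\<close>

lemma ex_asymptotic_weights:
  fixes L :: "nat \<Rightarrow> real^'n::finite"
  assumes A: "finite A0" "finite A1" "\<And>a i. a \<in> A0 \<union> A1 \<Longrightarrow> a $ i \<in> \<int>"
    and bdd: "\<And>a. a \<in> A0 \<Longrightarrow> bounded (range (\<lambda>k. a \<bullet> L k))"
    and top: "\<And>a. a \<in> A1 \<Longrightarrow> filterlim (\<lambda>k. a \<bullet> L k) at_top sequentially"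
  shows "\<exists>C p. bounded (range C) \<and> (\<forall>a\<in>A0. \<forall>k. a \<bullet> (L k - C k) = 0) \<and>
    (\<forall>a\<in>A1. filterlim (\<lambda>k. a \<bullet> (L k - C k)) at_top sequentially) \<and>
    (\<forall>i. p $ i \<in> \<int>) \<and> (\<forall>a\<in>A0. a \<bullet> p = 0) \<and> (\<forall>a\<in>A1. a \<bullet> p > 0)"
proof -
  obtain B where B: "B \<subseteq> span A0" "pairwise orthogonal B" "\<And>x. x \<in> B \<Longrightarrow> norm x = 1"
      "independent B" "span B = span A0"
    using orthonormal_basis_subspace[OF subspace_span[of A0]] by metis
  have finB: "finite B" using B(4) independent_imp_finite by blast
  define C where "C k = (\<Sum>b\<in>B. (b \<bullet> L k) *\<^sub>R b)" for k
  have bddspan: "bounded (range (\<lambda>k. a \<bullet> L k))" if "a \<in> span A0" for a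
    using that
  proof (induction rule: span_induct_alt)
    case base
    show ?case by (auto simp: bounded_iff)
  next
    case (step c x y)
    show ?case
      using bounded_plus_comp[OF bounded_scaleR_comp[OF bdd[OF step(1)], of c] step(2)]
      by (simp add: inner_add_left)
  qed
  have bC: "bounded (range C)"
    unfolding C_def
    using finB B(1)
  proof (induction B rule: finite_induct)
    case (insert x B)
    obtain m where "\<And>k. \<bar>x \<bullet> L k\<bar> \<le> m"
      using bddspan[of x] insert.prems by (auto simp: bounded_iff)
    hence "\<And>k. norm ((x \<bullet> L k) *\<^sub>R x) \<le> m * norm x" by (simp add: mult_right_mono)
    hence "bounded (range (\<lambda>k. (x \<bullet> L k) *\<^sub>R x))" by (auto simp: bounded_iff)
    from bounded_plus_comp[OF this insert.IH] insert show ?case by simp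
  qed auto
  have orth: "a \<bullet> (L k - C k) = 0" if "a \<in> span A0" for a k
    using that unfolding B(5)[symmetric]
  proof (induction rule: span_induct_alt)
    case (step c x y)
    have "x \<bullet> C k = (\<Sum>b\<in>B. if b = x then x \<bullet> L k else 0)"
      unfolding C_def inner_sum_right
      using B(2) B(3)[OF step(1)] step(1)
      by (intro sum.cong) (auto simp: pairwise_def orthogonal_def norm_eq_1)
    hence "x \<bullet> (L k - C k) = 0" using finB step(1) by (simp add: inner_diff_right)
    thus ?case using step(2) by (simp add: inner_add_left)
  qed simp
  obtain m where m: "\<And>k. norm (C k) \<le> m" using bC by (auto simp: bounded_iff)
  have top': "filterlim (\<lambda>k. a \<bullet> (L k - C k)) at_top sequentially" if "a \<in> A1" for a
  proof (rule filterlim_at_top_mono)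
    show "filterlim (\<lambda>k. - (norm a * m) + a \<bullet> L k) at_top sequentially"
      by (intro filterlim_tendsto_add_at_top[OF tendsto_const] top that)
    have "a \<bullet> C k \<le> norm a * m" for k
      using norm_cauchy_schwarz[of a "C k"] m[of k] mult_left_mono[of "norm (C k)" m "norm a"]
      by simp
    thus "\<forall>\<^sub>F k in sequentially. - (norm a * m) + a \<bullet> L k \<le> a \<bullet> (L k - C k)"
      by (simp add: inner_diff_right)
  qed
  \<comment> \<open>A single late term of the corrected sequence already has all the required signs
    and is then replaced by an integral vector.\<close>
  have "\<forall>\<^sub>F k in sequentially. \<forall>a\<in>A1. 0 < a \<bullet> (L k - C k)"
    using top' A(2) unfolding filterlim_at_top_dense by (intro eventually_ball_finite) auto
  then obtain k where k: "\<And>a. a \<in> A1 \<Longrightarrow> 0 < a \<bullet> (L k - C k)"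
    unfolding eventually_sequentially by blast
  obtain p where "\<And>i. p $ i \<in> \<int>"
    "\<And>a. a \<in> A0 \<union> A1 \<Longrightarrow> a \<bullet> (L k - C k) = 0 \<Longrightarrow> a \<bullet> p = 0"
    "\<And>a. a \<in> A0 \<union> A1 \<Longrightarrow> a \<bullet> (L k - C k) > 0 \<Longrightarrow> a \<bullet> p > 0"
    using ex_integral_signs[of "A0 \<union> A1" "L k - C k"] A finite_UnI[OF A(1,2)] by blast
  thus ?thesis using bC orth top' k by (intro exI[of _ C] exI[of _ p]) (auto simp: span_base)
qed

section \<open>Passing to subsequences\<close>

lemma ex_subseq_minimal:
  fixes g :: "nat \<Rightarrow> 'a \<Rightarrow> real"
  assumes "finite K" "K \<noteq> {}"
  shows "\<exists>\<beta>\<in>K. \<exists>r::nat \<Rightarrow> nat. strict_mono r \<and> (\<forall>k. \<forall>\<alpha>\<in>K. g (r k) \<beta> \<le> g (r k) \<alpha>)"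
proof -
  define m where "m k = arg_min_on (g k) K" for k
  have m: "m k \<in> K" for k
    unfolding m_def by (rule arg_min_if_finite(1)[OF assms])
  have le: "g k (m k) \<le> g k \<alpha>" if "\<alpha> \<in> K" for k \<alpha>
    unfolding m_def by (rule arg_min_least[OF assms that])
  have "range m \<subseteq> K" using m by blast
  hence "finite (range m)" using assms(1) finite_subset by blast
  then obtain k0 where "infinite {k \<in> UNIV. m k = m k0}"
    using pigeonhole_infinite[OF infinite_UNIV_nat] by blast
  hence inf: "infinite {k. m k = m k0}" by simp
  define r where "r = enumerate {k. m k = m k0}"
  have mr: "m (r k) = m k0" for k using enumerate_in_set[OF inf, of k] by (auto simp: r_def)
  show ?thesis
  proof (intro bexI[of _ "m k0"] exI[of _ r] conjI allI ballI)
    show "m k0 \<in> K" by (rule m)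
    show "strict_mono r" unfolding r_def by (rule strict_mono_enumerate[OF inf])
    show "g (r k) (m k0) \<le> g (r k) \<alpha>" if "\<alpha> \<in> K" for k \<alpha>
      using le[OF that, of "r k"] by (simp add: mr)
  qed
qed

text \<open>Compactness of the extended reals gives a limit for one sequence at a time;
  nonnegativity excludes minus infinity, and both alternatives survive a further
  subsequence.\<close>

lemma ex_subseq_bounded_or_top:
  fixes X :: "'a \<Rightarrow> nat \<Rightarrow> real"
  assumes "finite A" "\<And>a k. a \<in> A \<Longrightarrow> 0 \<le> X a k"
  shows "\<exists>r::nat \<Rightarrow> nat. strict_mono r \<and> (\<forall>a\<in>A. bounded (range (\<lambda>k. X a (r k))) \<or>
           filterlim (\<lambda>k. X a (r k)) at_top sequentially)"
  using assms
proof (induction A rule: finite_induct)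
  case empty
  show ?case by (intro exI[of _ id]) (simp add: strict_mono_def)
next
  case (insert a A)
  then obtain r :: "nat \<Rightarrow> nat" where r: "strict_mono r" "\<And>b. b \<in> A \<Longrightarrow> bounded (range (\<lambda>k. X b (r k))) \<or>
           filterlim (\<lambda>k. X b (r k)) at_top sequentially" by auto
  obtain l :: ereal and s where s: "strict_mono s" "(\<lambda>k. ereal (X a (r (s k)))) \<longlonglongrightarrow> l"
    using compact_complete_linorder[of "\<lambda>k. ereal (X a (r k))"] by (auto simp: o_def)
  have "bounded (range (\<lambda>k. X a (r (s k)))) \<or> filterlim (\<lambda>k. X a (r (s k))) at_top sequentially"
  proof (cases l)
    case (real x)
    hence "(\<lambda>k. X a (r (s k))) \<longlonglongrightarrow> x" using s(2) by simp
    thus ?thesis using convergent_imp_bounded by blast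
  next
    case PInf
    thus ?thesis using s(2) by (simp add: tendsto_PInfty_eq_at_top)
  next
    case MInf
    have "0 \<le> l" using s(2) insert.prems by (intro LIMSEQ_le_const[OF s(2)]) auto
    thus ?thesis using MInf by simp
  qed
  moreover have "bounded (range (\<lambda>k. X b (r (s k)))) \<or>
           filterlim (\<lambda>k. X b (r (s k))) at_top sequentially" if "b \<in> A" for b
    using r(2)[OF that]
  proof
    assume "bounded (range (\<lambda>k. X b (r k)))"
    thus ?thesis by (rule disjI1[OF bounded_subset]) auto
  next
    assume "filterlim (\<lambda>k. X b (r k)) at_top sequentially"
    from filterlim_compose[OF this filterlim_subseq[OF s(1)]] show ?thesis by blast
  qed
  ultimately show ?case
    using strict_mono_compose[OF r(1) s(1)] by (intro exI[of _ "\<lambda>k. r (s k)"]) auto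
qed


text \<open>The sequence is written as \<open>z\<^sub>k = exp(-l\<^sub>k) b\<^sub>k\<close> with \<open>b\<^sub>k\<close> convergent in the torus and \<open>l\<^sub>k\<close>
  orthogonal to the differences of all exponents of maximal order; an integral weight vector with
  the same signs as \<open>l\<^sub>k\<close> then has these exponents as its face.  The coordinates outside \<open>J\<close> vanish
  along the sequence and receive a weight exceeding the minimum.\<close>

lemma torus_sequence_weights:
  fixes z :: "nat \<Rightarrow> complex^'n::finite"
  assumes K: "finite K" "K \<noteq> {}" "\<forall>\<alpha>\<in>K. supported J \<alpha>"
    and z: "\<And>k. z k \<in> coord_torus J" "z \<longlonglongrightarrow> p" "p \<in> coord_torus I" "I \<subseteq> J"
    and P: "P \<subseteq> J - I"
    and ratio: "\<forall>i\<in>P. \<forall>j\<in>P. bounded (range (\<lambda>k. ln (norm (z k $ i)) - ln (norm (z k $ j))))"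
  shows "\<exists>(r :: nat \<Rightarrow> nat) w \<beta> b (M :: nat \<Rightarrow> complex). strict_mono r \<and> \<beta> \<in> K \<and> weight_zeros w = I \<and>
    (\<forall>i\<in>P. \<forall>j\<in>P. w $ i = w $ j) \<and>
    (\<forall>\<alpha>\<in>K. weight_value w (real_exponent \<beta>) \<le> weight_value w (real_exponent \<alpha>)) \<and>
    (\<forall>j. j \<notin> J \<longrightarrow> weight_value w (real_exponent \<beta>) < real (w $ j)) \<and>
    b \<in> coord_torus UNIV \<and> (\<forall>i\<in>I. b $ i = p $ i) \<and> (\<forall>k. M k \<noteq> 0) \<and>
    (\<forall>\<alpha>\<in>K. (\<lambda>k. monomial_at \<alpha> (z (r k)) / M k) \<longlonglongrightarrow>
       (if weight_value w (real_exponent \<alpha>) = weight_value w (real_exponent \<beta>)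
        then monomial_at \<alpha> b else 0))"
proof -
  define R where "R = (real_exponent :: nat^'n \<Rightarrow> real^'n)"
  \<comment> \<open>Outside J the coordinate of z is 0, and the convention \<open>ln 0 = 0\<close>
    makes L vanish there.\<close>
  define L where "L k = (\<chi> i. - ln (norm (z k $ i)))" for k
  have zJ: "z k $ i \<noteq> 0 \<longleftrightarrow> i \<in> J" for k i
    using z(1)[of k] by (auto simp: coord_torus_def)
  have pI: "p $ i \<noteq> 0 \<longleftrightarrow> i \<in> I" for i
    using z(3) by (auto simp: coord_torus_def)
  have zlim: "(\<lambda>k. z k $ i) \<longlonglongrightarrow> p $ i" for i
    by (intro tendsto_vec_nth z)
  have L0: "L k $ i = 0" if "i \<notin> J" for k i
    using zJ[of k i] that by (simp add: L_def)
  have Lbdd: "bounded (range (\<lambda>k. L k $ i))" if "i \<notin> J - I" for i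
  proof (cases "i \<in> I")
    case True
    hence "(\<lambda>k. L k $ i) \<longlonglongrightarrow> - ln (norm (p $ i))"
      unfolding L_def using zlim[of i] pI[of i] by (auto intro!: tendsto_intros)
    thus ?thesis by (rule convergent_imp_bounded)
  next
    case False
    thus ?thesis using L0 that by (auto simp: bounded_iff)
  qed
  have Ltop: "filterlim (\<lambda>k. L k $ i) at_top sequentially" if i: "i \<in> J - I" for i
  proof -
    have "(\<lambda>k. norm (z k $ i)) \<longlonglongrightarrow> 0"
      using tendsto_norm[OF zlim[of i]] pI[of i] i by simp
    hence "filterlim (\<lambda>k. norm (z k $ i)) (at_right 0) sequentially"
      using zJ i by (auto simp: filterlim_at)
    hence "filterlim (\<lambda>k. ln (norm (z k $ i))) at_bot sequentially"
      by (rule filterlim_compose[OF ln_at_0])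
    from filterlim_compose[OF filterlim_uminus_at_top_at_bot this]
    show ?thesis by (simp add: L_def)
  qed
  have "\<exists>\<beta>\<in>K. \<exists>r::nat \<Rightarrow> nat. strict_mono r \<and> (\<forall>k. \<forall>\<alpha>\<in>K. R \<beta> \<bullet> L (r k) \<le> R \<alpha> \<bullet> L (r k))"
    by (rule ex_subseq_minimal[OF K(1,2)])
  then obtain \<beta> and r1 :: "nat \<Rightarrow> nat" where \<beta>: "\<beta> \<in> K" and r1: "strict_mono r1"
    and min: "\<And>k \<alpha>. \<alpha> \<in> K \<Longrightarrow> R \<beta> \<bullet> L (r1 k) \<le> R \<alpha> \<bullet> L (r1 k)"
    by blast
  have "\<exists>r::nat \<Rightarrow> nat. strict_mono r \<and> (\<forall>\<alpha>\<in>K. bounded (range (\<lambda>k. (R \<alpha> - R \<beta>) \<bullet> L (r1 (r k)))) \<or>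
      filterlim (\<lambda>k. (R \<alpha> - R \<beta>) \<bullet> L (r1 (r k))) at_top sequentially)"
    by (rule ex_subseq_bounded_or_top[OF K(1)]) (simp add: inner_diff_left min)
  then obtain r2 :: "nat \<Rightarrow> nat" where r2: "strict_mono r2" and dich: "\<And>\<alpha>. \<alpha> \<in> K \<Longrightarrow>
      bounded (range (\<lambda>k. (R \<alpha> - R \<beta>) \<bullet> L (r1 (r2 k)))) \<or>
      filterlim (\<lambda>k. (R \<alpha> - R \<beta>) \<bullet> L (r1 (r2 k))) at_top sequentially"
    by blast
  define s where "s k = r1 (r2 k)" for k
  have s: "strict_mono s" unfolding s_def by (intro strict_mono_compose[OF r1 r2])
  \<comment> \<open>The exponents whose monomials are of the same order as the largest one; for the
    rest of K the difference diverges.\<close>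
  define F where "F = {\<alpha>\<in>K. bounded (range (\<lambda>k. (R \<alpha> - R \<beta>) \<bullet> L (s k)))}"
  have ax: "axis i 1 \<bullet> L k = L k $ i" for i k by (simp add: inner_axis' )
  \<comment> \<open>\<open>A0\<close> makes the weight constant on F and on P and zero outside J - I
    (before the correction outside J); \<open>A1\<close> makes it positive on J - I and larger on
    the exponents outside F.\<close>
  define A0 where "A0 = (\<lambda>\<alpha>. R \<alpha> - R \<beta>) ` F \<union> (\<lambda>i. axis i 1) ` (- (J - I)) \<union>
      (\<lambda>(i, j). axis i 1 - axis j 1) ` (P \<times> P)"
  define A1 where "A1 = (\<lambda>\<alpha>. R \<alpha> - R \<beta>) ` (K - F) \<union> (\<lambda>i. axis i 1) ` (J - I)"
  have A: "finite A0" "finite A1" using K(1) by (auto simp: A0_def A1_def F_def)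
  have Aint: "a $ i \<in> \<int>" if "a \<in> A0 \<union> A1" for a i
    using that by (auto simp: A0_def A1_def R_def axis_def)
  have A0b: "bounded (range (\<lambda>k. a \<bullet> L (s k)))" if "a \<in> A0" for a
  proof -
    have "bounded (range (\<lambda>k. L (s k) $ i))" if "i \<notin> J - I" for i
      by (rule bounded_subset[OF Lbdd[OF that]]) auto
    moreover have "bounded (range (\<lambda>k. L (s k) $ i - L (s k) $ j))" if "i \<in> P" "j \<in> P" for i j
      by (rule bounded_subset[OF bspec[OF bspec[OF ratio that(2)] that(1)]]) (auto simp: L_def)
    ultimately show ?thesis
      using that by (auto simp: A0_def F_def inner_diff_left ax simp del: real_exponent_nth)
  qed
  have A1t: "filterlim (\<lambda>k. a \<bullet> L (s k)) at_top sequentially" if "a \<in> A1" for a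
  proof -
    have "filterlim (\<lambda>k. L (s k) $ i) at_top sequentially" if "i \<in> J - I" for i
      by (rule filterlim_compose[OF Ltop[OF that] filterlim_subseq[OF s]])
    moreover have "filterlim (\<lambda>k. (R \<alpha> - R \<beta>) \<bullet> L (s k)) at_top sequentially" if "\<alpha> \<in> K - F" for \<alpha>
      using dich[of \<alpha>] that by (auto simp: F_def s_def)
    ultimately show ?thesis using that by (auto simp: A1_def ax)
  qed
  have "\<exists>C e. bounded (range C) \<and> (\<forall>a\<in>A0. \<forall>k. a \<bullet> (L (s k) - C k) = 0) \<and>
    (\<forall>a\<in>A1. filterlim (\<lambda>k. a \<bullet> (L (s k) - C k)) at_top sequentially) \<and>
    (\<forall>i. e $ i \<in> \<int>) \<and> (\<forall>a\<in>A0. a \<bullet> e = 0) \<and> (\<forall>a\<in>A1. a \<bullet> e > 0)"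
    by (rule ex_asymptotic_weights[OF A]) (fact Aint A0b A1t)+
  then obtain C and e :: "real^'n" where C: "bounded (range C)"
    and orth: "\<And>a k. a \<in> A0 \<Longrightarrow> a \<bullet> (L (s k) - C k) = 0"
    and ltop: "\<And>a. a \<in> A1 \<Longrightarrow> filterlim (\<lambda>k. a \<bullet> (L (s k) - C k)) at_top sequentially"
    and e: "\<And>i. e $ i \<in> \<int>" "\<And>a. a \<in> A0 \<Longrightarrow> a \<bullet> e = 0" "\<And>a. a \<in> A1 \<Longrightarrow> a \<bullet> e > 0"
    by blast
  define l where "l k = L (s k) - C k" for k
  \<comment> \<open>The rescaled coordinates in J have modulus \<open>exp (- C k $ i)\<close>, which
    lies between two positive constants; so a limit point has nonzero J-coordinates.\<close>
  define bs where "bs k = (\<chi> i. z (s k) $ i * of_real (exp (l k $ i)))" for k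
  obtain m where m: "\<And>k. norm (C k) \<le> m" using C by (auto simp: bounded_iff)
  have nb: "norm (bs k $ i) = exp (- C k $ i)" if "i \<in> J" for k i
    using zJ[of "s k" i] that by (simp add: bs_def norm_mult norm_divide l_def L_def exp_diff exp_minus field_simps)
  have nb0: "bs k $ i = 0" if "i \<notin> J" for k i
    using zJ[of "s k" i] that by (simp add: bs_def)
  have cm: "\<bar>C k $ i\<bar> \<le> m" for k i
    using component_le_norm_cart[of "C k" i] m[of k] by linarith
  have nbb: "norm (bs k $ i) \<le> exp m" for k i
    using cm[of k i] by (cases "i \<in> J") (auto simp: nb nb0)
  have "norm (bs k) \<le> (\<Sum>i\<in>(UNIV::'n set). exp m)" for k
    unfolding norm_vec_def using nbb
    by (intro order_trans[OF L2_set_le_sum] sum_mono) auto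
  hence "bounded (range bs)" by (auto simp: bounded_iff)
  then obtain b0 r3 where r3: "strict_mono r3" "(bs \<circ> r3) \<longlonglongrightarrow> b0"
    using bounded_imp_convergent_subsequence by blast
  have b0: "(\<lambda>k. bs (r3 k) $ i) \<longlonglongrightarrow> b0 $ i" for i
    using tendsto_vec_nth[OF r3(2), of i] by (simp add: o_def)
  have b0n: "b0 $ i \<noteq> 0" if "i \<in> J" for i
  proof -
    have "exp (- m) \<le> norm (b0 $ i)"
      using cm that by (intro LIMSEQ_le_const[OF tendsto_norm[OF b0]]) (auto simp: nb abs_le_iff)
    thus ?thesis using exp_gt_zero[of "- m"] by (auto simp del: exp_gt_zero)
  qed
  \<comment> \<open>Coordinates outside J are invisible to the monomials of K; the value 1 puts the
    point into the full torus.\<close>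
  define b where "b = (\<chi> i. if i \<in> J then b0 $ i else 1)"
  define d where "d = R \<beta> \<bullet> e"
  \<comment> \<open>On J the entries of e are nonnegative integers, so rounding is exact. Outside J
    any integer above the minimal value d would do.\<close>
  define w where "w = (\<chi> i. if i \<in> J then nat \<lfloor>e $ i\<rfloor> else nat (\<lfloor>d\<rfloor> + 1))"
  have eI: "e $ i = 0" if "i \<notin> J - I" for i
    using e(2)[of "axis i 1"] that by (auto simp: A0_def inner_axis')
  have eN: "e $ i > 0" if "i \<in> J - I" for i
    using e(3)[of "axis i 1"] that by (auto simp: A1_def inner_axis')
  have e0: "e $ i \<ge> 0" for i using eI[of i] eN[of i] by (cases "i \<in> J - I") auto
  have d0: "0 \<le> d" unfolding d_def inner_vec_def R_def using e0 by (intro sum_nonneg) auto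
  have we: "real (w $ i) = e $ i" if "i \<in> J" for i
    using e(1)[of i] e0[of i] that by (auto simp: w_def elim!: Ints_cases)
  have wd: "d < real (w $ i)" if "i \<notin> J" for i
    using d0 that by (simp add: w_def)
  have wv: "weight_value w (real_exponent \<alpha>) = R \<alpha> \<bullet> e" if "\<alpha> \<in> K" for \<alpha>
    unfolding weight_value_def inner_vec_def R_def inner_real_def
    using bspec[OF K(3) that] we by (intro sum.cong) (force simp: supported_def)+
  have lift: "monomial_at \<alpha> (z (s k)) = monomial_at \<alpha> (bs k) * of_real (exp (- (R \<alpha> \<bullet> l k)))" for \<alpha> k
  proof -
    have "monomial_at \<alpha> (bs k) = (\<Prod>i\<in>UNIV. (z (s k) $ i) ^ (\<alpha> $ i) * of_real (exp (real (\<alpha> $ i) * l k $ i)))"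
      unfolding monomial_at_def bs_def
      by (intro prod.cong refl) (simp add: power_mult_distrib exp_of_nat_mult flip: of_real_power)
    also have "\<dots> = monomial_at \<alpha> (z (s k)) * of_real (exp (R \<alpha> \<bullet> l k))"
      by (simp add: monomial_at_def prod.distrib inner_vec_def exp_sum R_def)
    finally show ?thesis by (simp add: exp_minus field_simps)
  qed
  \<comment> \<open>The common scale of the dominant monomials: the exponential factor of
    \<beta>.\<close>
  define M where "M k = complex_of_real (exp (- (R \<beta> \<bullet> l (r3 k))))" for k
  define r where "r k = s (r3 k)" for k
  have quot: "monomial_at \<alpha> (z (r k)) / M k =
      monomial_at \<alpha> (bs (r3 k)) * of_real (exp (- ((R \<alpha> - R \<beta>) \<bullet> l (r3 k))))" for \<alpha> k
    unfolding r_def M_def lift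
    by (simp add: inner_diff_left exp_diff exp_minus field_simps)
  have mlim: "(\<lambda>k. monomial_at \<alpha> (bs (r3 k))) \<longlonglongrightarrow> monomial_at \<alpha> b0" for \<alpha>
    unfolding monomial_at_def by (intro tendsto_intros b0)
  have mb: "monomial_at \<alpha> b0 = monomial_at \<alpha> b" if "\<alpha> \<in> K" for \<alpha>
    unfolding monomial_at_def using bspec[OF K(3) that]
    by (intro prod.cong) (auto simp: b_def supported_def)
  show ?thesis
  proof (rule exI[of _ r], rule exI[of _ w], rule exI[of _ \<beta>], rule exI[of _ b], rule exI[of _ M],
      intro conjI ballI allI impI)
    show mono: "strict_mono r" unfolding r_def by (intro strict_mono_compose[OF s r3(1)])
    show "\<beta> \<in> K" by (rule \<beta>)
    show "weight_zeros w = I"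
    proof (intro set_eqI)
      fix i
      show "i \<in> weight_zeros w \<longleftrightarrow> i \<in> I"
      proof (cases "i \<in> J")
        case True
        thus ?thesis using we[OF True] eI[of i] eN[of i]
          by (cases "i \<in> I") (auto simp: weight_zeros_def)
      next
        case False
        thus ?thesis using wd[OF False] d0 z(4) by (auto simp: weight_zeros_def)
      qed
    qed
    show "w $ i = w $ j" if "i \<in> P" "j \<in> P" for i j
    proof -
      have "axis i 1 - axis j 1 \<in> A0" using that by (force simp: A0_def)
      from e(2)[OF this] have "e $ i = e $ j" by (simp add: inner_diff_left inner_axis')
      moreover have "i \<in> J" "j \<in> J" using that P by auto
      ultimately show ?thesis using we[of i] we[of j] by simp
    qed
    show low: "weight_value w (real_exponent \<beta>) \<le> weight_value w (real_exponent \<alpha>)" if "\<alpha> \<in> K" for \<alpha>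
    proof (cases "\<alpha> \<in> F")
      case True
      hence "(R \<alpha> - R \<beta>) \<bullet> e = 0" by (intro e) (auto simp: A0_def)
      thus ?thesis using that \<beta> by (simp add: wv inner_diff_left)
    next
      case False
      hence "(R \<alpha> - R \<beta>) \<bullet> e > 0" using that by (intro e) (auto simp: A1_def)
      thus ?thesis using that \<beta> by (simp add: wv inner_diff_left)
    qed
    show "weight_value w (real_exponent \<beta>) < real (w $ j)" if "j \<notin> J" for j
      using wd[OF that] wv[OF \<beta>] by (simp add: d_def)
    show "b \<in> coord_torus UNIV" using b0n by (auto simp: coord_torus_def b_def)
    show "b $ i = p $ i" if "i \<in> I" for i
    proof -
      \<comment> \<open>For i in I the unit vector belongs to \<open>A0\<close>, so this coordinate
        is not rescaled and keeps its limit.\<close>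
      have "axis i 1 \<bullet> l k = 0" for k
        unfolding l_def using that by (intro orth) (auto simp: A0_def)
      hence "bs k $ i = z (s k) $ i" for k by (simp add: bs_def inner_axis')
      hence "(\<lambda>k. z (r k) $ i) \<longlonglongrightarrow> b0 $ i" using b0[of i] by (simp add: r_def)
      moreover have "(\<lambda>k. z (r k) $ i) \<longlonglongrightarrow> p $ i"
        using LIMSEQ_subseq_LIMSEQ[OF zlim[of i] mono] by (simp add: o_def)
      ultimately show ?thesis using that z(4) LIMSEQ_unique by (auto simp: b_def)
    qed
    show "M k \<noteq> 0" for k by (simp add: M_def)
    show "(\<lambda>k. monomial_at \<alpha> (z (r k)) / M k) \<longlonglongrightarrow>
       (if weight_value w (real_exponent \<alpha>) = weight_value w (real_exponent \<beta>)
        then monomial_at \<alpha> b else 0)" if \<alpha>: "\<alpha> \<in> K" for \<alpha>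
    proof (cases "\<alpha> \<in> F")
      case True
      hence "(R \<alpha> - R \<beta>) \<bullet> e = 0" by (intro e) (auto simp: A0_def)
      moreover have "(R \<alpha> - R \<beta>) \<bullet> l k = 0" for k
        unfolding l_def using True by (intro orth) (auto simp: A0_def)
      ultimately show ?thesis
        using mlim[of \<alpha>] \<alpha> \<beta> unfolding quot by (simp add: wv inner_diff_left mb)
    next
      case False
      hence aA: "R \<alpha> - R \<beta> \<in> A1" using \<alpha> by (auto simp: A1_def)
      have "filterlim (\<lambda>k. (R \<alpha> - R \<beta>) \<bullet> l (r3 k)) at_top sequentially"
        unfolding l_def by (rule filterlim_compose[OF ltop[OF aA] filterlim_subseq[OF r3(1)]])
      from filterlim_compose[OF filterlim_uminus_at_bot_at_top this]
      have "(\<lambda>k. exp (- ((R \<alpha> - R \<beta>) \<bullet> l (r3 k)))) \<longlonglongrightarrow> 0"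
        by (rule filterlim_compose[OF exp_at_bot])
      hence "(\<lambda>k. monomial_at \<alpha> (z (r k)) / M k) \<longlonglongrightarrow> monomial_at \<alpha> b0 * of_real 0"
        unfolding quot by (intro tendsto_mult mlim tendsto_of_real)
      moreover have "(R \<alpha> - R \<beta>) \<bullet> e > 0" by (rule e(3)[OF aA])
      ultimately show ?thesis using \<alpha> \<beta> by (simp add: wv inner_diff_left)
    qed
  qed
qed

section \<open>Charts and tangent spaces\<close>

lemma has_derivative_vec_lambda:
  fixes f :: "'n::finite \<Rightarrow> 'a::real_normed_vector \<Rightarrow> complex"
  assumes "\<And>i. (f i has_derivative f' i) (at x)"
  shows "((\<lambda>x. \<chi> i. f i x) has_derivative (\<lambda>v. \<chi> i. f' i v)) (at x)"
proof -
  have n: "norm (axis i a :: complex^'n) = norm a" for i :: 'n and a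
  proof -
    have "(\<Sum>j\<in>UNIV. (norm ((axis i a :: complex^'n) $ j))\<^sup>2) = (\<Sum>j\<in>UNIV. if j = i then (norm a)\<^sup>2 else 0)"
      by (intro sum.cong) (auto simp: axis_def)
    thus ?thesis by (simp add: norm_vec_def L2_set_def)
  qed
  have lin: "bounded_linear (axis i :: complex \<Rightarrow> complex^'n)" for i :: 'n
  proof (rule bounded_linear_intro[where K = 1])
    show "norm (axis i x :: complex^'n) \<le> norm x * 1" for x by (simp add: n)
  qed (auto simp: axis_def vec_eq_iff)
  have eq: "(\<chi> i. g i) = (\<Sum>i\<in>UNIV. axis i (g i))" for g :: "'n \<Rightarrow> complex"
  proof -
    have "(\<Sum>i\<in>UNIV. axis i (g i)) $ k = (\<Sum>i\<in>UNIV. if i = k then g i else 0)" for k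
      unfolding sum_component by (intro sum.cong) (auto simp: axis_def)
    thus ?thesis by (simp add: vec_eq_iff)
  qed
  show ?thesis
    unfolding eq by (intro has_derivative_sum bounded_linear.has_derivative[OF lin] assms)
qed

lemma holo_map_onI:
  assumes "\<And>p. p \<in> W \<Longrightarrow> \<exists>A. (\<phi> has_derivative A) (at p) \<and> (\<forall>c v. A (cscale c v) = cscale c (A v))"
  shows "holo_map_on \<phi> W"
proof -
  have "\<exists>A. ((\<lambda>p. snd (\<phi> p) $ i) has_derivative A) (at p) \<and> (\<forall>c v. A (cscale c v) = c * A v)"
    if p: "p \<in> W" for p i
  proof -
    obtain A where A: "(\<phi> has_derivative A) (at p)" "\<And>c v. A (cscale c v) = cscale c (A v)"
      using assms[OF p] by blast
    have "((\<lambda>p. snd (\<phi> p) $ i) has_derivative (\<lambda>v. snd (A v) $ i)) (at p)"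
      by (rule has_derivative_compose[OF A(1) has_derivative_snd_nth])
    thus ?thesis using A(2) by (intro exI[of _ "\<lambda>v. snd (A v) $ i"]) auto
  qed
  moreover have "\<exists>A. ((\<lambda>p. fst (\<phi> p)) has_derivative A) (at p) \<and> (\<forall>c v. A (cscale c v) = c * A v)"
    if p: "p \<in> W" for p
  proof -
    obtain A where A: "(\<phi> has_derivative A) (at p)" "\<And>c v. A (cscale c v) = cscale c (A v)"
      using assms[OF p] by blast
    have "((\<lambda>p. fst (\<phi> p)) has_derivative (\<lambda>v. fst (A v))) (at p)"
      by (rule has_derivative_fst[OF A(1)])
    thus ?thesis using A(2) by (intro exI[of _ "\<lambda>v. fst (A v)"]) auto
  qed
  ultimately show ?thesis unfolding holo_map_on_def holo_fun_on_def by blast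
qed

definition hypersurface ::
    "(nat^'n) set \<Rightarrow> (nat^'n \<Rightarrow> complex poly) \<Rightarrow> 'n::finite set \<Rightarrow> 'n tspace set" where
  "hypersurface K c J = {q \<in> coord_plane J. family_sum K c q = 0}"

text \<open>Near a point where \<open>\<partial>F/\<partial>z\<^sub>j \<noteq> 0\<close>, the chart replaces the coordinate \<open>z\<^sub>j\<close> by \<open>F\<close> and moves
  it to the position \<open>j0\<close>, so that the model subspace does not depend on \<open>j\<close>.\<close>

lemma hypersurface_chart:
  fixes K :: "(nat^'n::finite) set"
  assumes "j \<in> J" "j0 \<in> J" and nz: "diff_z K c j q0 \<noteq> 0"
    and W1: "open W1" "q0 \<in> W1" and q0: "q0 \<in> hypersurface K c J"
  obtains W W' \<phi> \<psi> where "open W" "q0 \<in> W" "W \<subseteq> W1" "open W'" "homeomorphism W W' \<phi> \<psi>"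
    "holo_map_on \<phi> W" "holo_map_on \<psi> W'"
    "\<phi> ` (hypersurface K c J \<inter> W) = coord_plane (J - {j0}) \<inter> W'"
    "\<And>v. v \<in> coord_plane J \<Longrightarrow> family_diff K c q0 v = 0 \<Longrightarrow>
       v \<in> tangent_space (hypersurface K c J \<inter> W) q0"
proof -
  define \<phi> where "\<phi> q = (fst q, \<chi> i. if i = j0 then family_sum K c q else if i = j then snd q $ j0 else snd q $ i)"
    for q :: "'n tspace"
  define D where "D q v = (fst v, \<chi> i. if i = j0 then family_diff K c q v else if i = j then snd v $ j0 else snd v $ i)"
    for q v :: "'n tspace"
  have der: "(\<phi> has_derivative D q) (at q)" for q
  proof -
    have "((\<lambda>q. if i = j0 then family_sum K c q else if i = j then snd q $ j0 else snd q $ i) has_derivative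
        (\<lambda>v. if i = j0 then family_diff K c q v else if i = j then snd v $ j0 else snd v $ i)) (at q)" for i
      by (cases "i = j0"; cases "i = j") (simp_all add: family_sum_has_derivative has_derivative_snd_nth)
    thus ?thesis unfolding \<phi>_def D_def
      by (intro has_derivative_Pair has_derivative_fst has_derivative_ident has_derivative_vec_lambda)
  qed
  have Dlin: "bounded_linear (D q)" for q using der has_derivative_bounded_linear by blast
  have Dc: "D q (cscale a v) = cscale a (D q v)" for q a v
    by (simp add: D_def prod_eq_iff vec_eq_iff family_diff_cscale)
  \<comment> \<open>A vector in the kernel has all coordinates zero except number j, and the
    F-component of \<open>D\<close> then kills this one since dF/dz_j is nonzero.\<close>
  have inj: "inj (D q0)"
  proof (rule injI)
    fix u v assume "D q0 u = D q0 v"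
    hence "D q0 (u - v) = 0" using Dlin[of q0] by (simp add: bounded_linear.linear linear_diff)
    hence x: "fst (u - v) = 0" "family_diff K c q0 (u - v) = 0"
        "\<And>i. i \<noteq> j0 \<Longrightarrow> (if i = j then snd (u - v) $ j0 else snd (u - v) $ i) = 0"
      unfolding D_def by (auto simp: prod_eq_iff vec_eq_iff split: if_splits)
    have i0: "snd (u - v) $ i = 0" if "i \<noteq> j" for i
      using x(3)[of i] x(3)[of j] that by (cases "i = j0") auto
    hence "u - v = (0, axis j (snd (u - v) $ j))"
      using x(1) by (auto simp: prod_eq_iff vec_eq_iff axis_def)
    hence "diff_z K c j q0 * snd (u - v) $ j = 0" using x(2) by (metis family_diff_axis)
    hence "snd (u - v) $ j = 0" using nz by simp
    hence "snd (u - v) $ i = 0" for i using i0[of i] by (cases "i = j") simp_all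
    hence "snd (u - v) = 0" by (metis vec_eq_iff zero_index)
    thus "u = v" using x(1) by (simp add: prod_eq_iff)
  qed
  obtain g where g: "linear g" "g \<circ> D q0 = id"
    using linear_injective_left_inverse[OF _ inj] Dlin bounded_linear.linear by blast
  have bg: "bounded_linear g" using g(1) by (simp add: linear_conv_bounded_linear)
  have app: "blinfun_apply (Blinfun (D q)) = D q" for q by (simp add: bounded_linear_Blinfun_apply Dlin)
  have "Blinfun g o\<^sub>L Blinfun (D q0) = id_blinfun"
  proof (rule blinfun_eqI)
    fix v
    have "g (D q0 v) = v" using g(2) by (metis comp_apply id_apply)
    thus "blinfun_apply (Blinfun g o\<^sub>L Blinfun (D q0)) v = blinfun_apply id_blinfun v"
      by (simp add: app bounded_linear_Blinfun_apply[OF bg])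
  qed
  moreover have "continuous_on W1 (\<lambda>q. Blinfun (D q))"
  proof (rule continuous_on_blinfun_componentwise)
    fix v :: "'n tspace"
    have "continuous_on W1 (\<lambda>q. if i = j0 then family_diff K c q v else if i = j then snd v $ j0 else snd v $ i)" for i
      by (cases "i = j0"; cases "i = j") (simp_all add: continuous_on_family_diff)
    thus "continuous_on W1 (\<lambda>q. blinfun_apply (Blinfun (D q)) v)"
      unfolding app D_def by (intro continuous_intros)
  qed
  ultimately obtain W W' \<psi> \<psi>' where W: "open W" "W \<subseteq> W1" "q0 \<in> W" "open W'" "\<phi> q0 \<in> W'"
    and hom: "homeomorphism W W' \<phi> \<psi>"
    and \<psi>: "\<And>y. y \<in> W' \<Longrightarrow> (\<psi> has_derivative \<psi>' y) (at y)"
      "\<And>y. y \<in> W' \<Longrightarrow> \<psi>' y = inv (D (\<psi> y))" "\<And>y. y \<in> W' \<Longrightarrow> bij (D (\<psi> y))"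
    using inverse_function_theorem[OF W1(1) _ _ W1(2), of \<phi> "\<lambda>q. Blinfun (D q)" "Blinfun g"] der
    unfolding app by metis
  have \<psi>\<phi>: "\<psi> (\<phi> q) = q" if "q \<in> W" for q using hom that by (simp add: homeomorphism_def)
  have \<phi>\<psi>: "\<phi> (\<psi> y) = y" "\<psi> y \<in> W" if "y \<in> W'" for y
    using hom that by (auto simp: homeomorphism_def)
  have iff: "\<phi> q \<in> coord_plane (J - {j0}) \<longleftrightarrow> q \<in> hypersurface K c J" for q
  proof -
    have "\<phi> q \<in> coord_plane (J - {j0}) \<longleftrightarrow> (\<forall>i. i \<notin> J \<longrightarrow> snd q $ i = 0) \<and> family_sum K c q = 0"
      using assms(1,2) unfolding coord_plane_iff \<phi>_def by auto
    thus ?thesis by (simp add: hypersurface_def coord_plane_iff)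
  qed
  have img: "\<phi> ` (hypersurface K c J \<inter> W) = coord_plane (J - {j0}) \<inter> W'"
  proof
    show "\<phi> ` (hypersurface K c J \<inter> W) \<subseteq> coord_plane (J - {j0}) \<inter> W'"
      using iff hom by (auto simp: homeomorphism_def)
    show "coord_plane (J - {j0}) \<inter> W' \<subseteq> \<phi> ` (hypersurface K c J \<inter> W)"
    proof
      fix y assume y: "y \<in> coord_plane (J - {j0}) \<inter> W'"
      hence "\<psi> y \<in> hypersurface K c J \<inter> W" using iff[of "\<psi> y"] \<phi>\<psi> by auto
      thus "y \<in> \<phi> ` (hypersurface K c J \<inter> W)" using \<phi>\<psi>(1)[of y] y by (metis IntD2 imageI)
    qed
  qed
  have hol1: "holo_map_on \<phi> W" using der Dc by (intro holo_map_onI) blast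
  have hol2: "holo_map_on \<psi> W'"
  proof (intro holo_map_onI)
    fix y assume y: "y \<in> W'"
    \<comment> \<open>The inverse of a complex-linear bijection is complex linear.\<close>
    have "\<psi>' y (cscale a v) = cscale a (\<psi>' y v)" for a v
      unfolding \<psi>(2)[OF y] using \<psi>(3)[OF y] Dc by (metis bij_inv_eq_iff)
    thus "\<exists>A. (\<psi> has_derivative A) (at y) \<and> (\<forall>c v. A (cscale c v) = cscale c (A v))"
      using \<psi>(1)[OF y] by blast
  qed
  have tan: "v \<in> tangent_space (hypersurface K c J \<inter> W) q0"
    if v: "v \<in> coord_plane J" "family_diff K c q0 v = 0" for v
  proof -
    \<comment> \<open>A straight segment in the chart, pulled back to the hypersurface.\<close>
    define \<gamma> where "\<gamma> s = \<psi> (\<phi> q0 + s *\<^sub>R D q0 v)" for s :: real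
    have "D q0 v \<in> coord_plane (J - {j0})"
      using v assms(1,2) unfolding D_def coord_plane_iff by auto
    moreover have "\<phi> q0 \<in> coord_plane (J - {j0})" using iff q0 by blast
    ultimately have L: "\<phi> q0 + s *\<^sub>R D q0 v \<in> coord_plane (J - {j0})" for s
      by (intro coord_plane_add coord_plane_scaleR)
    have "open ((\<lambda>s::real. \<phi> q0 + s *\<^sub>R D q0 v) -` W')"
      by (intro open_vimage W continuous_intros)
    moreover have "0 \<in> (\<lambda>s. \<phi> q0 + s *\<^sub>R D q0 v) -` W'" using W by simp
    ultimately obtain e where e0: "0 < e" "ball 0 e \<subseteq> (\<lambda>s. \<phi> q0 + s *\<^sub>R D q0 v) -` W'"
      by (meson openE)
    hence e: "0 < e" "\<And>s. \<bar>s\<bar> < e \<Longrightarrow> \<phi> q0 + s *\<^sub>R D q0 v \<in> W'" by (auto simp: subset_iff)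
    have "\<gamma> s \<in> hypersurface K c J \<inter> W" if "\<bar>s\<bar> < e" for s
      using e(2)[OF that] L[of s] \<phi>\<psi> iff unfolding \<gamma>_def by (metis IntI)
    hence sub: "\<gamma> ` {-e<..<e} \<subseteq> hypersurface K c J \<inter> W" by (auto simp: abs_less_iff)
    have \<gamma>0: "\<gamma> 0 = q0" by (simp add: \<gamma>_def \<psi>\<phi> W)
    have "((\<lambda>s. \<phi> q0 + s *\<^sub>R D q0 v) has_derivative (\<lambda>h. h *\<^sub>R D q0 v)) (at 0)"
      by (auto intro!: derivative_eq_intros)
    from has_derivative_compose[OF this, of \<psi> "\<psi>' (\<phi> q0)"] \<psi>(1)[OF W(5)]
    have "(\<gamma> has_derivative (\<lambda>h. \<psi>' (\<phi> q0) (h *\<^sub>R D q0 v))) (at 0)"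
      unfolding \<gamma>_def by simp
    moreover have "\<psi>' (\<phi> q0) (h *\<^sub>R D q0 v) = h *\<^sub>R v" for h
    proof -
      have "h *\<^sub>R D q0 v = D q0 (h *\<^sub>R v)"
        using Dlin[of q0] by (simp add: bounded_linear.linear linear_scale)
      thus ?thesis unfolding \<psi>(2)[OF W(5)] \<psi>\<phi>[OF W(3)] using inj by (simp add: inv_f_f)
    qed
    ultimately have "(\<gamma> has_vector_derivative v) (at 0)"
      by (simp add: has_vector_derivative_def)
    thus ?thesis unfolding tangent_space_def using e(1) \<gamma>0 sub by blast
  qed
  show ?thesis
    by (rule that[OF W(1,3,2,4) hom hol1 hol2 img tan])
qed


section \<open>Tangent spaces of hypersurfaces and of open parts of planes\<close>

lemma tangent_space_mono: "S \<subseteq> T \<Longrightarrow> tangent_space S p \<subseteq> tangent_space T p"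
  unfolding tangent_space_def by blast

lemma derivative_along_curve_eq_0:
  assumes \<gamma>: "(\<gamma> has_vector_derivative v) (at 0)" "0 < e" "\<gamma> ` {-e<..<e} \<subseteq> S" "\<gamma> 0 = q"
    and g: "(g has_derivative A) (at q)" "\<And>x. x \<in> S \<Longrightarrow> g x = (0::'b::real_normed_vector)"
  shows "A v = 0"
proof -
  have "((\<lambda>s. g (\<gamma> s)) has_derivative (\<lambda>h. A (h *\<^sub>R v))) (at 0)"
    using has_derivative_compose[OF \<gamma>(1)[unfolded has_vector_derivative_def]] g(1) \<gamma>(4) by blast
  moreover have "open {-e<..<e}" "0 \<in> {-e<..<e}" using \<gamma>(2) by auto
  moreover have "g (\<gamma> s) = 0" if "s \<in> {-e<..<e}" for s
    using \<gamma>(3) g(2) that by blast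
  ultimately have "((\<lambda>s. 0) has_derivative (\<lambda>h. A (h *\<^sub>R v))) (at 0)"
    by (rule has_derivative_transform_within_open)
  from has_derivative_unique[OF this has_derivative_const]
  have "A (1 *\<^sub>R v) = 0" by meson
  thus ?thesis by simp
qed

lemma tangent_space_subset_coord_plane:
  assumes "S \<subseteq> coord_plane J"
  shows "tangent_space S q \<subseteq> coord_plane J"
proof
  fix v assume "v \<in> tangent_space S q"
  then obtain \<gamma> and e :: real where \<gamma>: "(\<gamma> has_vector_derivative v) (at 0)" "0 < e" "\<gamma> ` {-e<..<e} \<subseteq> S" "\<gamma> 0 = q"
    unfolding tangent_space_def by blast
  have "snd v $ i = 0" if "i \<notin> J" for i
    using assms that coord_plane_iff
    by (intro derivative_along_curve_eq_0[OF \<gamma> has_derivative_snd_nth]) blast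
  thus "v \<in> coord_plane J" by (simp add: coord_plane_iff)
qed

text \<open>Velocities satisfy the linearised equations by the chain rule; conversely the chart
  realises each solution by a curve, which stays in S because the chart lies in
  \<open>W1\<close>.\<close>

lemma tangent_space_hypersurface:
  assumes "j \<in> J" "diff_z K c j q \<noteq> 0" "q \<in> S" "open W1" "q \<in> W1"
    and "S \<subseteq> hypersurface K c J" "hypersurface K c J \<inter> W1 \<subseteq> S"
  shows "tangent_space S q = {v \<in> coord_plane J. family_diff K c q v = 0}"
proof
  show "tangent_space S q \<subseteq> {v \<in> coord_plane J. family_diff K c q v = 0}"
  proof
    fix v assume v: "v \<in> tangent_space S q"
    then obtain \<gamma> and e :: real where \<gamma>: "(\<gamma> has_vector_derivative v) (at 0)" "0 < e" "\<gamma> ` {-e<..<e} \<subseteq> S" "\<gamma> 0 = q"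
      unfolding tangent_space_def by blast
    have "family_diff K c q v = 0"
      using assms(6) unfolding hypersurface_def
      by (intro derivative_along_curve_eq_0[OF \<gamma> family_sum_has_derivative]) auto
    moreover have "S \<subseteq> coord_plane J" using assms(6) by (auto simp: hypersurface_def)
    ultimately show "v \<in> {v \<in> coord_plane J. family_diff K c q v = 0}"
      using v tangent_space_subset_coord_plane by blast
  qed
next
  have q: "q \<in> hypersurface K c J" using assms by blast
  obtain W where "W \<subseteq> W1" and W: "\<And>v. v \<in> coord_plane J \<Longrightarrow> family_diff K c q v = 0 \<Longrightarrow>
       v \<in> tangent_space (hypersurface K c J \<inter> W) q"
    by (rule hypersurface_chart[OF assms(1,1,2,4,5) q]) blast
  hence "hypersurface K c J \<inter> W \<subseteq> S" using assms(7) by blast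
  from tangent_space_mono[OF this] W
  show "{v \<in> coord_plane J. family_diff K c q v = 0} \<subseteq> tangent_space S q" by blast
qed

lemma tangent_space_open_plane:
  assumes "S \<subseteq> coord_plane J" "open W1" "q \<in> W1" "q \<in> S" "coord_plane J \<inter> W1 \<subseteq> S"
  shows "tangent_space S q = coord_plane J"
proof
  show "tangent_space S q \<subseteq> coord_plane J" by (rule tangent_space_subset_coord_plane[OF assms(1)])
  show "coord_plane J \<subseteq> tangent_space S q"
  proof
    fix v assume v: "v \<in> coord_plane J"
    have "open ((\<lambda>s::real. q + s *\<^sub>R v) -` W1)"
      by (intro open_vimage assms continuous_intros)
    moreover have "0 \<in> (\<lambda>s. q + s *\<^sub>R v) -` W1" using assms by simp
    ultimately obtain e where e0: "0 < e" "ball 0 e \<subseteq> (\<lambda>s. q + s *\<^sub>R v) -` W1"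
      by (meson openE)
    hence e: "0 < e" "\<And>s. \<bar>s\<bar> < e \<Longrightarrow> q + s *\<^sub>R v \<in> W1" by (auto simp: subset_iff)
    have "q + s *\<^sub>R v \<in> coord_plane J" for s
      using v assms by (intro coord_plane_add coord_plane_scaleR) auto
    hence "(\<lambda>s. q + s *\<^sub>R v) ` {-e<..<e} \<subseteq> S"
      using e(2) assms(5) by (auto simp: abs_less_iff)
    moreover have "((\<lambda>s. q + s *\<^sub>R v) has_vector_derivative v) (at 0)"
      by (auto intro!: derivative_eq_intros)
    ultimately show "v \<in> tangent_space S q"
      unfolding tangent_space_def using e(1)
      by (intro CollectI exI[of _ "\<lambda>s. q + s *\<^sub>R v"] exI[of _ e]) auto
  qed
qed

lemma complex_submanifold_hypersurface:
  assumes "j0 \<in> J" "S \<subseteq> hypersurface K c J" "\<And>q. q \<in> S \<Longrightarrow> \<exists>j\<in>J. diff_z K c j q \<noteq> 0"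
    and "\<And>q. q \<in> S \<Longrightarrow> \<exists>W1. open W1 \<and> q \<in> W1 \<and> hypersurface K c J \<inter> W1 \<subseteq> S"
  shows "complex_submanifold S"
  unfolding complex_submanifold_def
proof (rule exI[of _ "coord_plane (J - {j0})"], intro conjI ballI module_subspace_coord_plane)
  fix q assume q: "q \<in> S"
  obtain j where j: "j \<in> J" "diff_z K c j q \<noteq> 0" using assms(3)[OF q] by blast
  obtain W1 where W1: "open W1" "q \<in> W1" "hypersurface K c J \<inter> W1 \<subseteq> S" using assms(4)[OF q] by blast
  have qh: "q \<in> hypersurface K c J" using q assms(2) by blast
  show "\<exists>W W' \<phi> \<psi>. open W \<and> q \<in> W \<and> open W' \<and> homeomorphism W W' \<phi> \<psi> \<and>
      holo_map_on \<phi> W \<and> holo_map_on \<psi> W' \<and> \<phi> ` (S \<inter> W) = coord_plane (J - {j0}) \<inter> W'"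
  proof (rule hypersurface_chart[OF j(1) assms(1) j(2) W1(1,2) qh])
    fix W W' \<phi> \<psi>
    assume *: "open W" "q \<in> W" "W \<subseteq> W1" "open W'" "homeomorphism W W' \<phi> \<psi>"
      "holo_map_on \<phi> W" "holo_map_on \<psi> W'"
      "\<phi> ` (hypersurface K c J \<inter> W) = coord_plane (J - {j0}) \<inter> W'"
    have "S \<inter> W = hypersurface K c J \<inter> W" using *(3) W1(3) assms(2) by blast
    with * show ?thesis by metis
  qed
qed

lemma complex_submanifold_open_plane:
  assumes "S \<subseteq> coord_plane J"
    and "\<And>q. q \<in> S \<Longrightarrow> \<exists>W1. open W1 \<and> q \<in> W1 \<and> coord_plane J \<inter> W1 \<subseteq> S"
  shows "complex_submanifold S"
  unfolding complex_submanifold_def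
proof (rule exI[of _ "coord_plane J"], intro conjI ballI module_subspace_coord_plane)
  fix q assume q: "q \<in> S"
  obtain W1 where W1: "open W1" "q \<in> W1" "coord_plane J \<inter> W1 \<subseteq> S" using assms(2)[OF q] by blast
  have eq: "S \<inter> W1 = coord_plane J \<inter> W1" using W1 assms(1) by blast
  have hol: "holo_map_on (\<lambda>x. x) W1"
    by (intro holo_map_onI exI[of _ "\<lambda>x. x"]) (auto intro: has_derivative_ident)
  show "\<exists>W W' \<phi> \<psi>. open W \<and> q \<in> W \<and> open W' \<and> homeomorphism W W' \<phi> \<psi> \<and>
      holo_map_on \<phi> W \<and> holo_map_on \<psi> W' \<and> \<phi> ` (S \<inter> W) = coord_plane J \<inter> W'"
    by (rule exI[of _ W1], rule exI[of _ W1], rule exI[of _ "\<lambda>x. x"], rule exI[of _ "\<lambda>x. x"])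
       (use W1 eq hol homeomorphism_ident in auto)
qed

section \<open>Limits of tangent spaces\<close>

text \<open>The closest point of \<open>L k\<close> to v is at most as far away as
  \<open>x k\<close>, so these projections tend to v; their limit is also the projection of v to
  T.\<close>

lemma subspaces_tendsto_mem:
  assumes "subspaces_tendsto L T" "\<And>k. closed (L k)" "\<And>k. x k \<in> L k" "x \<longlonglongrightarrow> v"
  shows "v \<in> T"
proof -
  have T: "subspace T" "(\<lambda>k. closest_point (L k) v) \<longlonglongrightarrow> closest_point T v"
    using assms(1) by (auto simp: subspaces_tendsto_def)
  have "dist (closest_point (L k) v) v \<le> dist (x k) v" for k
    using closest_point_le[OF assms(2,3)] by (simp add: dist_commute)
  hence "(\<lambda>k. closest_point (L k) v) \<longlonglongrightarrow> v"
    by (intro metric_tendsto_imp_tendsto[OF assms(4)] always_eventually allI)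
  hence "closest_point T v = v" using T(2) LIMSEQ_unique by blast
  moreover have "closest_point T v \<in> T"
    using T(1) by (intro closest_point_in_set closed_subspace) (auto dest: subspace_0)
  ultimately show ?thesis by simp
qed

lemma subspaces_tendsto_subseq:
  assumes "subspaces_tendsto L T" "strict_mono r"
  shows "subspaces_tendsto (\<lambda>k. L (r k)) T"
  unfolding subspaces_tendsto_def
proof (intro conjI allI)
  show "subspace T" using assms(1) by (simp add: subspaces_tendsto_def)
  have "(\<lambda>k. closest_point (L k) x) \<longlonglongrightarrow> closest_point T x" for x
    using assms(1) by (simp add: subspaces_tendsto_def)
  from LIMSEQ_subseq_LIMSEQ[OF this assms(2)]
  show "(\<lambda>k. closest_point (L (r k)) x) \<longlonglongrightarrow> closest_point T x" for x
    by (simp add: o_def)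
qed

text \<open>Subtracting a multiple of the j-th unit vector moves \<open>u k\<close> into the kernel,
  and this multiple is the quotient assumed to tend to 0. The quotient form allows all derivatives
  to tend to 0 themselves.\<close>

lemma limit_tangent_mem:
  assumes "subspaces_tendsto (\<lambda>k. {v \<in> coord_plane J. family_diff K c (y k) v = 0}) T"
    and "j \<in> J" "\<And>k. u k \<in> coord_plane J" "u \<longlonglongrightarrow> v"
    and nz: "\<forall>\<^sub>F k in sequentially. diff_z K c j (y k) \<noteq> 0"
    and lim: "(\<lambda>k. family_diff K c (y k) (u k) / diff_z K c j (y k)) \<longlonglongrightarrow> 0"
  shows "v \<in> T"
proof (rule subspaces_tendsto_mem[OF assms(1)])
  define a where "a k = family_diff K c (y k) (u k) / diff_z K c j (y k)" for k
  \<comment> \<open>The default 0 is a tangent vector too, and it is used for finitely many k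
    only.\<close>
  define x where "x k = (if diff_z K c j (y k) = 0 then 0 else u k - cscale (a k) (0, axis j 1))" for k
  show "closed {v \<in> coord_plane J. family_diff K c (y k) v = 0}" for k
    by (intro closed_Collect_conj closed_Collect_eq continuous_on_const
        linear_continuous_on bounded_linear_family_diff) (simp add: closed_coord_plane)
  have ax: "(0, axis j 1) \<in> coord_plane J" using assms(2) by (auto simp: coord_plane_iff axis_def)
  have "family_diff K c (y k) (u k - cscale (a k) (0, axis j 1)) = 0" if "diff_z K c j (y k) \<noteq> 0" for k
  proof -
    have "family_diff K c (y k) (u k) = family_diff K c (y k) (u k - cscale (a k) (0, axis j 1)) +
        family_diff K c (y k) (cscale (a k) (0, axis j 1))"
      by (simp only: family_diff_add [symmetric]) simp
    thus ?thesis using that by (simp add: family_diff_cscale family_diff_axis a_def)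
  qed
  moreover have "family_diff K c (y k) 0 = 0" for k
    by (simp add: family_diff_def)
  moreover have "x k \<in> coord_plane J" for k
    using coord_plane_diff[OF assms(3) coord_plane_cscale[OF ax]] coord_plane_0[of J] by (simp add: x_def)
  ultimately show "x k \<in> {v \<in> coord_plane J. family_diff K c (y k) v = 0}" for k
    by (simp add: x_def)
  have "(\<lambda>k. norm (cscale (a k) (0, axis j 1 :: complex^'a))) \<longlonglongrightarrow> 0"
    using tendsto_mult_left_zero[OF tendsto_norm_zero[OF lim]] unfolding norm_cscale a_def .
  hence "(\<lambda>k. cscale (a k) (0, axis j 1 :: complex^'a)) \<longlonglongrightarrow> 0"
    by (rule tendsto_norm_zero_cancel)
  from tendsto_diff[OF assms(4) this]
  have "(\<lambda>k. u k - cscale (a k) (0, axis j 1)) \<longlonglongrightarrow> v - 0" .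
  moreover have "\<forall>\<^sub>F k in sequentially. u k - cscale (a k) (0, axis j 1) = x k"
    using nz by eventually_elim (simp add: x_def)
  ultimately have "x \<longlonglongrightarrow> v - 0" by (rule Lim_transform_eventually)
  thus "x \<longlonglongrightarrow> v" by simp
qed

section \<open>Closures of the strata\<close>

lemma line_poly_monomial_at: "line_poly (\<lambda>q. monomial_at \<alpha> (snd q))"
  unfolding monomial_at_def by (intro line_poly_prod line_poly_power line_poly_snd)

lemma holo_monomial_at: "holo_fun_on (\<lambda>q. monomial_at \<alpha> (snd q)) W"
  using holo_family_sum[of "{\<alpha>}" "\<lambda>_. 1" W] by (simp add: family_sum_def [abs_def])

lemma holo_snd_nth: "holo_fun_on (\<lambda>q. snd q $ i) W"
  unfolding holo_fun_on_def using has_derivative_snd_nth by fastforce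

lemma holo_mult:
  assumes "holo_fun_on f W" "holo_fun_on g W"
  shows "holo_fun_on (\<lambda>q. f q * g q) W"
  unfolding holo_fun_on_def
proof
  fix p assume p: "p \<in> W"
  obtain A B where A: "(f has_derivative A) (at p)" "\<And>c v. A (cscale c v) = c * A v"
    and B: "(g has_derivative B) (at p)" "\<And>c v. B (cscale c v) = c * B v"
    using assms p unfolding holo_fun_on_def by metis
  show "\<exists>A. ((\<lambda>q. f q * g q) has_derivative A) (at p) \<and> (\<forall>c v. A (cscale c v) = c * A v)"
    by (rule exI, rule conjI[OF has_derivative_mult[OF A(1) B(1)]]) (simp add: A B algebra_simps)
qed

text \<open>The exponent of the product of the coordinates in J. This product is the single equation
  that cuts the complement of the torus out of the plane of J.\<close>

definition square_free :: "'n::finite set \<Rightarrow> nat^'n" where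
  "square_free J = (\<chi> i. if i \<in> J then 1 else 0)"

lemma monomial_at_square_free: "monomial_at (square_free J) z = (\<Prod>i\<in>J. z $ i)"
proof -
  have "monomial_at (square_free J) z = (\<Prod>i\<in>UNIV. if i \<in> J then z $ i else 1)"
    unfolding monomial_at_def square_free_def by (intro prod.cong) auto
  thus ?thesis by (simp add: prod.If_cases)
qed

lemma torus_iff:
  "q \<in> UNIV \<times> coord_torus J \<longleftrightarrow> q \<in> coord_plane J \<and> monomial_at (square_free J) (snd q) \<noteq> 0"
  by (cases q) (auto simp: coord_torus_def coord_plane_iff monomial_at_square_free)

lemma family_sum_restrict:
  assumes "finite K" "q \<in> coord_plane J"
  shows "family_sum K c q = family_sum {\<alpha>\<in>K. supported J \<alpha>} c q"
  unfolding family_sum_def using assms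
  by (intro sum.mono_neutral_right)
     (auto simp: coord_plane_def mem_Times_iff monomial_at_eq_0)

lemma ex_family_sum_nonzero:
  assumes "finite K" "\<alpha> \<in> K" "supported J \<alpha>" "c \<alpha> \<noteq> 0"
  shows "\<exists>q\<in>coord_plane J. family_sum K c q \<noteq> 0"
proof -
  obtain t where "poly (c \<alpha>) t \<noteq> 0" using ex_small_nonroot[OF assms(4), of 1] by auto
  from family_sum_nonzero_at[where c = c, OF assms(1-3) this] show ?thesis
    by (auto simp: coord_plane_def)
qed

text \<open>The largest monomial dividing F on the plane of J is split off. Afterwards no coordinate
  with index in J divides the quotient, so it stays nonzero on each coordinate hyperplane of that
  plane.\<close>

lemma ex_reduced_equation:
  fixes K :: "(nat^'n::finite) set"
  assumes "finite K" "\<And>\<alpha>. \<alpha> \<in> K \<Longrightarrow> c \<alpha> \<noteq> 0" "\<alpha>0 \<in> K" "supported J \<alpha>0"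
  shows "\<exists>K' c' m. supported J m \<and>
      (\<forall>q\<in>coord_plane J. family_sum K c q = monomial_at m (snd q) * family_sum K' c' q) \<and>
      (\<exists>q\<in>coord_plane J. family_sum K' c' q \<noteq> 0) \<and>
      (\<forall>i\<in>J. \<exists>q\<in>coord_plane (J - {i}). family_sum K' c' q \<noteq> 0)"
proof -
  define KJ where "KJ = {\<alpha>\<in>K. supported J \<alpha>}"
  have KJ: "finite KJ" "KJ \<noteq> {}" using assms by (auto simp: KJ_def)
  define m :: "nat^'n" where "m = (\<chi> i. Min ((\<lambda>\<alpha>. \<alpha> $ i) ` KJ))"
  have m_le: "m $ i \<le> \<alpha> $ i" if "\<alpha> \<in> KJ" for i \<alpha>
    using KJ that by (simp add: m_def)
  define K' where "K' = (\<lambda>\<alpha>. \<alpha> - m) ` KJ"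
  define c' where "c' = (\<lambda>\<beta>. c (\<beta> + m))"
  have restore: "\<alpha> - m + m = \<alpha>" if "\<alpha> \<in> KJ" for \<alpha>
    using m_le[OF that] by (simp add: vec_eq_iff)
  have inj: "inj_on (\<lambda>\<alpha>. \<alpha> - m) KJ"
    by (rule inj_onI) (metis restore)
  have supm: "supported J m"
    unfolding supported_def
  proof (intro allI impI)
    fix i assume "i \<notin> J"
    hence "\<alpha>0 $ i = 0" using assms(4) by (simp add: supported_def)
    thus "m $ i = 0" using m_le[of \<alpha>0 i] assms(3,4) by (simp add: KJ_def)
  qed
  have fct: "family_sum K c q = monomial_at m (snd q) * family_sum K' c' q" if "q \<in> coord_plane J" for q
  proof -
    have "monomial_at \<alpha> (snd q) = monomial_at m (snd q) * monomial_at (\<alpha> - m) (snd q)" if "\<alpha> \<in> KJ" for \<alpha>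
      unfolding monomial_at_def prod.distrib [symmetric]
      using m_le[OF that] by (intro prod.cong refl) (simp flip: power_add)
    hence "family_sum KJ c q = (\<Sum>\<alpha>\<in>KJ. monomial_at m (snd q) *
        (poly (c' (\<alpha> - m)) (fst q) * monomial_at (\<alpha> - m) (snd q)))"
      unfolding family_sum_def by (intro sum.cong) (auto simp: c'_def restore mult_ac)
    also have "\<dots> = monomial_at m (snd q) * family_sum K' c' q"
      unfolding family_sum_def K'_def sum.reindex[OF inj] sum_distrib_left by simp
    finally show ?thesis using family_sum_restrict[OF assms(1) that] by (simp add: KJ_def)
  qed
  have finK': "finite K'" using KJ by (simp add: K'_def)
  have nz: "c' (\<alpha> - m) \<noteq> 0" "\<alpha> - m \<in> K'" "supported J (\<alpha> - m)" if "\<alpha> \<in> KJ" for \<alpha>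
    using that assms(2) by (auto simp: c'_def restore K'_def KJ_def supported_def)
  have nzJ: "\<exists>q\<in>coord_plane J. family_sum K' c' q \<noteq> 0"
    using KJ ex_family_sum_nonzero[where c = c', OF finK' nz(2,3,1)] by blast
  have nzi: "\<exists>q\<in>coord_plane (J - {i}). family_sum K' c' q \<noteq> 0" if "i \<in> J" for i
  proof -
    \<comment> \<open>The minimum is attained, so some exponent of the quotient does not involve
      coordinate i.\<close>
    have "m $ i \<in> (\<lambda>\<alpha>. \<alpha> $ i) ` KJ"
      using Min_in[of "(\<lambda>\<alpha>. \<alpha> $ i) ` KJ"] KJ by (simp add: m_def)
    then obtain \<alpha> where \<alpha>: "\<alpha> \<in> KJ" "\<alpha> $ i = m $ i" by (metis imageE)
    have "supported (J - {i}) (\<alpha> - m)"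
      using nz(3)[OF \<alpha>(1)] \<alpha>(2) by (auto simp: supported_def)
    from ex_family_sum_nonzero[where c = c', OF finK' nz(2)[OF \<alpha>(1)] this] nz(1)[OF \<alpha>(1)] show ?thesis by blast
  qed
  show ?thesis using supm fct nzJ nzi by blast
qed

lemma holomorphic_poly: "poly P holomorphic_on S" for P :: "complex poly"
  by (meson field_differentiable_at_within field_differentiable_def holomorphic_onI poly_DERIV)

text \<open>A line through \<open>p\<close> on which \<open>g\<close> has an isolated zero at \<open>p\<close> is moved parallel to itself so
  that it meets \<open>{g = 0}\<close> only off the coordinate hyperplanes; by Hurwitz's theorem it still meets
  \<open>{g = 0}\<close> near \<open>p\<close>.\<close>

lemma zero_in_torus_dense:
  fixes K :: "(nat^'n::finite) set" and c J
  defines "g \<equiv> family_sum K c"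
  assumes nz: "\<exists>q\<in>coord_plane J. g q \<noteq> 0"
    and nzi: "\<And>i. i \<in> J \<Longrightarrow> \<exists>q\<in>coord_plane (J - {i}). g q \<noteq> 0"
    and p: "p \<in> coord_plane J" "g p = 0" and e: "0 < e"
  shows "\<exists>x\<in>UNIV \<times> coord_torus J. dist x p < e \<and> g x = 0"
proof -
  have lg: "line_poly g" unfolding g_def by (rule line_poly_family_sum)
  have lf: "line_poly (\<lambda>q. snd q $ i - snd p $ i)" for i
    using line_poly_add[OF line_poly_snd line_poly_const, of i "- (snd p $ i)"] by simp
  have "\<exists>q\<in>coord_plane J. (\<Prod>i\<in>J. snd q $ i - snd p $ i) \<noteq> 0"
  proof (rule line_poly_prod_nonzero)
    fix i assume "i \<in> J"
    hence "p + (0, axis i 1) \<in> coord_plane J" using p by (auto simp: coord_plane_iff axis_def)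
    thus "\<exists>q\<in>coord_plane J. snd q $ i - snd p $ i \<noteq> 0"
      by (intro bexI[of _ "p + (0, axis i 1)"]) (auto simp: axis_def)
  qed (auto intro: lf)
  moreover have lp: "line_poly (\<lambda>q. \<Prod>i\<in>J. snd q $ i - snd p $ i)"
    by (intro line_poly_prod lf)
  \<comment> \<open>The direction q - p must have all J-coordinates nonzero, and g must not vanish
    identically on the line.\<close>
  ultimately obtain q where q: "q \<in> coord_plane J" "g q * (\<Prod>i\<in>J. snd q $ i - snd p $ i) \<noteq> 0"
    using nz line_poly_mult_nonzero[OF lg _ _ lp] by blast
  define v where "v = q - p"
  have v: "v \<in> coord_plane J" using q(1) p(1) by (simp add: v_def coord_plane_diff)
  have vi: "snd v $ i \<noteq> 0" if "i \<in> J" for i using q(2) that by (auto simp: v_def)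
  obtain P where P: "\<And>s. g (p + cscale s v) = poly P s" using line_polyE[OF lg] by blast
  have "poly P 1 \<noteq> 0" using q(2) P[of 1] by (simp add: v_def)
  hence P0: "P \<noteq> 0" by auto
  \<comment> \<open>The line through x in direction v meets the hyperplane of coordinate i exactly
    in \<open>\<pi> i x\<close>. A base point u with \<open>g (\<pi> i u) \<noteq> 0\<close> for all
    i in J thus keeps the zeros on its line off these hyperplanes.\<close>
  define \<pi> where "\<pi> i x = x - cscale (snd x $ i / snd v $ i) v" for i x
  have \<pi>aff: "\<pi> i (x + cscale s w) = \<pi> i x + cscale s (\<pi> i w)" for i x s w
    by (simp add: \<pi>_def prod_eq_iff vec_eq_iff add_divide_distrib algebra_simps)
  have "\<exists>x\<in>coord_plane J. (\<Prod>i\<in>J. g (\<pi> i x)) \<noteq> 0"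
  proof (rule line_poly_prod_nonzero)
    fix i assume i: "i \<in> J"
    obtain x where x: "x \<in> coord_plane (J - {i})" "g x \<noteq> 0" using nzi[OF i] by blast
    have "\<pi> i x = x" using x(1) by (simp add: \<pi>_def coord_plane_iff)
    thus "\<exists>x\<in>coord_plane J. g (\<pi> i x) \<noteq> 0"
      using x coord_plane_mono[of "J - {i}" J] by (intro bexI[of _ x]) auto
  qed (auto intro: line_poly_affine[OF lg \<pi>aff])
  then obtain x0 where x0: "x0 \<in> coord_plane J" "(\<Prod>i\<in>J. g (\<pi> i x0)) \<noteq> 0" by blast
  have lG: "line_poly (\<lambda>x. \<Prod>i\<in>J. g (\<pi> i x))"
    by (intro line_poly_prod line_poly_affine[OF lg \<pi>aff])
  have "\<exists>x\<in>coord_plane J. dist x p < min (e / 2) (inverse (Suc n)) \<and> (\<Prod>i\<in>J. g (\<pi> i x)) \<noteq> 0" for n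
    using e by (intro line_poly_dense[OF lG x0 p(1)]) auto
  then obtain u where u: "\<And>n. u n \<in> coord_plane J" "\<And>n. dist (u n) p < min (e / 2) (inverse (Suc n))"
      "\<And>n. (\<Prod>i\<in>J. g (\<pi> i (u n))) \<noteq> 0"
    by metis
  \<comment> \<open>Parameters below \<delta> move a point by less than e / 2; the other half covers
    the distance from \<open>u n\<close> to p.\<close>
  define \<delta> where "\<delta> = e / (2 * (norm v + 1))"
  have \<delta>: "0 < \<delta>" using e by (simp add: \<delta>_def add_nonneg_pos)
  have "\<exists>n s. norm s < \<delta> \<and> g (u n + cscale s v) = 0"
  proof (rule ccontr)
    assume none: "\<not> (\<exists>n s. norm s < \<delta> \<and> g (u n + cscale s v) = 0)"
    \<comment> \<open>If no parallel line had a zero near p, the limit function P would have none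
      either, yet P vanishes at 0.\<close>
    have "poly P 0 \<noteq> 0"
    proof (rule Hurwitz_no_zeros[of "ball 0 \<delta>" "\<lambda>n s. g (u n + cscale s v)" "poly P"])
      show "(\<lambda>s. g (u n + cscale s v)) holomorphic_on ball 0 \<delta>" for n
      proof -
        obtain Q where "\<And>s. g (u n + cscale s v) = poly Q s" using line_polyE[OF lg] by blast
        thus ?thesis using holomorphic_poly[of Q] by simp
      qed
      show "poly P holomorphic_on ball 0 \<delta>" by (rule holomorphic_poly)
      show "g (u n + cscale s v) \<noteq> 0" if "s \<in> ball 0 \<delta>" for n s using none that by auto
      show "\<not> poly P constant_on ball 0 \<delta>"
      proof
        assume "poly P constant_on ball 0 \<delta>"
        then obtain a where a: "\<And>s. norm s < \<delta> \<Longrightarrow> poly P s = a" by (auto simp: constant_on_def)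
        moreover have "poly P 0 = 0" using P[of 0] p(2) by simp
        ultimately have "a = 0" using \<delta> by force
        obtain s where "norm s < \<delta>" "poly P s \<noteq> 0" by (rule ex_small_nonroot[OF P0 \<delta>])
        with a \<open>a = 0\<close> show False by auto
      qed
      show "uniform_limit C (\<lambda>n s. g (u n + cscale s v)) (poly P) sequentially"
        if "compact C" "C \<subseteq> ball 0 \<delta>" for C
      proof (rule uniform_limitI)
        fix \<epsilon> :: real assume \<epsilon>: "0 < \<epsilon>"
        have "continuous_on (cball p 1 \<times> C) (\<lambda>y. g (fst y + cscale (snd y) v))"
          unfolding g_def cscale_def vector_scalar_mult_def
          by (intro continuous_on_compose2[OF continuous_on_family_sum[of UNIV]] continuous_intros) auto
        hence "uniformly_continuous_on (cball p 1 \<times> C) (\<lambda>y. g (fst y + cscale (snd y) v))"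
          by (intro compact_uniformly_continuous compact_Times that compact_cball)
        then obtain d where d: "0 < d" "\<And>y y'. y \<in> cball p 1 \<times> C \<Longrightarrow> y' \<in> cball p 1 \<times> C \<Longrightarrow>
            dist y' y < d \<Longrightarrow> dist (g (fst y' + cscale (snd y') v)) (g (fst y + cscale (snd y) v)) < \<epsilon>"
          unfolding uniformly_continuous_on_def using \<epsilon> by metis
        have "\<forall>\<^sub>F n in sequentially. inverse (real (Suc n)) < d"
          using LIMSEQ_inverse_real_of_nat d(1) order_tendstoD(2) by blast
        thus "\<forall>\<^sub>F n in sequentially. \<forall>s\<in>C. dist (g (u n + cscale s v)) (poly P s) < \<epsilon>"
        proof eventually_elim
          case (elim n)
          have "inverse (real (Suc n)) \<le> 1" by (simp add: inverse_le_1_iff)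
          hence un: "dist (u n) p \<le> 1" "dist (u n) p < d" using u(2)[of n] elim by auto
          show ?case
          proof
            fix s assume s: "s \<in> C"
            show "dist (g (u n + cscale s v)) (poly P s) < \<epsilon>"
              using d(2)[of "(p, s)" "(u n, s)"] s un P[of s]
              by (simp add: dist_Pair_Pair dist_commute)
          qed
        qed
      qed
    qed (use \<delta> in auto)
    thus False using P[of 0] p(2) by simp
  qed
  then obtain n s where s: "norm s < \<delta>" "g (u n + cscale s v) = 0" by blast
  define x where "x = u n + cscale s v"
  have x: "x \<in> coord_plane J" unfolding x_def by (intro coord_plane_add u coord_plane_cscale v)
  have "norm s * norm v \<le> norm s * (norm v + 1)" by (simp add: mult_left_mono)
  also have "\<dots> < e / 2"
  proof -
    have "0 < 2 * (norm v + 1)" by (simp add: add_nonneg_pos)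
    hence "norm s * (2 * (norm v + 1)) < e"
      using s(1) unfolding \<delta>_def by (simp only: pos_less_divide_eq)
    thus ?thesis by (simp add: algebra_simps)
  qed
  finally have "dist x (u n) < e / 2" by (simp add: x_def dist_norm)
  hence "dist x p < e" using u(2)[of n] dist_triangle[of x p "u n"] by simp
  moreover have "snd x $ i \<noteq> 0" if i: "i \<in> J" for i
  proof
    assume "snd x $ i = 0"
    hence "s = - (snd (u n) $ i / snd v $ i)" using vi[OF i] by (simp add: x_def field_simps add_eq_0_iff)
    hence "x = \<pi> i (u n)" by (simp add: x_def \<pi>_def prod_eq_iff vec_eq_iff)
    hence "g (\<pi> i (u n)) = 0" using s(2) by (simp add: x_def)
    thus False using u(3)[of n] i by (simp add: prod_zero_iff) 
  qed
  ultimately show ?thesis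
    using s(2) x by (intro bexI[of _ x]) (auto simp: x_def torus_iff monomial_at_square_free prod_zero_iff)
qed


lemma closure_eqI:
  fixes X :: "'a::metric_space set"
  assumes "X \<subseteq> Y" "closed Y" "\<And>p e. p \<in> Y \<Longrightarrow> 0 < e \<Longrightarrow> \<exists>x\<in>X. dist x p < e"
  shows "closure X = Y"
  using assms closure_minimal[of X Y] closure_approachable[of _ X] by (meson subsetI subset_antisym)

lemma closure_torus_nonzero:
  assumes "line_poly g" "\<exists>q\<in>coord_plane J. g q \<noteq> 0"
  shows "closure {q \<in> UNIV \<times> coord_torus J. g q \<noteq> 0} = coord_plane J"
proof (rule closure_eqI)
  fix p e assume p: "p \<in> coord_plane J" "0 < (e::real)"
  have lh: "line_poly (\<lambda>q. g q * monomial_at (square_free J) (snd q))"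
    by (intro line_poly_mult assms line_poly_monomial_at)
  have "(0, \<chi> i. if i \<in> J then 1 else 0) \<in> coord_plane J"
    "monomial_at (square_free J) (snd (0::complex, \<chi> i. if i \<in> J then 1 else 0)) \<noteq> 0"
    by (auto simp: coord_plane_iff monomial_at_square_free)
  then obtain q where q: "q \<in> coord_plane J" "g q * monomial_at (square_free J) (snd q) \<noteq> 0"
    using line_poly_mult_nonzero[OF assms(1) _ _ line_poly_monomial_at] assms(2) by blast
  from line_poly_dense[OF lh this p] torus_iff
  show "\<exists>x\<in>{q \<in> UNIV \<times> coord_torus J. g q \<noteq> 0}. dist x p < e"
    by (metis (mono_tags, lifting) mem_Collect_eq mult_eq_0_iff)
qed (use closed_coord_plane torus_iff in blast)+

lemma closed_hypersurface: "closed (hypersurface K c J)"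
  unfolding hypersurface_def
  by (intro closed_Collect_conj closed_Collect_eq continuous_on_const continuous_on_family_sum)
     (simp add: closed_coord_plane)

text \<open>On the torus the monomial factor is invertible, so both equations have the same zeros
  there; the reduced one describes the closure.\<close>

lemma closure_hypersurface_torus:
  assumes "supported J m"
    and fct: "\<And>q. q \<in> coord_plane J \<Longrightarrow> family_sum K c q = monomial_at m (snd q) * family_sum K' c' q"
    and nz: "\<exists>q\<in>coord_plane J. family_sum K' c' q \<noteq> 0"
      "\<And>i. i \<in> J \<Longrightarrow> \<exists>q\<in>coord_plane (J - {i}). family_sum K' c' q \<noteq> 0"
  shows "closure (hypersurface K c J \<inter> (UNIV \<times> coord_torus J)) = hypersurface K' c' J"
proof -
  have eq: "hypersurface K c J \<inter> (UNIV \<times> coord_torus J) = hypersurface K' c' J \<inter> (UNIV \<times> coord_torus J)"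
    using fct monomial_at_nonzero[OF _ assms(1)] by (auto simp: hypersurface_def)
  show ?thesis
    unfolding eq
  proof (rule closure_eqI)
    show "closed (hypersurface K' c' J)"
      by (rule closed_hypersurface)
    fix p e assume p: "p \<in> hypersurface K' c' J" "0 < (e::real)"
    show "\<exists>x\<in>hypersurface K' c' J \<inter> (UNIV \<times> coord_torus J). dist x p < e"
      using zero_in_torus_dense[OF nz _ _ p(2)] p(1) torus_iff by (fastforce simp: hypersurface_def)
  qed auto
qed

lemma analytic_subset_coord_plane:
  assumes "open W" "holo_fun_on g W" "holo_fun_on h W"
    and "Y = {q \<in> W. q \<in> coord_plane J \<and> g q = 0 \<and> h q = 0}"
  shows "analytic_subset W Y"
  unfolding analytic_subset_def
proof (intro conjI ballI)
  show "Y \<subseteq> W" using assms(4) by blast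
  fix p assume "p \<in> W"
  define G where "G = insert g (insert h ((\<lambda>i q. snd q $ i) ` (- J)))"
  have "\<forall>f\<in>G. holo_fun_on f W" using assms(2,3) holo_snd_nth by (auto simp: G_def)
  moreover have "Y \<inter> W = {q \<in> W. \<forall>f\<in>G. f q = 0}"
    unfolding assms(4) G_def coord_plane_iff by auto
  moreover have "finite G" by (simp add: G_def)
  ultimately show "\<exists>N G. open N \<and> p \<in> N \<and> N \<subseteq> W \<and> finite G \<and> (\<forall>g\<in>G. holo_fun_on g N) \<and>
      Y \<inter> N = {q \<in> N. \<forall>g\<in>G. g q = 0}"
    using assms(1) \<open>p \<in> W\<close> by blast
qed

text \<open>For open W, closures relative to W are traces of global closures. The form "closure
  given by g, boundary by one further equation h" is shared by all strata.\<close>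

lemma analytic_closure:
  assumes "open W" "holo_fun_on g W" "holo_fun_on h W"
    and cl: "closure X = {q \<in> coord_plane J. g q = 0}"
    and df: "{q \<in> coord_plane J. g q = 0} - X = {q \<in> coord_plane J. g q = 0 \<and> h q = 0}"
  shows "analytic_subset W (closure (W \<inter> X) \<inter> W)"
    and "analytic_subset W (closure (W \<inter> X) \<inter> W - W \<inter> X)"
proof -
  have eq: "closure (W \<inter> X) \<inter> W = W \<inter> {q \<in> coord_plane J. g q = 0}"
    using open_Int_closure_subset[OF assms(1), of X] closure_mono[of "W \<inter> X" X] cl by blast
  show "analytic_subset W (closure (W \<inter> X) \<inter> W)"
    unfolding eq by (rule analytic_subset_coord_plane[OF assms(1,2,2)]) blast
  have "W \<inter> {q \<in> coord_plane J. g q = 0} - W \<inter> X = W \<inter> ({q \<in> coord_plane J. g q = 0} - X)" by blast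
  thus "analytic_subset W (closure (W \<inter> X) \<inter> W - W \<inter> X)"
    unfolding eq df by (intro analytic_subset_coord_plane[OF assms(1,2,3)]) auto
qed

section \<open>Limits of tangent spaces at a vanishing stratum\<close>

text \<open>One statement for F, its t-derivative and its logarithmic z-derivatives, which differ
  only in the polynomials C and the constants e.\<close>

lemma sum_quotient_tendsto:
  assumes "t \<longlonglongrightarrow> t0"
    and "\<And>\<alpha>. \<alpha> \<in> K \<Longrightarrow> (\<lambda>k. X \<alpha> k / M k) \<longlonglongrightarrow> (if \<alpha> \<in> F then l \<alpha> else 0)"
    and "finite K" "F \<subseteq> K"
  shows "(\<lambda>k. (\<Sum>\<alpha>\<in>K. poly (C \<alpha>) (t k) * e \<alpha> * X \<alpha> k) / M k) \<longlonglongrightarrow>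
      (\<Sum>\<alpha>\<in>F. poly (C \<alpha>) t0 * e \<alpha> * (l \<alpha> :: complex))"
proof -
  have "(\<lambda>k. \<Sum>\<alpha>\<in>K. poly (C \<alpha>) (t k) * e \<alpha> * (X \<alpha> k / M k)) \<longlonglongrightarrow>
      (\<Sum>\<alpha>\<in>K. poly (C \<alpha>) t0 * e \<alpha> * (if \<alpha> \<in> F then l \<alpha> else 0))"
    by (intro tendsto_sum tendsto_mult tendsto_const assms tendsto_poly)
  also have "(\<Sum>\<alpha>\<in>K. poly (C \<alpha>) t0 * e \<alpha> * (if \<alpha> \<in> F then l \<alpha> else 0)) =
      (\<Sum>\<alpha>\<in>F. poly (C \<alpha>) t0 * e \<alpha> * l \<alpha>)"
    using assms(3,4) by (intro sum.mono_neutral_cong_right) auto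
  finally show ?thesis by (simp add: sum_divide_distrib)
qed

lemma tangent_limit_at_vanishing_stratum:
  fixes K :: "(nat^'n::finite) set" and c and x y :: "nat \<Rightarrow> 'n tspace"
  assumes K: "finite K" "\<exists>\<alpha>\<in>K. supported J \<alpha>" "\<And>\<alpha>. \<alpha> \<in> K \<Longrightarrow> \<not> supported I \<alpha>"
    and y: "\<And>k. y k \<in> UNIV \<times> coord_torus J" "\<And>k. family_sum K c (y k) = 0" "y \<longlonglongrightarrow> p"
    and x: "\<And>k. x k \<in> coord_plane I" and p: "p \<in> UNIV \<times> coord_torus I"
    and T: "subspaces_tendsto (\<lambda>k. {v \<in> coord_plane J. family_diff K c (y k) v = 0}) T"
    and v: "(\<lambda>k. cscale (a k) (x k - y k)) \<longlonglongrightarrow> v"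
    and tame: "\<And>w \<beta> z. weight_zeros w = I \<Longrightarrow> \<beta> \<in> K \<Longrightarrow>
      (\<forall>\<alpha>\<in>K. weight_value w (real_exponent \<beta>) \<le> weight_value w (real_exponent \<alpha>)) \<Longrightarrow>
      z \<in> coord_torus UNIV \<Longrightarrow> (\<forall>i\<in>I. z $ i = snd p $ i) \<Longrightarrow>
      \<exists>j\<in>-I. diff_z {\<alpha>\<in>K. weight_value w (real_exponent \<alpha>) = weight_value w (real_exponent \<beta>)} c j (fst p, z) \<noteq> 0"
  shows "v \<in> T"
proof -
  have zJ: "snd (y k) $ i \<noteq> 0 \<longleftrightarrow> i \<in> J" for k i
    using y(1)[of k] by (auto simp: coord_torus_def mem_Times_iff)
  have pI: "snd p $ i \<noteq> 0 \<longleftrightarrow> i \<in> I" for i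
    using p by (auto simp: coord_torus_def mem_Times_iff)
  have zlim: "(\<lambda>k. snd (y k) $ i) \<longlonglongrightarrow> snd p $ i" for i
    by (intro tendsto_intros y)
  have IJ: "I \<subseteq> J"
  proof
    fix i assume "i \<in> I"
    show "i \<in> J"
    proof (rule ccontr)
      assume "i \<notin> J"
      hence "(\<lambda>k. snd (y k) $ i) = (\<lambda>k. 0)" using zJ by auto
      hence "snd p $ i = 0" using zlim[of i] LIMSEQ_unique[OF tendsto_const] by metis
      thus False using pI \<open>i \<in> I\<close> by blast
    qed
  qed
  define u where "u k = cscale (a k) (x k - y k)" for k
  have ulim: "u \<longlonglongrightarrow> v" using v by (simp add: u_def [abs_def])
  have yJ: "y k \<in> coord_plane J" for k using zJ by (auto simp: coord_plane_iff)
  have uJ: "u k \<in> coord_plane J" for k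
    unfolding u_def using x[of k] coord_plane_mono[OF IJ] yJ by (intro coord_plane_cscale coord_plane_diff) auto
  \<comment> \<open>Outside I the points \<open>x k\<close> have zero coordinates, so there the
    scaled secants are proportional to \<open>y k\<close> with a common factor.\<close>
  have uN: "snd (u k) $ j = - a k * snd (y k) $ j" if "j \<in> J - I" for j k
    using x[of k] that by (simp add: u_def coord_plane_iff)
  have uilim: "(\<lambda>k. snd (u k) $ i) \<longlonglongrightarrow> snd v $ i" for i
    by (intro tendsto_intros ulim)
  \<comment> \<open>For i, j in P the quotient of the moduli of the coordinates of
    \<open>y k\<close> tends to |v_i| / |v_j|, so equal weights can be prescribed.\<close>
  define P where "P = {j\<in>J - I. snd v $ j \<noteq> 0}"
  have ratio: "\<forall>i\<in>P. \<forall>j\<in>P. bounded (range (\<lambda>k. ln (norm (snd (y k) $ i)) - ln (norm (snd (y k) $ j))))"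
  proof (intro ballI)
    fix i j assume ij: "i \<in> P" "j \<in> P"
    have "(\<lambda>k. ln (norm (snd (u k) $ i)) - ln (norm (snd (u k) $ j))) \<longlonglongrightarrow>
        ln (norm (snd v $ i)) - ln (norm (snd v $ j))"
      using ij by (intro tendsto_intros uilim) (auto simp: P_def)
    moreover have "\<forall>\<^sub>F k in sequentially. ln (norm (snd (u k) $ i)) - ln (norm (snd (u k) $ j)) =
        ln (norm (snd (y k) $ i)) - ln (norm (snd (y k) $ j))"
    proof -
      have "\<forall>\<^sub>F k in sequentially. snd (u k) $ i \<noteq> 0"
        using ij by (intro tendsto_imp_eventually_ne[OF uilim]) (auto simp: P_def)
      thus ?thesis
      proof eventually_elim
        case (elim k)
        hence "a k \<noteq> 0" using uN[of i k] ij by (auto simp: P_def)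
        thus ?case using uN[of i k] uN[of j k] ij zJ[of k] by (simp add: P_def norm_mult ln_mult)
      qed
    qed
    ultimately have "(\<lambda>k. ln (norm (snd (y k) $ i)) - ln (norm (snd (y k) $ j))) \<longlonglongrightarrow>
        ln (norm (snd v $ i)) - ln (norm (snd v $ j))" by (rule Lim_transform_eventually)
    thus "bounded (range (\<lambda>k. ln (norm (snd (y k) $ i)) - ln (norm (snd (y k) $ j))))"
      by (rule convergent_imp_bounded)
  qed
  define KJ where "KJ = {\<alpha>\<in>K. supported J \<alpha>}"
  have zp: "(\<lambda>k. snd (y k)) \<longlonglongrightarrow> snd p" by (intro tendsto_intros y)
  have zt: "snd (y k) \<in> coord_torus J" for k using y(1)[of k] by (simp add: mem_Times_iff)
  have pt: "snd p \<in> coord_torus I" using p by (simp add: mem_Times_iff)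
  have KJ: "finite KJ" "KJ \<noteq> {}" "\<forall>\<alpha>\<in>KJ. supported J \<alpha>" using K by (auto simp: KJ_def)
  have PJ: "P \<subseteq> J - I" by (auto simp: P_def)
  obtain r :: "nat \<Rightarrow> nat" and w \<beta> b and M :: "nat \<Rightarrow> complex" where
    r: "strict_mono r" and \<beta>: "\<beta> \<in> KJ" and wI: "weight_zeros w = I"
    and wP: "\<forall>i\<in>P. \<forall>j\<in>P. w $ i = w $ j"
    and wmin: "\<forall>\<alpha>\<in>KJ. weight_value w (real_exponent \<beta>) \<le> weight_value w (real_exponent \<alpha>)"
    and wout: "\<forall>j. j \<notin> J \<longrightarrow> weight_value w (real_exponent \<beta>) < real (w $ j)"
    and b: "b \<in> coord_torus UNIV" "\<forall>i\<in>I. b $ i = snd p $ i" and M: "\<forall>k. M k \<noteq> 0"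
    and mlim: "\<forall>\<alpha>\<in>KJ. (\<lambda>k. monomial_at \<alpha> (snd (y (r k))) / M k) \<longlonglongrightarrow>
       (if weight_value w (real_exponent \<alpha>) = weight_value w (real_exponent \<beta>)
        then monomial_at \<alpha> b else 0)"
    using torus_sequence_weights[of KJ J "\<lambda>k. snd (y k)" "snd p" I P, OF KJ zt zp pt IJ PJ ratio]
    by (elim exE conjE) (erule that)
  define d where "d = weight_value w (real_exponent \<beta>)"
  define F where "F = {\<alpha>\<in>K. weight_value w (real_exponent \<alpha>) = d}"
  \<comment> \<open>The face is taken in the full exponent set. Monomials involving a coordinate
    outside J vanish along the sequence, and the large weights there keep them off the face.\<close>
  have high: "d < weight_value w (real_exponent \<alpha>)" if \<alpha>: "\<alpha> \<in> K" "\<alpha> \<notin> KJ" for \<alpha>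
  proof -
    obtain j where j: "j \<notin> J" "\<alpha> $ j \<noteq> 0" using \<alpha> by (auto simp: KJ_def supported_def)
    have "d < real (w $ j)" using wout j(1) by (simp add: d_def)
    also have "\<dots> \<le> real (\<alpha> $ j) * real (w $ j)" using j(2) by (simp add: mult_le_cancel_right1)
    also have "\<dots> \<le> weight_value w (real_exponent \<alpha>)"
      unfolding weight_value_def real_exponent_nth by (intro member_le_sum) auto
    finally show ?thesis .
  qed
  have FJ: "supported J \<alpha>" if "\<alpha> \<in> F" for \<alpha>
    using high[of \<alpha>] that by (auto simp: F_def KJ_def)
  have mlim': "(\<lambda>k. monomial_at \<alpha> (snd (y (r k))) / M k) \<longlonglongrightarrow> (if \<alpha> \<in> F then monomial_at \<alpha> b else 0)"
    if \<alpha>: "\<alpha> \<in> K" for \<alpha>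
  proof (cases "\<alpha> \<in> KJ")
    case True
    thus ?thesis using bspec[OF mlim True] \<alpha> by (simp add: F_def d_def)
  next
    case False
    have "monomial_at \<alpha> (snd (y (r k))) = 0" for k
      using yJ[of "r k"] False \<alpha> by (intro monomial_at_eq_0) (auto simp: coord_plane_def KJ_def mem_Times_iff)
    thus ?thesis using high[OF \<alpha> False] by (simp add: F_def)
  qed
  have yr: "(\<lambda>k. y (r k)) \<longlonglongrightarrow> p" using LIMSEQ_subseq_LIMSEQ[OF y(3) r] by (simp add: o_def)
  have tr: "(\<lambda>k. fst (y (r k))) \<longlonglongrightarrow> fst p" by (intro tendsto_intros yr)
  have zr: "(\<lambda>k. snd (y (r k)) $ i) \<longlonglongrightarrow> snd p $ i" for i by (intro tendsto_intros yr)
  have ur: "(\<lambda>k. u (r k)) \<longlonglongrightarrow> v" using LIMSEQ_subseq_LIMSEQ[OF ulim r] by (simp add: o_def)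
  have uir: "(\<lambda>k. snd (u (r k)) $ i) \<longlonglongrightarrow> snd v $ i" for i by (intro tendsto_intros ur)
  have FK: "F \<subseteq> K" by (auto simp: F_def)
  note slim = sum_quotient_tendsto[OF tr mlim' K(1) FK]
  define D where "D j = b $ j * diff_z F c j (fst p, b)" for j
  have D_sum: "D j = (\<Sum>\<alpha>\<in>F. poly (c \<alpha>) (fst p) * of_nat (\<alpha> $ j) * monomial_at \<alpha> b)" for j
    unfolding D_def using mult_diff_z[of "(fst p, b)" j F c] by simp
  have D_lim: "(\<lambda>k. snd (y (r k)) $ j * diff_z K c j (y (r k)) / M k) \<longlonglongrightarrow> D j" for j
    unfolding mult_diff_z D_sum by (rule slim)
  have Dt_lim: "(\<lambda>k. diff_t K c (y (r k)) / M k) \<longlonglongrightarrow>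
      (\<Sum>\<alpha>\<in>F. poly (pderiv (c \<alpha>)) (fst p) * 1 * monomial_at \<alpha> b)"
    using slim[of "\<lambda>\<alpha>. pderiv (c \<alpha>)" "\<lambda>_. 1"] by (simp add: diff_t_def)
  have f0: "(\<Sum>\<alpha>\<in>F. poly (c \<alpha>) (fst p) * monomial_at \<alpha> b) = 0"
  proof -
    have "(\<lambda>k. family_sum K c (y (r k)) / M k) \<longlonglongrightarrow> (\<Sum>\<alpha>\<in>F. poly (c \<alpha>) (fst p) * 1 * monomial_at \<alpha> b)"
      using slim[of c "\<lambda>_. 1"] by (simp add: family_sum_def)
    thus ?thesis by (simp add: y(2) LIMSEQ_const_iff)
  qed
  have euler: "(\<Sum>i\<in>UNIV. of_nat (w $ i) * D i) = 0"
  proof -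
    have "(\<Sum>i\<in>UNIV. of_nat (w $ i) * D i) =
        (\<Sum>\<alpha>\<in>F. poly (c \<alpha>) (fst p) * monomial_at \<alpha> b * (\<Sum>i\<in>UNIV. of_nat (\<alpha> $ i) * of_nat (w $ i)))"
      unfolding D_sum sum_distrib_left by (subst sum.swap) (simp add: mult_ac)
    also have "\<dots> = (\<Sum>\<alpha>\<in>F. poly (c \<alpha>) (fst p) * monomial_at \<alpha> b * of_real d)"
    proof (intro sum.cong refl)
      fix \<alpha> assume "\<alpha> \<in> F"
      hence "d = (\<Sum>i\<in>UNIV. real (\<alpha> $ i) * real (w $ i))" by (simp add: F_def weight_value_def)
      thus "poly (c \<alpha>) (fst p) * monomial_at \<alpha> b * (\<Sum>i\<in>UNIV. of_nat (\<alpha> $ i) * of_nat (w $ i)) =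
          poly (c \<alpha>) (fst p) * monomial_at \<alpha> b * of_real d" by simp
    qed
    also have "\<dots> = 0" using f0 by (simp flip: sum_distrib_right)
    finally show ?thesis .
  qed
  have D_out: "D j = 0" if "j \<notin> J" for j
    unfolding D_sum using FJ that by (intro sum.neutral) (auto simp: supported_def)
  obtain j0 where j0: "j0 \<in> J - I" "D j0 \<noteq> 0"
  proof -
    have "\<exists>j\<in>-I. diff_z {\<alpha>\<in>K. weight_value w (real_exponent \<alpha>) = weight_value w (real_exponent \<beta>)} c j (fst p, b) \<noteq> 0"
    proof (rule tame[OF wI _ _ b(1)])
      show "\<beta> \<in> K" using \<beta> by (simp add: KJ_def)
      show "\<forall>\<alpha>\<in>K. weight_value w (real_exponent \<beta>) \<le> weight_value w (real_exponent \<alpha>)"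
        using wmin high less_imp_le unfolding d_def by blast
    qed (use b in auto)
    then obtain j where j: "j \<notin> I" "diff_z F c j (fst p, b) \<noteq> 0" by (auto simp: F_def d_def)
    hence "D j \<noteq> 0" using b(1) by (auto simp: D_def coord_torus_def)
    thus ?thesis using that[of j] j D_out by blast
  qed
  have restrict: "(\<Sum>i\<in>UNIV. if i \<in> J - I then h i else 0) = sum h (J - I)" for h :: "'n \<Rightarrow> complex"
    by (rule sum.mono_neutral_cong_right) auto
  \<comment> \<open>If v_j is nonzero whenever D_j is, all these indices lie in P and share the
    weight of \<open>j0\<close>, which can be cancelled from Euler's identity.\<close>
  have "\<exists>j\<in>J - I. D j \<noteq> 0 \<and> snd v $ j * (\<Sum>i\<in>J - I. D i) = 0"
  proof (cases "\<exists>j\<in>J - I. D j \<noteq> 0 \<and> snd v $ j = 0")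
    case True
    thus ?thesis by auto
  next
    case False
    have "of_nat (w $ i) * D i = (if i \<in> J - I then of_nat (w $ j0) * D i else 0)" for i
    proof (cases "i \<in> J - I")
      case True
      thus ?thesis using False j0 wP by (cases "D i = 0") (auto simp: P_def)
    next
      case Fi: False
      thus ?thesis using D_out[of i] wI by (auto simp: weight_zeros_def)
    qed
    hence "0 = (\<Sum>i\<in>UNIV. if i \<in> J - I then of_nat (w $ j0) * D i else 0)" using euler by simp
    also have "\<dots> = of_nat (w $ j0) * (\<Sum>i\<in>J - I. D i)"
      by (simp only: restrict sum_distrib_left)
    finally have "of_nat (w $ j0) * (\<Sum>i\<in>J - I. D i) = 0" by simp
    moreover have "w $ j0 \<noteq> 0" using j0 wI by (auto simp: weight_zeros_def)
    ultimately show ?thesis using j0 by auto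
  qed
  then obtain j where j: "j \<in> J - I" "D j \<noteq> 0" "snd v $ j * (\<Sum>i\<in>J - I. D i) = 0" by blast
  \<comment> \<open>Multiplying by the j-th coordinate of y turns dF/dz_j into a logarithmic
    derivative, with nonzero limit D_j after division by M.\<close>
  define Z where "Z k = snd (y (r k)) $ j" for k
  have Z0: "Z \<longlonglongrightarrow> 0" using zr[of j] pI[of j] j(1) by (simp add: Z_def [abs_def])
  have Zn: "Z k \<noteq> 0" for k using zJ[of "r k" j] j(1) by (simp add: Z_def)
  have term_i: "(\<lambda>k. Z k * (diff_z K c i (y (r k)) * snd (u (r k)) $ i) / M k) \<longlonglongrightarrow>
      (if i \<in> J - I then snd v $ j * D i else 0)" for i
  proof (cases "i \<in> J")
    case False
    hence "snd (u k) $ i = 0" for k using uJ[of k] by (simp add: coord_plane_iff)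
    thus ?thesis using False by simp
  next
    case iJ: True
    show ?thesis
    proof (cases "i \<in> I")
      case True
      \<comment> \<open>For i in I the coordinate of y has a nonzero limit, so dF/dz_i itself
        converges after division by M and Z sends the term to 0.\<close>
      have "(\<lambda>k. Z k * ((snd (y (r k)) $ i * diff_z K c i (y (r k)) / M k) / snd (y (r k)) $ i * snd (u (r k)) $ i)) \<longlonglongrightarrow>
          0 * (D i / snd p $ i * snd v $ i)"
        using True pI by (intro tendsto_intros Z0 D_lim zr uir) auto
      thus ?thesis using True zJ[of "r _" i] iJ by (simp add: mult_ac)
    next
      case False
      hence i: "i \<in> J - I" using iJ by blast
      \<comment> \<open>With u_i = -a y_i and u_j = -a y_j one has y_j u_i = u_j y_i, which again
        produces a logarithmic derivative.\<close>
      have "Z k * (diff_z K c i (y (r k)) * snd (u (r k)) $ i) / M k =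
          snd (u (r k)) $ j * (snd (y (r k)) $ i * diff_z K c i (y (r k)) / M k)" for k
        using uN[OF i, of "r k"] uN[OF j(1), of "r k"] by (simp add: Z_def)
      moreover have "(\<lambda>k. snd (u (r k)) $ j * (snd (y (r k)) $ i * diff_z K c i (y (r k)) / M k)) \<longlonglongrightarrow> snd v $ j * D i"
        by (intro tendsto_mult uir D_lim)
      ultimately show ?thesis by (simp only: if_P[OF i])
    qed
  qed
  \<comment> \<open>The limit is v_j times the sum of the D_i over J - I, zero by the choice of j;
    the t-derivative is killed by Z.\<close>
  have "(\<lambda>k. Z k * (diff_t K c (y (r k)) / M k * fst (u (r k))) +
       (\<Sum>i\<in>UNIV. Z k * (diff_z K c i (y (r k)) * snd (u (r k)) $ i) / M k)) \<longlonglongrightarrow>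
      0 * ((\<Sum>\<alpha>\<in>F. poly (pderiv (c \<alpha>)) (fst p) * 1 * monomial_at \<alpha> b) * fst v) +
      (\<Sum>i\<in>UNIV. if i \<in> J - I then snd v $ j * D i else 0)"
    by (intro tendsto_add tendsto_mult tendsto_sum Z0 Dt_lim term_i tendsto_fst ur)
  moreover have "(\<Sum>i\<in>UNIV. if i \<in> J - I then snd v $ j * D i else 0) = 0"
    using j(3) by (simp only: restrict sum_distrib_left)
  moreover have "Z k * (diff_t K c (y (r k)) / M k * fst (u (r k))) +
       (\<Sum>i\<in>UNIV. Z k * (diff_z K c i (y (r k)) * snd (u (r k)) $ i) / M k) =
      Z k * family_diff K c (y (r k)) (u (r k)) / M k" for k
    unfolding family_diff_def by (simp add: algebra_simps add_divide_distrib sum_distrib_left sum_divide_distrib)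
  ultimately have num: "(\<lambda>k. Z k * family_diff K c (y (r k)) (u (r k)) / M k) \<longlonglongrightarrow> 0" by simp
  have den: "(\<lambda>k. Z k * diff_z K c j (y (r k)) / M k) \<longlonglongrightarrow> D j"
    using D_lim[of j] by (simp add: Z_def)
  show ?thesis
  proof (rule limit_tangent_mem[OF subspaces_tendsto_subseq[OF T r], of j "\<lambda>k. u (r k)"])
    show "\<forall>\<^sub>F k in sequentially. diff_z K c j (y (r k)) \<noteq> 0"
      using tendsto_imp_eventually_ne[OF den j(2)] by eventually_elim auto
    have "(\<lambda>k. (Z k * family_diff K c (y (r k)) (u (r k)) / M k) / (Z k * diff_z K c j (y (r k)) / M k)) \<longlonglongrightarrow> 0 / D j"
      by (intro tendsto_divide num den j)
    thus "(\<lambda>k. family_diff K c (y (r k)) (u (r k)) / diff_z K c j (y (r k))) \<longlonglongrightarrow> 0"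
      using Zn M by simp
  qed (use j uJ ur in auto)
qed

section \<open>Whitney regularity of the canonical strata\<close>

text \<open>Strict differentiability: both ends of a secant move, so the derivative at p alone gives
  too little. The mean value inequality is applied to F minus its differential at p.\<close>

lemma family_diff_strict:
  fixes p :: "'n::finite tspace"
  assumes "0 < e"
  shows "\<exists>d>0. \<forall>x\<in>ball p d. \<forall>y\<in>ball p d.
    norm (family_sum K c x - family_sum K c y - family_diff K c p (x - y)) \<le> e * norm (x - y)"
proof -
  define \<kappa> where "\<kappa> s = norm (diff_t K c s - diff_t K c p) + (\<Sum>i\<in>UNIV. norm (diff_z K c i s - diff_z K c i p))" for s
  have "continuous_on UNIV \<kappa>"
    unfolding \<kappa>_def by (intro continuous_intros continuous_on_diff_t continuous_on_diff_z)
  hence "isCont \<kappa> p" using continuous_on_eq_continuous_at[OF open_UNIV] by blast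
  then obtain d where d: "0 < d" "\<And>s. dist s p < d \<Longrightarrow> dist (\<kappa> s) (\<kappa> p) < e"
    using assms unfolding continuous_at_eps_delta by (metis dist_commute)
  have \<kappa>p: "\<kappa> p = 0" by (simp add: \<kappa>_def)
  have \<kappa>0: "0 \<le> \<kappa> s" for s by (auto simp: \<kappa>_def intro!: add_nonneg_nonneg sum_nonneg)
  define g where "g s = family_sum K c s - family_diff K c p s" for s
  have bound: "norm (g x - g y) \<le> e * norm (x - y)" if "x \<in> ball p d" "y \<in> ball p d" for x y
  proof (rule differentiable_bound[OF convex_ball _ _ that])
    fix s assume s: "s \<in> ball p d"
    show "(g has_derivative (\<lambda>h. family_diff K c s h - family_diff K c p h)) (at s within ball p d)"
      unfolding g_def
      by (intro has_derivative_diff has_derivative_at_withinI[OF family_sum_has_derivative]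
          bounded_linear_imp_has_derivative bounded_linear_family_diff)
    show "onorm (\<lambda>h. family_diff K c s h - family_diff K c p h) \<le> e"
    proof (rule onorm_bound)
      fix h :: "'n tspace"
      have nth: "norm (snd h $ i) \<le> norm h" for i
        using Finite_Cartesian_Product.norm_nth_le[of "snd h" i] norm_snd_le[of "snd h" "fst h"] by simp
      have fst_le: "norm (fst h) \<le> norm h" using norm_fst_le[of "fst h" "snd h"] by simp
      have "family_diff K c s h - family_diff K c p h =
          (diff_t K c s - diff_t K c p) * fst h + (\<Sum>i\<in>UNIV. (diff_z K c i s - diff_z K c i p) * snd h $ i)"
        by (simp add: family_diff_def algebra_simps sum_subtractf)
      also have "norm \<dots> \<le> norm (diff_t K c s - diff_t K c p) * norm h +
          (\<Sum>i\<in>UNIV. norm (diff_z K c i s - diff_z K c i p) * norm h)"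
        by (intro order_trans[OF norm_triangle_ineq] add_mono order_trans[OF norm_sum] sum_mono)
           (simp_all add: norm_mult mult_left_mono nth fst_le)
      also have "\<dots> = \<kappa> s * norm h" by (simp add: \<kappa>_def distrib_right sum_distrib_right)
      also have "\<dots> \<le> e * norm h"
        using d(2)[of s] s \<kappa>p \<kappa>0[of s] by (intro mult_right_mono) (auto simp: dist_commute dist_real_def)
      finally show "norm (family_diff K c s h - family_diff K c p h) \<le> e * norm h" .
    qed (use assms in simp)
  qed
  have lin: "family_diff K c p (x - y) = family_diff K c p x - family_diff K c p y" for x y
    using bounded_linear.linear[OF bounded_linear_family_diff] by (rule linear_diff)
  have "norm (family_sum K c x - family_sum K c y - family_diff K c p (x - y)) \<le> e * norm (x - y)"
    if "x \<in> ball p d" "y \<in> ball p d" for x y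
    using bound[OF that] unfolding g_def lin by (simp only: diff_diff_eq2 diff_diff_eq add_diff_eq diff_add_eq) (simp add: algebra_simps)
  thus ?thesis using d(1) by blast
qed

text \<open>On secants between zeros of F the differential at p is small compared with the secant
  length; multiplication by \<open>a k\<close> preserves this proportion.\<close>

lemma secant_limit_in_kernel:
  fixes x y :: "nat \<Rightarrow> 'n::finite tspace"
  assumes "x \<longlonglongrightarrow> p" "y \<longlonglongrightarrow> p" "\<And>k. family_sum K c (x k) = 0" "\<And>k. family_sum K c (y k) = 0"
    and v: "(\<lambda>k. cscale (a k) (x k - y k)) \<longlonglongrightarrow> v"
  shows "family_diff K c p v = 0"
proof (rule ccontr)
  assume nz: "family_diff K c p v \<noteq> 0"
  define u where "u k = cscale (a k) (x k - y k)" for k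
  have u: "u \<longlonglongrightarrow> v" using v by (simp add: u_def [abs_def])
  \<comment> \<open>Makes \<open>e * (norm v + 1)\<close> half of the value to be excluded; the 1
    keeps the denominator positive.\<close>
  define e where "e = norm (family_diff K c p v) / (2 * (norm v + 1))"
  have e: "0 < e" using nz by (simp add: e_def add_nonneg_pos)
  obtain d where d: "0 < d" "\<And>x y. x \<in> ball p d \<Longrightarrow> y \<in> ball p d \<Longrightarrow>
      norm (family_sum K c x - family_sum K c y - family_diff K c p (x - y)) \<le> e * norm (x - y)"
    using family_diff_strict[OF e, of p K c] by blast
  have "\<forall>\<^sub>F k in sequentially. norm (family_diff K c p (u k)) \<le> e * norm (u k)"
    using tendstoD[OF assms(1) d(1)] tendstoD[OF assms(2) d(1)]
  proof eventually_elim
    case (elim k)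
    hence "norm (family_diff K c p (x k - y k)) \<le> e * norm (x k - y k)"
      using d(2)[of "x k" "y k"] assms(3,4) by (simp add: dist_commute)
    hence "norm (a k) * norm (family_diff K c p (x k - y k)) \<le> norm (a k) * (e * norm (x k - y k))"
      by (rule mult_left_mono) simp
    thus ?case by (simp add: u_def family_diff_cscale norm_mult mult_ac)
  qed
  moreover have "(\<lambda>k. norm (family_diff K c p (u k))) \<longlonglongrightarrow> norm (family_diff K c p v)"
    by (intro tendsto_norm bounded_linear.tendsto[OF bounded_linear_family_diff u])
  moreover have "(\<lambda>k. e * norm (u k)) \<longlonglongrightarrow> e * norm v" by (intro tendsto_intros u)
  ultimately have "norm (family_diff K c p v) \<le> e * norm v"
    using tendsto_le[OF sequentially_bot] by blast
  also have "\<dots> \<le> e * (norm v + 1)" using e by simp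
  also have "\<dots> = norm (family_diff K c p v) / 2"
  proof -
    have "norm v + 1 \<noteq> 0" by (simp add: add_nonneg_eq_0_iff)
    thus ?thesis unfolding e_def by (simp add: divide_simps)
  qed
  finally show False using nz by simp
qed

lemma tendsto_family_diff:
  assumes "y \<longlonglongrightarrow> p" "u \<longlonglongrightarrow> v"
  shows "(\<lambda>k. family_diff K c (y k) (u k)) \<longlonglongrightarrow> family_diff K c p v"
proof -
  have "(\<lambda>k. diff_t K c (y k)) \<longlonglongrightarrow> diff_t K c p" "(\<lambda>k. diff_z K c i (y k)) \<longlonglongrightarrow> diff_z K c i p" for i
    using continuous_on_diff_t[of UNIV K c] continuous_on_diff_z[of UNIV K c i] assms(1)
      continuous_on_tendsto_compose[of UNIV _ y p sequentially] by auto
  thus ?thesis unfolding family_diff_def by (intro tendsto_intros assms)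
qed

text \<open>Here dF/dz_j has a nonzero limit, so the quotient in \<open>limit_tangent_mem\<close>
  tends to 0 as soon as the differential at p annihilates v.\<close>

lemma secant_limit_at_regular_point:
  fixes x y :: "nat \<Rightarrow> 'n::finite tspace"
  assumes "x \<longlonglongrightarrow> p" "y \<longlonglongrightarrow> p" "\<And>k. x k \<in> hypersurface K c J" "\<And>k. y k \<in> hypersurface K c J"
    and v: "(\<lambda>k. cscale (a k) (x k - y k)) \<longlonglongrightarrow> v"
    and T: "subspaces_tendsto (\<lambda>k. {v \<in> coord_plane J. family_diff K c (y k) v = 0}) T"
    and j: "j \<in> J" "diff_z K c j p \<noteq> 0"
  shows "v \<in> T"
proof (rule limit_tangent_mem[OF T j(1) _ v])
  show "cscale (a k) (x k - y k) \<in> coord_plane J" for k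
    using assms(3,4)[of k] by (intro coord_plane_cscale coord_plane_diff) (auto simp: hypersurface_def)
  have zl: "(\<lambda>k. diff_z K c j (y k)) \<longlonglongrightarrow> diff_z K c j p"
    using continuous_on_tendsto_compose[OF continuous_on_diff_z[of UNIV K c j] assms(2)] by simp
  show "\<forall>\<^sub>F k in sequentially. diff_z K c j (y k) \<noteq> 0"
    by (rule tendsto_imp_eventually_ne[OF zl j(2)])
  have "family_diff K c p v = 0"
    using assms(3,4) by (intro secant_limit_in_kernel[OF assms(1,2) _ _ v]) (auto simp: hypersurface_def)
  thus "(\<lambda>k. family_diff K c (y k) (cscale (a k) (x k - y k)) / diff_z K c j (y k)) \<longlonglongrightarrow> 0"
    using tendsto_divide[OF tendsto_family_diff[OF assms(2) v, of K c] zl j(2)] by simp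
qed

section \<open>Consequences of admissibility\<close>

lemma nonvanishing_sets_eq: "nonvanishing_sets h = - vanishing_sets h"
  by (auto simp: nonvanishing_sets_def vanishing_sets_def)

lemma vanishing_sets_family_at:
  "I \<in> vanishing_sets (family_at f t) \<longleftrightarrow>
     (\<forall>\<alpha>\<in>Poly_Mapping.keys (family_at f t). \<not> supported I \<alpha>)"
proof
  assume I: "I \<in> vanishing_sets (family_at f t)"
  show "\<forall>\<alpha>\<in>Poly_Mapping.keys (family_at f t). \<not> supported I \<alpha>"
  proof (intro ballI notI)
    fix \<alpha> assume \<alpha>: "\<alpha> \<in> Poly_Mapping.keys (family_at f t)" "supported I \<alpha>"
    hence "\<alpha> \<in> Poly_Mapping.keys f" "poly (Poly_Mapping.lookup f \<alpha>) t \<noteq> 0"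
      using keys_family_at_subset by (auto simp: in_keys_iff lookup_family_at)
    from family_sum_nonzero_at[where c = "Poly_Mapping.lookup f", OF finite_keys this(1) \<alpha>(2) this(2)]
    show False using I by (auto simp: vanishing_sets_def poly_fun_family_at total_fun_def)
  qed
next
  assume *: "\<forall>\<alpha>\<in>Poly_Mapping.keys (family_at f t). \<not> supported I \<alpha>"
  have "poly_fun (family_at f t) z = 0" if "z \<in> coord_space I" for z
    unfolding poly_fun_def
    using * monomial_at_eq_0[OF that] by (intro sum.neutral) (auto simp: monomial_at_def)
  thus "I \<in> vanishing_sets (family_at f t)" by (simp add: vanishing_sets_def)
qed

text \<open>The sum of the coordinates outside I is at least 1 on the exponents, hence on the
  polygon, but 0 at an exponent supported in I. Through the common polygon this carries vanishing
  from f_0 to all exponents of f.\<close>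

lemma supported_not_in_newton_polygon:
  assumes "\<forall>\<alpha>\<in>Poly_Mapping.keys h. \<not> supported I \<alpha>" "real_exponent \<beta> \<in> newton_polygon h"
  shows "\<not> supported I \<beta>"
proof
  assume \<beta>: "supported I \<beta>"
  define a :: "real^'a" where "a = (\<chi> i. if i \<in> I then 0 else 1)"
  have "1 \<le> a \<bullet> real_exponent \<alpha>" if \<alpha>: "\<alpha> \<in> Poly_Mapping.keys h" for \<alpha>
  proof -
    obtain i where i: "i \<notin> I" "\<alpha> $ i \<noteq> 0" using bspec[OF assms(1) \<alpha>] unfolding supported_def by blast
    have "1 \<le> a $ i * real_exponent \<alpha> $ i" using i by (simp add: a_def)
    also have "\<dots> \<le> a \<bullet> real_exponent \<alpha>"
      unfolding inner_vec_def inner_real_def by (intro member_le_sum) (auto simp: a_def)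
    finally show ?thesis .
  qed
  hence "1 \<le> a \<bullet> real_exponent \<beta>"
    by (intro newton_polygon_lower_bound[OF _ _ assms(2)]) (auto simp: a_def)
  also have "a \<bullet> real_exponent \<beta> = 0"
    unfolding inner_vec_def inner_real_def using \<beta>
    by (intro sum.neutral) (auto simp: a_def supported_def)
  finally show False by simp
qed

text \<open>The face of w is compact if I is empty and essential otherwise, which decides between
  non-degeneracy and tameness. Since all exponents of f lie in the polygon of f_t, equality of
  weights selects those on the face even if a coefficient vanishes at t.\<close>

lemma tame_face_derivative:
  fixes f :: "'n::finite mpol_family"
  assumes poly: "\<And>\<alpha>. \<alpha> \<in> Poly_Mapping.keys f \<Longrightarrow> real_exponent \<alpha> \<in> newton_polygon (family_at f t)"
    and nondeg: "nondegenerate (family_at f t)"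
    and tame: "\<And>\<Delta> z. essential_face (family_at f t) I \<Delta> \<Longrightarrow> z \<in> coord_torus UNIV \<Longrightarrow>
        (\<Sum>i\<in>I. (norm (z $ i))\<^sup>2) < \<rho>\<^sup>2 \<Longrightarrow> \<not> critical_in (- I) (face_fun (family_at f t) \<Delta>) z"
    and I: "I \<in> vanishing_sets (family_at f t)"
    and sup: "\<not> supported I \<beta>"
    and w: "weight_zeros w = I" "\<beta> \<in> Poly_Mapping.keys f"
      "\<forall>\<alpha>\<in>Poly_Mapping.keys f. weight_value w (real_exponent \<beta>) \<le> weight_value w (real_exponent \<alpha>)"
    and z: "z \<in> coord_torus UNIV" "(\<Sum>i\<in>I. (norm (z $ i))\<^sup>2) < \<rho>\<^sup>2"
  shows "\<exists>j\<in>-I. diff_z {\<alpha>\<in>Poly_Mapping.keys f. weight_value w (real_exponent \<alpha>) = weight_value w (real_exponent \<beta>)}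
      (Poly_Mapping.lookup f) j (t, z) \<noteq> 0"
proof -
  let ?h = "family_at f t"
  let ?\<Delta> = "weight_face ?h w"
  have low: "\<forall>\<alpha>\<in>Poly_Mapping.keys ?h. weight_value w (real_exponent \<beta>) \<le> weight_value w (real_exponent \<alpha>)"
    using w(3) keys_family_at_subset by blast
  have \<beta>: "real_exponent \<beta> \<in> newton_polygon ?h" by (rule poly[OF w(2)])
  have "\<not> critical_in (- I) (face_fun ?h ?\<Delta>) z"
  proof (cases "I = {}")
    case True
    hence "?\<Delta> \<in> compact_faces ?h" using weight_face_compact[OF low \<beta> refl] w(1) by simp
    thus ?thesis using nondeg z(1) True by (auto simp: nondegenerate_def)
  next
    case False
    \<comment> \<open>Were w zero, I would contain all indices and support \<beta>.\<close>
    have "w \<noteq> 0" using sup w(1) by (auto simp: weight_zeros_def supported_def)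
    hence "essential_face ?h I ?\<Delta>"
      using weight_face_essential[OF low \<beta> refl] False w(1) I by simp
    thus ?thesis using tame z by blast
  qed
  moreover have "{\<alpha>\<in>Poly_Mapping.keys f. real_exponent \<alpha> \<in> ?\<Delta>} =
      {\<alpha>\<in>Poly_Mapping.keys f. weight_value w (real_exponent \<alpha>) = weight_value w (real_exponent \<beta>)}"
    using weight_face_eq(1)[OF low \<beta> refl] poly by auto
  ultimately show ?thesis unfolding critical_in_face_fun by auto
qed

text \<open>The radii chosen for f_t vary with t; only their common lower bound \<rho> is kept. As
  \<open>\<rho> \<le> R\<close>, the same ball serves for non-singularity.\<close>

lemma admissible_neighbourhood:
  fixes f :: "'n::finite mpol_family"
  assumes "admissible U f"
  shows "\<exists>\<epsilon>>0. \<exists>\<rho>>0. \<forall>t. norm t < \<epsilon> \<longrightarrow>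
    newton_polygon (family_at f t) = newton_polygon (family_at f 0) \<and>
    nondegenerate (family_at f t) \<and>
    (\<forall>I\<in>vanishing_sets (family_at f t). \<forall>\<Delta>. essential_face (family_at f t) I \<Delta> \<longrightarrow>
       (\<forall>z\<in>coord_torus UNIV. (\<Sum>i\<in>I. (norm (z $ i))\<^sup>2) < \<rho>\<^sup>2 \<longrightarrow>
          \<not> critical_in (- I) (face_fun (family_at f t) \<Delta>) z)) \<and>
    (\<forall>J\<in>nonvanishing_sets (family_at f 0). \<forall>z\<in>fibre_zeros U f t \<inter> coord_torus J \<inter> ball 0 \<rho>.
       \<not> critical_in J (poly_fun (family_at f t)) z)"
proof -
  obtain R r \<rho> where R: "stable_radius U f R"
    and r: "\<forall>\<^sub>F t in nhds 0. tame_choice (family_at f t) (r t)"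
    and \<rho>: "0 < \<rho>" "\<forall>\<^sub>F t in nhds 0. ereal \<rho> \<le> min (ereal R) (radius_nc (r t) (family_at f t))"
    using assms unfolding admissible_def by blast
  have "\<forall>\<^sub>F t in nhds 0. \<forall>J\<in>nonvanishing_sets (family_at f 0).
      \<forall>z\<in>fibre_zeros U f t \<inter> coord_torus J \<inter> ball 0 R. \<not> critical_in J (poly_fun (family_at f t)) z"
  proof (intro eventually_ball_finite ballI)
    fix J assume "J \<in> nonvanishing_sets (family_at f 0)"
    with R have "\<forall>\<^sub>F t in nhds 0.
        (\<forall>z\<in>fibre_zeros U f t \<inter> coord_torus J \<inter> ball 0 R. \<not> critical_in J (poly_fun (family_at f t)) z) \<and>
        (\<forall>r. 0 < r \<and> r < R \<longrightarrow>
           (\<forall>z\<in>fibre_zeros U f t \<inter> coord_torus J \<inter> ball 0 R \<inter> sphere 0 r.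
              transverse_at (fibre_zeros U f t \<inter> coord_torus J \<inter> ball 0 R) (sphere 0 r) z))"
      unfolding stable_radius_def by blast
    thus "\<forall>\<^sub>F t in nhds 0. \<forall>z\<in>fibre_zeros U f t \<inter> coord_torus J \<inter> ball 0 R.
        \<not> critical_in J (poly_fun (family_at f t)) z"
      by (rule eventually_mono) blast
  qed simp
  moreover have "\<forall>\<^sub>F t in nhds 0.
      noncompact_newton_boundary (family_at f t) = noncompact_newton_boundary (family_at f 0)"
    "\<forall>\<^sub>F t in nhds 0. nondegenerate (family_at f t) \<and> locally_tame (family_at f t)"
    using assms unfolding admissible_def by blast+
  ultimately have "\<forall>\<^sub>F t in nhds 0.
    newton_polygon (family_at f t) = newton_polygon (family_at f 0) \<and>
    nondegenerate (family_at f t) \<and>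
    (\<forall>I\<in>vanishing_sets (family_at f t). \<forall>\<Delta>. essential_face (family_at f t) I \<Delta> \<longrightarrow>
       (\<forall>z\<in>coord_torus UNIV. (\<Sum>i\<in>I. (norm (z $ i))\<^sup>2) < \<rho>\<^sup>2 \<longrightarrow>
          \<not> critical_in (- I) (face_fun (family_at f t) \<Delta>) z)) \<and>
    (\<forall>J\<in>nonvanishing_sets (family_at f 0). \<forall>z\<in>fibre_zeros U f t \<inter> coord_torus J \<inter> ball 0 \<rho>.
       \<not> critical_in J (poly_fun (family_at f t)) z)"
    using r \<rho>(2)
  proof eventually_elim
    case (elim t)
    have \<rho>R: "\<rho> \<le> R" "ereal \<rho> \<le> radius_nc (r t) (family_at f t)" using elim by auto
    have "\<not> critical_in (- I) (face_fun (family_at f t) \<Delta>) z"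
      if *: "I \<in> vanishing_sets (family_at f t)" "essential_face (family_at f t) I \<Delta>" "z \<in> coord_torus UNIV"
        "(\<Sum>i\<in>I. (norm (z $ i))\<^sup>2) < \<rho>\<^sup>2" for I \<Delta> z
    proof -
      have "radius_nc (r t) (family_at f t) \<le> radius_along (r t) (family_at f t) I"
        unfolding radius_nc_def by (rule INF_lower[OF *(1)])
      also have "\<dots> \<le> r t \<Delta>"
        unfolding radius_along_def using *(2) by (intro INF_lower) auto
      finally have le: "ereal \<rho> \<le> r t \<Delta>" using \<rho>R by simp
      have "ereal (\<Sum>i\<in>I. (norm (z $ i))\<^sup>2) < ereal (\<rho>\<^sup>2)" using *(4) by simp
      also have "ereal (\<rho>\<^sup>2) \<le> (r t \<Delta>)\<^sup>2"
      proof (cases "r t \<Delta>")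
        case (real x)
        hence "\<rho>\<^sup>2 \<le> x\<^sup>2" using le \<rho>(1) by (intro power_mono) auto
        thus ?thesis using real by simp
      next
        case PInf
        thus ?thesis by (simp add: power2_eq_square)
      next
        case MInf
        thus ?thesis using le by simp
      qed
      finally show ?thesis
        using elim(4) * unfolding tame_choice_def tame_radius_def by blast
    qed
    moreover have "ball 0 \<rho> \<subseteq> ball (0::complex^'n) R" using \<rho>R by (intro subset_ball)
    hence "\<forall>J\<in>nonvanishing_sets (family_at f 0). \<forall>z\<in>fibre_zeros U f t \<inter> coord_torus J \<inter> ball 0 \<rho>.
       \<not> critical_in J (poly_fun (family_at f t)) z"
      using elim(1) by blast
    moreover note newton_polygon_determined[OF elim(2)] conjunct1[OF elim(3)]
    ultimately show ?case by (intro conjI ballI allI impI) simp_all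
  qed
  then obtain \<epsilon> where "0 < \<epsilon>" "\<forall>t. dist t 0 < \<epsilon> \<longrightarrow>
    newton_polygon (family_at f t) = newton_polygon (family_at f 0) \<and>
    nondegenerate (family_at f t) \<and>
    (\<forall>I\<in>vanishing_sets (family_at f t). \<forall>\<Delta>. essential_face (family_at f t) I \<Delta> \<longrightarrow>
       (\<forall>z\<in>coord_torus UNIV. (\<Sum>i\<in>I. (norm (z $ i))\<^sup>2) < \<rho>\<^sup>2 \<longrightarrow>
          \<not> critical_in (- I) (face_fun (family_at f t) \<Delta>) z)) \<and>
    (\<forall>J\<in>nonvanishing_sets (family_at f 0). \<forall>z\<in>fibre_zeros U f t \<inter> coord_torus J \<inter> ball 0 \<rho>.
       \<not> critical_in J (poly_fun (family_at f t)) z)"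
    unfolding eventually_nhds_metric by blast
  thus ?thesis using \<rho>(1)
    by (intro exI[of _ \<epsilon>] exI[of _ \<rho>] conjI) (simp_all only: dist_norm diff_zero)
qed

section \<open>The canonical stratification\<close>

lemma continuous_on_monomial_at: "continuous_on S (\<lambda>q. monomial_at \<alpha> (snd q))"
  unfolding monomial_at_def by (intro continuous_intros)

lemma holo_zero: "holo_fun_on (\<lambda>q. 0) W"
  using holo_family_sum[of "{}" _ W] by (simp add: family_sum_def [abs_def])

lemma whitney_b_regular_open_plane:
  assumes "S1 \<subseteq> coord_plane J" "S2 \<subseteq> coord_plane J" "\<And>q. q \<in> S2 \<Longrightarrow> tangent_space S2 q = coord_plane J"
  shows "whitney_b_regular S2 S1 p"
  unfolding whitney_b_regular_def
proof (intro allI impI, elim conjE)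
  fix x y :: "nat \<Rightarrow> 'a tspace" and a T v
  assume *: "\<forall>k. x k \<in> S1" "\<forall>k. y k \<in> S2" "subspaces_tendsto (\<lambda>k. tangent_space S2 (y k)) T"
    "(\<lambda>k. cscale (a k) (x k - y k)) \<longlonglongrightarrow> v"
  have T: "subspaces_tendsto (\<lambda>k. coord_plane J) T" using * assms(3) by simp
  have "cscale (a k) (x k - y k) \<in> coord_plane J" for k
    using * assms(1,2) by (intro coord_plane_cscale coord_plane_diff) blast+
  from subspaces_tendsto_mem[OF T closed_coord_plane this *(4)] show "v \<in> T" .
qed

lemma torus_eq:
  "UNIV \<times> coord_torus J = {q \<in> coord_plane J. monomial_at (square_free J) (snd q) \<noteq> 0}"
  by (intro set_eqI) (simp only: torus_iff mem_Collect_eq)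

text \<open>The conditions at the points of W are stated pointwise, so they pass to every smaller
  open set, as the quantification over neighbourhoods requires.\<close>

locale whitney_neighbourhood =
  fixes D :: "complex set" and U :: "(complex^'n::finite) set" and f :: "'n mpol_family"
    and W :: "'n tspace set"
  assumes open_W: "open W" and W_sub: "W \<subseteq> D \<times> U"
    and vanishing: "\<And>I \<alpha>. I \<in> vanishing_sets (family_at f 0) \<Longrightarrow> \<alpha> \<in> Poly_Mapping.keys f \<Longrightarrow> \<not> supported I \<alpha>"
    and nonsingular: "\<And>J q. J \<in> nonvanishing_sets (family_at f 0) \<Longrightarrow> q \<in> W \<Longrightarrow>
      q \<in> UNIV \<times> coord_torus J \<Longrightarrow> total_fun f q = 0 \<Longrightarrow>
      \<exists>j\<in>J. diff_z (Poly_Mapping.keys f) (Poly_Mapping.lookup f) j q \<noteq> 0"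
    and tame: "\<And>I p w \<beta> z. I \<in> vanishing_sets (family_at f 0) \<Longrightarrow> p \<in> W \<Longrightarrow> p \<in> UNIV \<times> coord_torus I \<Longrightarrow>
      weight_zeros w = I \<Longrightarrow> \<beta> \<in> Poly_Mapping.keys f \<Longrightarrow>
      (\<forall>\<alpha>\<in>Poly_Mapping.keys f. weight_value w (real_exponent \<beta>) \<le> weight_value w (real_exponent \<alpha>)) \<Longrightarrow>
      z \<in> coord_torus UNIV \<Longrightarrow> (\<forall>i\<in>I. z $ i = snd p $ i) \<Longrightarrow>
      \<exists>j\<in>-I. diff_z {\<alpha>\<in>Poly_Mapping.keys f. weight_value w (real_exponent \<alpha>) = weight_value w (real_exponent \<beta>)}
        (Poly_Mapping.lookup f) j (fst p, z) \<noteq> 0"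
begin

abbreviation "K \<equiv> Poly_Mapping.keys f"
abbreviation "c \<equiv> Poly_Mapping.lookup f"
abbreviation "A \<equiv> stratum_A D U f W"
abbreviation "B \<equiv> stratum_B D U f W"
abbreviation "C \<equiv> stratum_C W"

lemma nonvanishing_supported:
  assumes "J \<in> nonvanishing_sets (family_at f 0)"
  shows "\<exists>\<alpha>\<in>K. supported J \<alpha>"
  using assms keys_family_at_subset[of f 0] unfolding nonvanishing_sets_eq
  by (auto simp: vanishing_sets_family_at)

lemma total_zeros_iff: "q \<in> W \<Longrightarrow> q \<in> total_zeros D U f \<longleftrightarrow> family_sum K c q = 0"
  using W_sub by (cases q) (auto simp: total_zeros_def fibre_zeros_def poly_fun_family_at total_fun_def)

lemma A_eq: "A J = W \<inter> (hypersurface K c J \<inter> (UNIV \<times> coord_torus J))"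
  using total_zeros_iff unfolding stratum_A_def hypersurface_def torus_eq by blast

lemma B_eq: "B J = W \<inter> {q \<in> UNIV \<times> coord_torus J. family_sum K c q \<noteq> 0}"
  using total_zeros_iff unfolding stratum_B_def by blast

lemma C_eq: "C J = W \<inter> (UNIV \<times> coord_torus J)"
  by (simp add: stratum_C_def)

lemma open_near_torus: "open (W \<inter> {q. monomial_at (square_free J) (snd q) \<noteq> 0})"
  by (intro open_Int open_W open_Collect_neq continuous_on_monomial_at continuous_on_const)

lemma A_nbhd:
  assumes "q \<in> A J"
  shows "\<exists>W1. open W1 \<and> q \<in> W1 \<and> hypersurface K c J \<inter> W1 \<subseteq> A J"
  using open_near_torus[of J] assms unfolding A_eq torus_eq
  by (intro exI[of _ "W \<inter> {q. monomial_at (square_free J) (snd q) \<noteq> 0}"])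
     (auto simp: hypersurface_def)

lemma B_nbhd:
  assumes "q \<in> B J"
  shows "\<exists>W1. open W1 \<and> q \<in> W1 \<and> coord_plane J \<inter> W1 \<subseteq> B J"
proof -
  have "open (W \<inter> {q. monomial_at (square_free J) (snd q) \<noteq> 0} \<inter> {q. family_sum K c q \<noteq> 0})"
    by (intro open_Int open_near_torus open_Collect_neq continuous_on_family_sum continuous_on_const)
  thus ?thesis using assms unfolding B_eq torus_eq
    by (intro exI[of _ "W \<inter> {q. monomial_at (square_free J) (snd q) \<noteq> 0} \<inter> {q. family_sum K c q \<noteq> 0}"])
       auto
qed

lemma C_nbhd:
  assumes "q \<in> C J"
  shows "\<exists>W1. open W1 \<and> q \<in> W1 \<and> coord_plane J \<inter> W1 \<subseteq> C J"
  using open_near_torus[of J] assms unfolding C_eq torus_eq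
  by (intro exI[of _ "W \<inter> {q. monomial_at (square_free J) (snd q) \<noteq> 0}"])
     auto

lemma A_subset: "A J \<subseteq> hypersurface K c J" and B_subset: "B J \<subseteq> coord_plane J"
  and C_subset: "C J \<subseteq> coord_plane J"
  unfolding A_eq B_eq C_eq torus_eq by blast+

lemma A_nonsingular:
  assumes "J \<in> nonvanishing_sets (family_at f 0)" "q \<in> A J"
  shows "\<exists>j\<in>J. diff_z K c j q \<noteq> 0"
  using nonsingular[OF assms(1)] assms(2) unfolding A_eq total_fun_def hypersurface_def by blast

lemma tangent_A:
  assumes "J \<in> nonvanishing_sets (family_at f 0)" "q \<in> A J"
  shows "tangent_space (A J) q = {v \<in> coord_plane J. family_diff K c q v = 0}"
proof -
  obtain j where j: "j \<in> J" "diff_z K c j q \<noteq> 0" using A_nonsingular[OF assms] by blast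
  obtain W1 where W1: "open W1" "q \<in> W1" "hypersurface K c J \<inter> W1 \<subseteq> A J"
    using A_nbhd[OF assms(2)] by blast
  show ?thesis
    by (rule tangent_space_hypersurface[OF j assms(2) W1(1,2) A_subset W1(3)])
qed

lemma tangent_B:
  assumes "q \<in> B J"
  shows "tangent_space (B J) q = coord_plane J"
proof -
  obtain W1 where W1: "open W1" "q \<in> W1" "coord_plane J \<inter> W1 \<subseteq> B J" using B_nbhd[OF assms] by blast
  show ?thesis by (rule tangent_space_open_plane[OF B_subset W1(1,2) assms W1(3)])
qed

lemma tangent_C:
  assumes "q \<in> C J"
  shows "tangent_space (C J) q = coord_plane J"
proof -
  obtain W1 where W1: "open W1" "q \<in> W1" "coord_plane J \<inter> W1 \<subseteq> C J" using C_nbhd[OF assms] by blast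
  show ?thesis by (rule tangent_space_open_plane[OF C_subset W1(1,2) assms W1(3)])
qed

lemma submanifold_A:
  assumes "J \<in> nonvanishing_sets (family_at f 0)"
  shows "complex_submanifold (A J)"
proof (cases "J = {}")
  case True
  \<comment> \<open>The empty set offers no index j, so non-singularity forces the stratum to be
    empty.\<close>
  hence "A J = {}" using A_nonsingular[OF assms] by blast
  thus ?thesis using complex_submanifold_open_plane[of "{}"] by simp
next
  case False
  then obtain j0 where "j0 \<in> J" by blast
  thus ?thesis
    by (rule complex_submanifold_hypersurface[OF _ A_subset A_nonsingular[OF assms] A_nbhd])
qed

lemma submanifold_B: "complex_submanifold (B J)"
  by (rule complex_submanifold_open_plane[OF B_subset B_nbhd])

lemma submanifold_C: "complex_submanifold (C J)"
  by (rule complex_submanifold_open_plane[OF C_subset C_nbhd])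

lemma analytic_A:
  assumes "J \<in> nonvanishing_sets (family_at f 0)"
  shows "analytic_subset W (closure (A J) \<inter> W)" "analytic_subset W ((closure (A J) \<inter> W) - A J)"
proof -
  obtain \<alpha> where \<alpha>: "\<alpha> \<in> K" "supported J \<alpha>" using nonvanishing_supported[OF assms] by blast
  obtain K' c' m where m: "supported J m"
    and fct: "\<forall>q\<in>coord_plane J. family_sum K c q = monomial_at m (snd q) * family_sum K' c' q"
    and nz: "\<exists>q\<in>coord_plane J. family_sum K' c' q \<noteq> 0"
      "\<forall>i\<in>J. \<exists>q\<in>coord_plane (J - {i}). family_sum K' c' q \<noteq> 0"
    using ex_reduced_equation[of K c, OF finite_keys _ \<alpha>] by (auto simp: in_keys_iff)
  let ?X = "hypersurface K c J \<inter> (UNIV \<times> coord_torus J)"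
  have cl: "closure ?X = {q \<in> coord_plane J. family_sum K' c' q = 0}"
    using closure_hypersurface_torus[OF m, of K c K' c'] fct nz by (simp add: hypersurface_def)
  have df: "{q \<in> coord_plane J. family_sum K' c' q = 0} - ?X =
      {q \<in> coord_plane J. family_sum K' c' q = 0 \<and> monomial_at (square_free J) (snd q) = 0}"
    using fct unfolding hypersurface_def torus_eq by auto
  show "analytic_subset W (closure (A J) \<inter> W)" "analytic_subset W ((closure (A J) \<inter> W) - A J)"
    unfolding A_eq
    using analytic_closure[OF open_W holo_family_sum holo_monomial_at cl df] by simp_all
qed

lemma analytic_B:
  assumes "J \<in> nonvanishing_sets (family_at f 0)"
  shows "analytic_subset W (closure (B J) \<inter> W)" "analytic_subset W ((closure (B J) \<inter> W) - B J)"
proof -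
  obtain \<alpha> where \<alpha>: "\<alpha> \<in> K" "supported J \<alpha>" using nonvanishing_supported[OF assms] by blast
  let ?X = "{q \<in> UNIV \<times> coord_torus J. family_sum K c q \<noteq> 0}"
  have "\<exists>q\<in>coord_plane J. family_sum K c q \<noteq> 0"
    using ex_family_sum_nonzero[where c = c, OF finite_keys \<alpha>] \<alpha>(1) by (simp add: in_keys_iff)
  \<comment> \<open>The plane is written as the zero set of the constant 0 to fit
    \<open>analytic_closure\<close>.\<close>
  hence cl: "closure ?X = {q \<in> coord_plane J. 0 = (0::complex)}"
    using closure_torus_nonzero[OF line_poly_family_sum] by simp
  have df: "{q \<in> coord_plane J. 0 = (0::complex)} - ?X =
      {q \<in> coord_plane J. 0 = (0::complex) \<and> family_sum K c q * monomial_at (square_free J) (snd q) = 0}"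
    unfolding torus_eq by auto
  show "analytic_subset W (closure (B J) \<inter> W)" "analytic_subset W ((closure (B J) \<inter> W) - B J)"
    unfolding B_eq
    using analytic_closure[OF open_W holo_zero holo_mult[OF holo_family_sum holo_monomial_at] cl df] by simp_all
qed

lemma analytic_C: "analytic_subset W (closure (C J) \<inter> W)" "analytic_subset W ((closure (C J) \<inter> W) - C J)"
proof -
  have "closure {q \<in> UNIV \<times> coord_torus J. (1::complex) \<noteq> 0} = coord_plane J"
    by (rule closure_torus_nonzero[OF line_poly_const], rule bexI[OF _ coord_plane_0]) simp
  hence cl: "closure (UNIV \<times> coord_torus J) = {q \<in> coord_plane J. 0 = (0::complex)}" by simp
  have df: "{q \<in> coord_plane J. 0 = (0::complex)} - UNIV \<times> coord_torus J =
      {q \<in> coord_plane J. 0 = (0::complex) \<and> monomial_at (square_free J) (snd q) = 0}"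
    unfolding torus_eq by auto
  show "analytic_subset W (closure (C J) \<inter> W)" "analytic_subset W ((closure (C J) \<inter> W) - C J)"
    unfolding C_eq
    using analytic_closure[OF open_W holo_zero holo_monomial_at cl df] by simp_all
qed

lemma stratum_cases:
  assumes "S \<in> canonical_stratification D U f W"
  obtains (A) J where "J \<in> nonvanishing_sets (family_at f 0)" "S = A J"
    | (B) J where "J \<in> nonvanishing_sets (family_at f 0)" "S = B J"
    | (C) J where "J \<in> vanishing_sets (family_at f 0)" "S = C J"
  using assms unfolding canonical_stratification_def by blast

lemma stratum_in_torus:
  assumes "S \<in> canonical_stratification D U f W"
  obtains I where "S \<subseteq> W \<inter> (UNIV \<times> coord_torus I)"
  using assms
  by (cases rule: stratum_cases) (unfold A_eq B_eq C_eq, blast+)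

lemma index_subset:
  assumes "p \<in> UNIV \<times> coord_torus I" "p \<in> coord_plane J"
  shows "I \<subseteq> J"
  using assms by (auto simp: coord_torus_def coord_plane_iff)

lemma regular_over_open_plane:
  assumes "S1 \<in> canonical_stratification D U f W" "p \<in> S1" "p \<in> closure S2"
    and "S2 \<subseteq> coord_plane J" "\<And>q. q \<in> S2 \<Longrightarrow> tangent_space S2 q = coord_plane J"
  shows "whitney_b_regular S2 S1 p"
proof -
  obtain I where I: "S1 \<subseteq> W \<inter> (UNIV \<times> coord_torus I)" using stratum_in_torus[OF assms(1)] .
  have "p \<in> coord_plane J" using closure_minimal[OF assms(4) closed_coord_plane] assms(3) by blast
  hence "I \<subseteq> J" using I assms(2) by (intro index_subset) auto
  hence "S1 \<subseteq> coord_plane J" using I torus_iff coord_plane_mono by blast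
  thus ?thesis by (rule whitney_b_regular_open_plane[OF _ assms(4,5)])
qed

lemma regular_A:
  assumes "S1 \<in> canonical_stratification D U f W" "p \<in> S1" "p \<in> closure (A J)"
    and J: "J \<in> nonvanishing_sets (family_at f 0)"
  shows "whitney_b_regular (A J) S1 p"
  unfolding whitney_b_regular_def
proof (intro allI impI, elim conjE)
  fix x y :: "nat \<Rightarrow> 'n tspace" and a T v
  assume x: "\<forall>k. x k \<in> S1" "x \<longlonglongrightarrow> p" and y: "\<forall>k. y k \<in> A J" "y \<longlonglongrightarrow> p"
    and T: "subspaces_tendsto (\<lambda>k. tangent_space (A J) (y k)) T"
    and v: "(\<lambda>k. cscale (a k) (x k - y k)) \<longlonglongrightarrow> v"
  have T': "subspaces_tendsto (\<lambda>k. {v \<in> coord_plane J. family_diff K c (y k) v = 0}) T"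
    using T y(1) tangent_A[OF J] by simp
  have pJ: "p \<in> hypersurface K c J"
    using closure_minimal[OF A_subset closed_hypersurface] assms(3) by blast
  show "v \<in> T"
    using assms(1)
  proof (cases rule: stratum_cases)
    case (A I)
    have pI: "p \<in> A I" using assms(2) A(2) by simp
    have IJ: "I \<subseteq> J" using pI pJ by (intro index_subset[of p]) (auto simp: A_eq hypersurface_def)
    obtain j where j: "j \<in> I" "diff_z K c j p \<noteq> 0" using A_nonsingular[OF A(1) pI] by blast
    \<comment> \<open>Both strata lie in the hypersurface of J, which is regular at p because a
      derivative in a direction of I is already nonzero.\<close>
    have "A I \<subseteq> hypersurface K c J" using A_subset[of I] coord_plane_mono[OF IJ] by (auto simp: hypersurface_def)
    thus ?thesis
      using x(1) y(1) A(2) A_subset[of J] j IJ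
      by (intro secant_limit_at_regular_point[OF x(2) y(2) _ _ v T', of j]) auto
  next
    \<comment> \<open>Impossible: F vanishes on the closed hypersurface containing
      \<open>A J\<close>, hence at p.\<close>
    case (B I)
    thus ?thesis using assms(2) pJ by (simp add: B_eq hypersurface_def)
  next
    case (C I)
    show ?thesis
    proof (rule tangent_limit_at_vanishing_stratum[OF finite_keys nonvanishing_supported[OF J] _ _ _ y(2) _ _ T' v])
      show "\<not> supported I \<alpha>" if "\<alpha> \<in> K" for \<alpha> by (rule vanishing[OF C(1) that])
      show "y k \<in> UNIV \<times> coord_torus J" "family_sum K c (y k) = 0" for k
        using y(1) by (auto simp: A_eq hypersurface_def simp del: mem_Sigma_iff)
      show "x k \<in> coord_plane I" for k using x(1) C(2) C_subset[of I] by blast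
      show pI: "p \<in> UNIV \<times> coord_torus I" using assms(2) C(2) by (simp add: C_eq)
      show "\<exists>j\<in>-I. diff_z {\<alpha>\<in>K. weight_value w (real_exponent \<alpha>) = weight_value w (real_exponent \<beta>)} c j (fst p, z) \<noteq> 0"
        if "weight_zeros w = I" "\<beta> \<in> K"
          "\<forall>\<alpha>\<in>K. weight_value w (real_exponent \<beta>) \<le> weight_value w (real_exponent \<alpha>)"
          "z \<in> coord_torus UNIV" "\<forall>i\<in>I. z $ i = snd p $ i" for w \<beta> z
        using assms(2) C by (intro tame[OF C(1) _ pI that]) (simp add: C_eq)
    qed
  qed
qed

text \<open>The regularity conditions concern single strata or pairs, so subfamilies inherit them.
  V(f) uses the strata of types A and C, the whole neighbourhood all three.\<close>

lemma whitney_stratification_subfamily: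
  assumes "\<S> \<subseteq> canonical_stratification D U f W"
  shows "whitney_stratification W (\<Union>\<S>) \<S>"
  unfolding whitney_stratification_def
proof (intro conjI ballI)
  show "open W" by (rule open_W)
  show "\<Union>\<S> \<subseteq> W" using assms stratum_in_torus by blast
  show "\<Union>\<S> = \<Union>\<S>" ..
  have "finite (canonical_stratification D U f W)"
    unfolding canonical_stratification_def by simp
  thus "locally_finite_in (top_of_set (\<Union>\<S>)) \<S>"
    using assms finite_subset by (intro finite_imp_locally_finite_in) auto
  show "disjoint \<S>"
    unfolding disjoint_def
  proof (intro ballI impI)
    fix S S' assume SS: "S \<in> \<S>" "S' \<in> \<S>" "S \<noteq> S'"
    show "S \<inter> S' = {}"
    proof (rule ccontr)
      assume "S \<inter> S' \<noteq> {}"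
      then obtain q where q: "q \<in> S" "q \<in> S'" by blast
      have un: "I = J" if "q \<in> UNIV \<times> coord_torus I" "q \<in> UNIV \<times> coord_torus J" for I J
        using that by (auto simp: coord_torus_def)
      have S: "S \<in> canonical_stratification D U f W" "S' \<in> canonical_stratification D U f W"
        using SS assms by auto
      show False
        using S(1)
      proof (cases rule: stratum_cases)
        case (A J)
        show ?thesis using S(2)
        proof (cases rule: stratum_cases)
          case (A J')
          thus ?thesis using q SS(3) un[of J J'] \<open>S = A J\<close> by (auto simp: A_eq simp del: mem_Sigma_iff)
        next
          case (B J')
          thus ?thesis using q \<open>S = A J\<close> by (auto simp: A_eq B_eq hypersurface_def)
        next
          case (C J')
          thus ?thesis using q un[of J J'] A by (auto simp: A_eq C_eq nonvanishing_sets_eq simp del: mem_Sigma_iff)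
        qed
      next
        case (B J)
        show ?thesis using S(2)
        proof (cases rule: stratum_cases)
          case (A J')
          thus ?thesis using q \<open>S = B J\<close> by (auto simp: A_eq B_eq hypersurface_def)
        next
          case (B J')
          thus ?thesis using q SS(3) un[of J J'] \<open>S = B J\<close> by (auto simp: B_eq simp del: mem_Sigma_iff)
        next
          case (C J')
          thus ?thesis using q un[of J J'] B by (auto simp: B_eq C_eq nonvanishing_sets_eq simp del: mem_Sigma_iff)
        qed
      next
        case (C J)
        show ?thesis using S(2)
        proof (cases rule: stratum_cases)
          case (A J')
          thus ?thesis using q un[of J J'] C by (auto simp: A_eq C_eq nonvanishing_sets_eq simp del: mem_Sigma_iff)
        next
          case (B J')
          thus ?thesis using q un[of J J'] C by (auto simp: B_eq C_eq nonvanishing_sets_eq simp del: mem_Sigma_iff)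
        next
          case (C J')
          thus ?thesis using q SS(3) un[of J J'] \<open>S = C J\<close> by (auto simp: C_eq simp del: mem_Sigma_iff)
        qed
      qed
    qed
  qed
  fix S assume "S \<in> \<S>"
  hence S: "S \<in> canonical_stratification D U f W" using assms by blast
  show "complex_submanifold S" "analytic_subset W (closure S \<inter> W)" "analytic_subset W ((closure S \<inter> W) - S)"
    using S by (cases rule: stratum_cases;
        simp add: submanifold_A submanifold_B submanifold_C analytic_A analytic_B analytic_C)+
next
  fix S1 S2 p assume *: "S1 \<in> \<S>" "S2 \<in> \<S>" "p \<in> S1 \<inter> closure S2"
  hence S1: "S1 \<in> canonical_stratification D U f W" and S2: "S2 \<in> canonical_stratification D U f W"
    using assms by auto
  show "whitney_b_regular S2 S1 p"
    using S2
  proof (cases rule: stratum_cases)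
    case (A J)
    thus ?thesis using regular_A[OF S1] * by simp
  next
    case (B J)
    thus ?thesis using regular_over_open_plane[OF S1 _ _ B_subset tangent_B] * by simp
  next
    case (C J)
    thus ?thesis using regular_over_open_plane[OF S1 _ _ C_subset tangent_C] * by simp
  qed
qed

lemma in_own_torus: "q \<in> UNIV \<times> coord_torus {i. snd q $ i \<noteq> 0}"
  by (auto simp: coord_torus_def mem_Times_iff)

lemma Union_canonical: "\<Union>(canonical_stratification D U f W) = W"
proof
  show "\<Union>(canonical_stratification D U f W) \<subseteq> W" using stratum_in_torus by blast
  show "W \<subseteq> \<Union>(canonical_stratification D U f W)"
  proof
    fix q assume q: "q \<in> W"
    let ?I = "{i. snd q $ i \<noteq> 0}"
    have "q \<in> (if ?I \<in> vanishing_sets (family_at f 0) then C ?I else A ?I \<union> B ?I)"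
      using q in_own_torus[of q] torus_iff unfolding A_eq B_eq C_eq hypersurface_def by auto
    thus "q \<in> \<Union>(canonical_stratification D U f W)"
      unfolding canonical_stratification_def nonvanishing_sets_eq by (auto split: if_splits)
  qed
qed

lemma whitney_stratification_canonical:
  "whitney_stratification W W (canonical_stratification D U f W)"
  using whitney_stratification_subfamily[OF subset_refl] unfolding Union_canonical .

lemma whitney_stratification_zeros:
  "whitney_stratification W (W \<inter> total_zeros D U f)
     (A ` nonvanishing_sets (family_at f 0) \<union> C ` vanishing_sets (family_at f 0))"
proof -
  have "family_sum K c q = 0" if "J \<in> vanishing_sets (family_at f 0)" "q \<in> C J" for J q
    unfolding family_sum_def
    using C_subset[of J] that vanishing[OF that(1)]
    by (intro sum.neutral ballI) (auto simp: coord_plane_def mem_Times_iff intro!: monomial_at_eq_0)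
  moreover have "C J \<subseteq> W" "A J \<subseteq> W" for J unfolding C_eq A_eq by blast+
  ultimately have "\<Union>(A ` nonvanishing_sets (family_at f 0) \<union> C ` vanishing_sets (family_at f 0)) \<subseteq> W \<inter> total_zeros D U f"
    using total_zeros_iff A_subset unfolding hypersurface_def by blast
  moreover have "W \<inter> total_zeros D U f \<subseteq> \<Union>(A ` nonvanishing_sets (family_at f 0) \<union> C ` vanishing_sets (family_at f 0))"
  proof
    fix q assume q: "q \<in> W \<inter> total_zeros D U f"
    hence "q \<in> \<Union>(canonical_stratification D U f W)" using Union_canonical by blast
    thus "q \<in> \<Union>(A ` nonvanishing_sets (family_at f 0) \<union> C ` vanishing_sets (family_at f 0))"
      using q unfolding canonical_stratification_def stratum_B_def by blast
  qed
  ultimately have eq: "\<Union>(A ` nonvanishing_sets (family_at f 0) \<union> C ` vanishing_sets (family_at f 0)) = W \<inter> total_zeros D U f"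
    by blast
  have "A ` nonvanishing_sets (family_at f 0) \<union> C ` vanishing_sets (family_at f 0) \<subseteq> canonical_stratification D U f W"
    unfolding canonical_stratification_def by blast
  from whitney_stratification_subfamily[OF this] show ?thesis unfolding eq .
qed

end

section \<open>Choice of the neighbourhood\<close>

theorem theorem3p6:
  fixes U :: "(complex^'n::finite) set" and D :: "complex set" and d :: real
    and f :: "'n mpol_family"
  assumes "open U" and "0 \<in> U"
    and "0 < d" and "D = ball 0 d"
    and "\<forall>t\<in>D. poly_fun (family_at f t) 0 = 0"
    and "admissible U f"
  shows "(\<exists>W0. open W0 \<and> (0, 0) \<in> W0 \<and> W0 \<subseteq> D \<times> U \<and>
            (\<forall>W. open W \<and> (0, 0) \<in> W \<and> W \<subseteq> W0 \<longrightarrow>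
               whitney_stratification W W (canonical_stratification D U f W)))
         \<and> whitney_equisingular D U f"
proof -
  obtain \<epsilon> \<rho> where \<epsilon>: "0 < \<epsilon>" and \<rho>: "0 < \<rho>"
    and polygon: "\<And>t. norm t < \<epsilon> \<Longrightarrow> newton_polygon (family_at f t) = newton_polygon (family_at f 0)"
    and nondeg: "\<And>t. norm t < \<epsilon> \<Longrightarrow> nondegenerate (family_at f t)"
    and tame: "\<And>t I \<Delta> z. norm t < \<epsilon> \<Longrightarrow> I \<in> vanishing_sets (family_at f t) \<Longrightarrow>
      essential_face (family_at f t) I \<Delta> \<Longrightarrow> z \<in> coord_torus UNIV \<Longrightarrow>
      (\<Sum>i\<in>I. (norm (z $ i))\<^sup>2) < \<rho>\<^sup>2 \<Longrightarrow> \<not> critical_in (- I) (face_fun (family_at f t) \<Delta>) z"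
    and regular: "\<And>t J z. norm t < \<epsilon> \<Longrightarrow> J \<in> nonvanishing_sets (family_at f 0) \<Longrightarrow>
      z \<in> fibre_zeros U f t \<inter> coord_torus J \<inter> ball 0 \<rho> \<Longrightarrow> \<not> critical_in J (poly_fun (family_at f t)) z"
    using admissible_neighbourhood[OF assms(6)] by (elim exE conjE) (rule that; blast)
  let ?K = "Poly_Mapping.keys f" and ?c = "Poly_Mapping.lookup f"
  \<comment> \<open>The coefficient is a nonzero polynomial in t, hence nonzero at some s near 0;
    \<alpha> is then an exponent of f_s, whose polygon is the common one.\<close>
  have in_polygon: "real_exponent \<alpha> \<in> newton_polygon (family_at f t)" if "\<alpha> \<in> ?K" "norm t < \<epsilon>" for \<alpha> t
  proof -
    have "?c \<alpha> \<noteq> 0" using that(1) by (simp add: in_keys_iff)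
    then obtain s where s: "norm s < \<epsilon>" "poly (?c \<alpha>) s \<noteq> 0" using ex_small_nonroot \<epsilon> by blast
    hence "\<alpha> \<in> Poly_Mapping.keys (family_at f s)" by (simp add: in_keys_iff lookup_family_at)
    hence "real_exponent \<alpha> \<in> newton_polygon (family_at f s)" by (rule real_exponent_in_newton_polygon)
    thus ?thesis using polygon[OF s(1)] polygon[OF that(2)] by simp
  qed
  have vanishing: "\<not> supported I \<alpha>" if "I \<in> vanishing_sets (family_at f 0)" "\<alpha> \<in> ?K" for I \<alpha>
    using supported_not_in_newton_polygon in_polygon[OF that(2), of 0] that(1) \<epsilon>
    unfolding vanishing_sets_family_at by simp
  have vanishing_t: "I \<in> vanishing_sets (family_at f t)" if "I \<in> vanishing_sets (family_at f 0)" for I t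
    using vanishing[OF that] keys_family_at_subset[of f t] unfolding vanishing_sets_family_at by blast
  \<comment> \<open>\<epsilon> secures the conditions in t, d keeps t in D, and \<rho> bounds z for
    both tameness and non-singularity.\<close>
  define W0 where "W0 = (ball 0 (min \<epsilon> d) :: complex set) \<times> (U \<inter> ball 0 \<rho>)"
  have W0: "open W0" "(0, 0) \<in> W0" "W0 \<subseteq> D \<times> U"
    using assms \<epsilon> \<rho> by (auto simp: W0_def intro!: open_Times)
  have in_W0: "norm (fst q) < \<epsilon>" "snd q \<in> U" "norm (snd q) < \<rho>" "fst q \<in> D" if "q \<in> W0" for q
    using that assms(4) by (auto simp: W0_def)
  have nbhd: "whitney_neighbourhood D U f W" if W: "open W" "W \<subseteq> W0" for W
  proof
    show "open W" "W \<subseteq> D \<times> U" using W W0 by auto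
    show "\<not> supported I \<alpha>" if "I \<in> vanishing_sets (family_at f 0)" "\<alpha> \<in> ?K" for I \<alpha>
      by (rule vanishing[OF that])
    show "\<exists>j\<in>J. diff_z ?K ?c j q \<noteq> 0"
      if J: "J \<in> nonvanishing_sets (family_at f 0)" and q: "q \<in> W" "q \<in> UNIV \<times> coord_torus J" "total_fun f q = 0" for J q
    proof -
      have q0: "q \<in> W0" using q(1) W(2) by blast
      have "snd q \<in> fibre_zeros U f (fst q) \<inter> coord_torus J \<inter> ball 0 \<rho>"
        using in_W0[OF q0] q(2,3) by (simp add: fibre_zeros_def poly_fun_family_at mem_Times_iff)
      from regular[OF in_W0(1)[OF q0] J this] show ?thesis
        unfolding critical_in_total_fun by simp
    qed
    show "\<exists>j\<in>-I. diff_z {\<alpha>\<in>?K. weight_value w (real_exponent \<alpha>) = weight_value w (real_exponent \<beta>)} ?c j (fst p, z) \<noteq> 0"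
      if I: "I \<in> vanishing_sets (family_at f 0)" and p: "p \<in> W" "p \<in> UNIV \<times> coord_torus I"
        and w: "weight_zeros w = I" "\<beta> \<in> ?K"
          "\<forall>\<alpha>\<in>?K. weight_value w (real_exponent \<beta>) \<le> weight_value w (real_exponent \<alpha>)"
        and z: "z \<in> coord_torus UNIV" "\<forall>i\<in>I. z $ i = snd p $ i" for I p w \<beta> z
    proof -
      have p0: "p \<in> W0" using p(1) W(2) by blast
      note t = in_W0(1)[OF p0]
      have "(\<Sum>i\<in>I. (norm (z $ i))\<^sup>2) = (\<Sum>i\<in>I. (norm (snd p $ i))\<^sup>2)"
        using z(2) by (intro sum.cong) auto
      also have "\<dots> \<le> (\<Sum>i\<in>UNIV. (norm (snd p $ i))\<^sup>2)" by (intro sum_mono2) auto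
      also have "\<dots> = (norm (snd p))\<^sup>2" by (simp add: norm_vec_def L2_set_def sum_nonneg)
      also have "\<dots> < \<rho>\<^sup>2" using in_W0(3)[OF p0] by (intro power_strict_mono) auto
      finally have small: "(\<Sum>i\<in>I. (norm (z $ i))\<^sup>2) < \<rho>\<^sup>2" .
      show ?thesis
        by (rule tame_face_derivative[OF in_polygon[OF _ t] nondeg[OF t] tame[OF t vanishing_t[OF I]]
              vanishing_t[OF I] vanishing[OF I w(2)] w z(1) small])
    qed
  qed
  have "whitney_equisingular D U f"
    unfolding whitney_equisingular_def
  proof (intro exI conjI)
    show "open W0" "(0, 0) \<in> W0" "W0 \<subseteq> D \<times> U" by (fact W0)+
    show "whitney_stratification W0 (W0 \<inter> total_zeros D U f)
        (stratum_A D U f W0 ` nonvanishing_sets (family_at f 0) \<union> stratum_C W0 ` vanishing_sets (family_at f 0))"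
      by (rule whitney_neighbourhood.whitney_stratification_zeros[OF nbhd[OF W0(1) subset_refl]])
    \<comment> \<open>Since f_0 vanishes at the origin, the empty index set is vanishing, and its
      stratum is the t-axis.\<close>
    have "coord_space {} = {0::complex^'n}" by (auto simp: coord_space_def vec_eq_iff)
    hence "{} \<in> vanishing_sets (family_at f 0)"
      using assms(3-5) by (simp add: vanishing_sets_def)
    moreover have "coord_torus {} = {0::complex^'n}" by (auto simp: coord_torus_def vec_eq_iff)
    hence "stratum_C W0 {} = W0 \<inter> (D \<times> {0})"
      using W0(3) by (auto simp: stratum_C_def)
    ultimately show "W0 \<inter> (D \<times> {0}) \<in>
        stratum_A D U f W0 ` nonvanishing_sets (family_at f 0) \<union> stratum_C W0 ` vanishing_sets (family_at f 0)"
      by (metis UnI2 imageI)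
  qed
  moreover have "whitney_stratification W W (canonical_stratification D U f W)" if "open W" "W \<subseteq> W0" for W
    by (rule whitney_neighbourhood.whitney_stratification_canonical[OF nbhd[OF that]])
  ultimately show ?thesis using W0 by blast
qed

end
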